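(* Let $\alpha\in(\pi,3\pi/2)$ and let $\nu\in\mathcal N$. Assume that $$\lim_{x\to\infty}\frac{\nu(x)}{x}=\lim_{x\to-\infty}\frac{\nu(x)}{x}=\frac{\gamma}{2}\sqrt{\tan\alpha}.$$ Then, with probability one, $$\lim_{t\to\infty}\frac{X_\nu(t)}{t}=\frac{1}{\tan\alpha},$$ where $X_\nu(t)$ is the location at time $t$ of the second-class particle started at the origin.
   Context: Model. Let $\mathbf P\subset\mathbb R^2$ be a Poisson point process of intensity one. To each $\mathbf p\in\mathbf P$ attach a positive weight $\omega_{\mathbf p}$; the weights are i.i.d. with distribution function $F$ and independent of $\mathbf P$. Assume that $\int_0^\infty e^{ax}\,dF(x)<\infty$ for some $a>0$. Write $\mathbf p\le\mathbf q$ for inequality in each coordinate. For $\mathbf p\le\mathbf q$, let $\Pi(\mathbf p,\mathbf q)$ be the set of up-right (coordinatewise nondecreasing) paths from $\mathbf p$ to $\mathbf q$ consisting of points of $\mathbf P$ in the rectangle between $\mathbf p$ and $\mathbf q$, with the starting point $\mathbf p$ excluded, and put $L(\mathbf p,\mathbf q)=\max_{\varpi\in\Pi(\mathbf p,\mathbf q)}\sum_{\mathbf p'\in\varpi}\omega_{\mathbf p'}$ (equal to $0$ if there are no points). Put $\gamma=\gamma(F)=\sup_{n\ge1}\mathbb E[L((0,0),(n,n))]/n$, which is positive and finite. Measures. For a positive locally finite measure $\nu$ on $\mathbb R$ put $\nu(x)=\nu([0,x])$ for $x\ge0$ and $\nu(x)=-\nu((x,0))$ for $x<0$. $\mathcal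 N$ is the set of such measures with $\liminf_{y\to-\infty}\nu(y)/y>0$. Hammersley interacting fluid system. For $\nu\in\mathcal N$, $x\in\mathbb R$, $t\ge0$ put $L_\nu(x,t)=\sup_{z\le x}\{\nu(z)+L((z,0),(x,t))\}$, and let $M_t^\nu$ be the measure with $M_t^\nu((x,y])=L_\nu(y,t)-L_\nu(x,t)$. For $x\ge0$ write $M^\nu_t(x)=M^\nu_t([0,x])$. Second-class particle. Fix $\varepsilon>0$ and let $\bar\nu=\nu+\varepsilon\delta_0$ (an extra mass $\varepsilon$ at $0$). With $M_t^\nu$ and $M_t^{\bar\nu}$ built from the same weighted Poisson points, $X_\nu(t)=\inf\{x\ge0:M_t^{\bar\nu}(x)=M_t^\nu(x)+\varepsilon\}$. (This does not depend on $\varepsilon$.) *)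

theory Defs
  imports "HOL-Probability.Probability"
begin

text \<open>
  The order on \<^typ>\<open>real \<times> real\<close> is the coordinatewise one, so \<open>{a..b}\<close> is the closed rectangle
  between \<open>a\<close> and \<open>b\<close>.

  A weighted point configuration is an injective enumeration \<open>p :: nat \<Rightarrow> real \<times> real\<close> of its points
  together with \<open>w :: nat \<Rightarrow> real\<close>, where \<open>w i\<close> is the weight of the point \<open>p i\<close>.
\<close>

section \<open>The weighted Poisson process\<close>

text \<open>
  The condition \<open>poisson_count\<close> also covers sets of measure zero, since \<open>0 ^ 0 = 1\<close>. In
  \<open>points_weights_indep\<close> the two sigma-algebras are those generated by the whole family of
  points and by the whole family of weights.
\<close>

locale weighted_poisson_process = prob_space M for M :: "'a measure" +
  fixes p :: "nat \<Rightarrow> 'a \<Rightarrow> real \<times> real"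
    and w :: "nat \<Rightarrow> 'a \<Rightarrow> real"
    and F :: "real \<Rightarrow> real"
  assumes points_measurable: "\<And>i. random_variable borel (p i)"
    and points_distinct: "\<And>\<omega>. \<omega> \<in> space M \<Longrightarrow> inj (\<lambda>i. p i \<omega>)"
    and points_locally_finite: "\<And>\<omega> B. \<omega> \<in> space M \<Longrightarrow> bounded B \<Longrightarrow> finite {i. p i \<omega> \<in> B}"
    and poisson_count: "\<And>B k. B \<in> sets borel \<Longrightarrow> bounded B \<Longrightarrow>
      prob {\<omega> \<in> space M. card {i. p i \<omega> \<in> B} = k} =
        measure lborel B ^ k / fact k * exp (- measure lborel B)"
    and counts_indep: "\<And>(B :: nat \<Rightarrow> (real \<times> real) set) m.
      (\<And>j. j < m \<Longrightarrow> B j \<in> sets borel \<and> bounded (B j)) \<Longrightarrow> disjoint_family_on B {..<m} \<Longrightarrow>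
      indep_vars (\<lambda>_. count_space UNIV) (\<lambda>j \<omega>. card {i. p i \<omega> \<in> B j}) {..<m}"
    and weights_positive: "\<And>i \<omega>. \<omega> \<in> space M \<Longrightarrow> 0 < w i \<omega>"
    and weights_indep: "indep_vars (\<lambda>_. borel) w UNIV"
    and weights_distribution: "\<And>i. cdf (distr M borel (w i)) = F"
    and points_weights_indep: "indep_set
      (sets (vimage_algebra (space M) (\<lambda>\<omega> i. p i \<omega>) (\<Pi>\<^sub>M i\<in>UNIV. borel)))
      (sets (vimage_algebra (space M) (\<lambda>\<omega> i. w i \<omega>) (\<Pi>\<^sub>M i\<in>UNIV. borel)))"

section \<open>Last-passage percolation\<close>

text \<open>
  A path is given by the list of the indices of its points. The strict order makes the points
  pairwise distinct and coordinatewise nondecreasing.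
\<close>

definition up_right_paths ::
    "(nat \<Rightarrow> real \<times> real) \<Rightarrow> real \<times> real \<Rightarrow> real \<times> real \<Rightarrow> nat list set" where
  "up_right_paths p a b =
     {is. sorted_wrt (\<lambda>i j. p i < p j) is \<and> p ` set is \<subseteq> {a..b} - {a}}"

definition last_passage ::
    "(nat \<Rightarrow> real \<times> real) \<Rightarrow> (nat \<Rightarrow> real) \<Rightarrow> real \<times> real \<Rightarrow> real \<times> real \<Rightarrow> real" where
  "last_passage p w a b = Max ((\<lambda>is. \<Sum>i\<leftarrow>is. w i) ` up_right_paths p a b)"

definition lpp_gamma ::
    "'a measure \<Rightarrow> (nat \<Rightarrow> 'a \<Rightarrow> real \<times> real) \<Rightarrow> (nat \<Rightarrow> 'a \<Rightarrow> real) \<Rightarrow> real" where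
  "lpp_gamma M p w =
     (SUP n\<in>{1::nat..}.
        (\<integral>\<omega>. last_passage (\<lambda>i. p i \<omega>) (\<lambda>i. w i \<omega>) (0, 0) (real n, real n) \<partial>M) / real n)"

section \<open>The fluid system\<close>

definition mass_function :: "real measure \<Rightarrow> real \<Rightarrow> real" where
  "mass_function \<nu> x = (if 0 \<le> x then measure \<nu> {0..x} else - measure \<nu> {x<..<0})"

definition fluid_measures :: "real measure set" where
  "fluid_measures =
     {\<nu>. sets \<nu> = sets borel \<and> (\<forall>a b. emeasure \<nu> {a..b} < \<infinity>) \<and>
         Liminf at_bot (\<lambda>y. ereal (mass_function \<nu> y / y)) > 0}"

text \<open>
  The supremum is taken in \<^typ>\<open>real\<close>; for \<open>\<nu> \<in> fluid_measures\<close> it is almost surely finite, for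
  all \<open>x\<close> and \<open>t \<ge> 0\<close> simultaneously, and then it is nondecreasing and right-continuous in \<open>x\<close>, so
  that \<^const>\<open>interval_measure\<close> yields the measure with these increments.
\<close>

definition fluid_height ::
    "(nat \<Rightarrow> real \<times> real) \<Rightarrow> (nat \<Rightarrow> real) \<Rightarrow> real measure \<Rightarrow> real \<Rightarrow> real \<Rightarrow> real" where
  "fluid_height p w \<nu> x t = (SUP z\<in>{..x}. mass_function \<nu> z + last_passage p w (z, 0) (x, t))"

definition fluid_evolution ::
    "(nat \<Rightarrow> real \<times> real) \<Rightarrow> (nat \<Rightarrow> real) \<Rightarrow> real measure \<Rightarrow> real \<Rightarrow> real measure" where
  "fluid_evolution p w \<nu> t = interval_measure (\<lambda>x. fluid_height p w \<nu> x t)"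

section \<open>The second-class particle\<close>

definition add_atom :: "real \<Rightarrow> real measure \<Rightarrow> real measure" where
  "add_atom \<epsilon> \<nu> =
     measure_of (space \<nu>) (sets \<nu>) (\<lambda>A. emeasure \<nu> A + ennreal \<epsilon> * indicator A 0)"

text \<open>The infimum is taken in \<^typ>\<open>ereal\<close>, so that it is \<open>\<infinity>\<close> for the empty set.\<close>

definition second_class_particle ::
    "(nat \<Rightarrow> real \<times> real) \<Rightarrow> (nat \<Rightarrow> real) \<Rightarrow> real \<Rightarrow> real measure \<Rightarrow> real \<Rightarrow> ereal" where
  "second_class_particle p w \<epsilon> \<nu> t =
     (INF x\<in>{x. 0 \<le> x \<and>
           mass_function (fluid_evolution p w (add_atom \<epsilon> \<nu>) t) x =
           mass_function (fluid_evolution p w \<nu> t) x + \<epsilon>}. ereal x)"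

lemma emeasure_add_atom:
  assumes "A \<in> sets \<nu>"
  shows "emeasure (add_atom \<epsilon> \<nu>) A = emeasure \<nu> A + ennreal \<epsilon> * indicator A 0"
proof (rule emeasure_measure_of[OF add_atom_def])
  show "sets \<nu> \<subseteq> Pow (space \<nu>)" by (rule sets.space_closed)
  show "A \<in> sets (add_atom \<epsilon> \<nu>)" using assms by (simp add: add_atom_def)
  show "positive (sets (add_atom \<epsilon> \<nu>)) (\<lambda>A. emeasure \<nu> A + ennreal \<epsilon> * indicator A 0)"
    by (simp add: positive_def)
  show "countably_additive (sets (add_atom \<epsilon> \<nu>)) (\<lambda>A. emeasure \<nu> A + ennreal \<epsilon> * indicator A 0)"
  proof (rule countably_additiveI)
    fix B :: "nat \<Rightarrow> real set"
    assume B: "range B \<subseteq> sets (add_atom \<epsilon> \<nu>)" "disjoint_family B"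
    have B': "range B \<subseteq> sets \<nu>" using B by (simp add: add_atom_def)
    have "(\<Sum>i. emeasure \<nu> (B i) + ennreal \<epsilon> * indicator (B i) 0) =
        (\<Sum>i. emeasure \<nu> (B i)) + (\<Sum>i. ennreal \<epsilon> * indicator (B i) 0)"
      by (rule suminf_add[symmetric]) auto
    also have "(\<Sum>i. ennreal \<epsilon> * indicator (B i) 0) = ennreal \<epsilon> * (\<Sum>i. indicator (B i) 0)"
      by simp
    also have "(\<Sum>i. indicator (B i) 0 :: ennreal) = indicator (\<Union>i. B i) 0"
      by (rule suminf_indicator[OF B(2)])
    finally show "(\<Sum>i. emeasure \<nu> (B i) + ennreal \<epsilon> * indicator (B i) 0) =
        emeasure \<nu> (\<Union>i. B i) + ennreal \<epsilon> * indicator (\<Union>i. B i) 0"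
      using suminf_emeasure[OF B' B(2)] by simp
  qed
qed

end

theory Submission
  imports Defs "HOL-Real_Asymp.Real_Asymp"
begin

text \<open>
  The second-class particle sits at the first \<open>x \<ge> 0\<close> for which a maximiser of
  \<open>z \<mapsto> \<nu>(z) + L((z, 0), (x, t))\<close> can be taken in \<open>{0..x}\<close> rather than in \<open>{..<0}\<close>. If
  \<open>\<nu>\<close> has slope \<open>\<rho>\<close> on both sides, the rescaled functional for \<open>x = c t\<close> is close to
  \<open>\<rho> z + \<gamma> \<surd>(c - z) = \<rho> (c + c\<^sub>0) - \<rho> (\<surd>(c - z) - \<surd>c\<^sub>0)\<^sup>2\<close> with
  \<open>\<gamma> = 2 \<rho> \<surd>c\<^sub>0\<close>. Its maximiser \<open>c - c\<^sub>0\<close> changes sign at \<open>c = c\<^sub>0 = 1 / tan \<alpha>\<close>.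

  The probabilistic input is \<open>L((a t, 0), (b t, t)) / t \<rightarrow> \<gamma> \<surd>(b - a)\<close> almost surely. Since the
  starting point moves with \<open>t\<close>, this does not follow from the subadditive ergodic theorem. The
  means converge because the law of \<open>L\<close> depends on the area of the rectangle only and by
  superadditivity. For the fluctuations, \<open>L\<close> is the limit of last-passage times on fine grids with
  independent compound Poisson weights, and the Efron--Stein inequality bounds the variance of \<open>L\<close> on a
  rectangle of area \<open>s\<^sup>2\<close> by a multiple of \<open>s\<^sup>3\<^sup>/\<^sup>2\<close>: removing a box changes \<open>L\<close> only if the box
  meets the optimal path, and then by at most its weight. Chebyshev and Borel--Cantelli give
  convergence along \<open>t = j\<^sup>4\<close>, and monotonicity fills the gaps.
\<close>

section \<open>Last-passage times of a configuration\<close>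

text \<open>Everything pathwise is proved for one fixed \<open>weighted_configuration\<close>;
  chance enters only through one almost sure event, the limits at rational endpoints. The exponent
  3/2 comes from splitting the box weights at the level sqrt s: boxes below it contribute at most
  sqrt s times L, whose mean is of order s, and boxes above it are controlled by fourth moments of
  total order s^2, divided by s. At time T, Chebyshev then leaves T^(-1/2), which is j^(-2) for T =
  j^4. The fourth moments must add up to a bound free of the mesh, so the moment of a single box has
  to be linear in its area. Efron--Stein is proved for bounded functions, which shapes the limits: L
  is truncated at R, the mesh goes to 0 with R fixed, and only then R grows. The exponential moment
  of the weights serves twice: for the fourth moments and, by a union bound over the chains of a
  coarse grid, for the linear growth of the mean of L.\<close>

locale weighted_configuration =
  fixes p :: "nat \<Rightarrow> real \<times> real" and w :: "nat \<Rightarrow> real"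
  assumes inj_points: "inj p"
    and locally_finite: "bounded B \<Longrightarrow> finite {i. p i \<in> B}"
    and weight_pos: "0 < w i"
begin

definition points_in :: "real \<times> real \<Rightarrow> real \<times> real \<Rightarrow> nat set" where
  "points_in a b = {i. p i \<in> {a..b} - {a}}"

lemma finite_points_in: "finite (points_in a b)"
  unfolding points_in_def by (rule locally_finite) (simp add: bounded_diff)

lemma up_right_paths_eq:
  "up_right_paths p a b = {is. sorted_wrt (\<lambda>i j. p i < p j) is \<and> set is \<subseteq> points_in a b}"
  by (auto simp: up_right_paths_def points_in_def)

lemma sorted_distinct: "sorted_wrt (\<lambda>i j. p i < p j) is \<Longrightarrow> distinct is"
  by (induction "is") auto

lemma finite_up_right_paths: "finite (up_right_paths p a b)"
proof (rule finite_subset)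
  show "up_right_paths p a b \<subseteq> {is. set is \<subseteq> points_in a b \<and> distinct is}"
    by (auto simp: up_right_paths_eq sorted_distinct)
  show "finite {is. set is \<subseteq> points_in a b \<and> distinct is}"
    by (rule finite_subset_distinct[OF finite_points_in])
qed

lemma Nil_in_up_right_paths: "[] \<in> up_right_paths p a b"
  by (simp add: up_right_paths_def)

lemma last_passage_upper: "is \<in> up_right_paths p a b \<Longrightarrow> (\<Sum>i\<leftarrow>is. w i) \<le> last_passage p w a b"
  unfolding last_passage_def using finite_up_right_paths by (intro Max_ge) auto

lemma last_passage_attained:
  obtains "is" where "is \<in> up_right_paths p a b" "last_passage p w a b = (\<Sum>i\<leftarrow>is. w i)"
proof -
  have "last_passage p w a b \<in> (\<lambda>is. \<Sum>i\<leftarrow>is. w i) ` up_right_paths p a b"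
    unfolding last_passage_def
    using Nil_in_up_right_paths[of a b] by (intro Max_in finite_imageI finite_up_right_paths) blast
  then show ?thesis using that by auto
qed

lemma last_passage_nonneg: "0 \<le> last_passage p w a b"
  using last_passage_upper[OF Nil_in_up_right_paths] by simp

lemma last_passage_mono_points:
  assumes "points_in a b \<subseteq> points_in a' b'"
  shows "last_passage p w a b \<le> last_passage p w a' b'"
proof -
  obtain "is" where "is \<in> up_right_paths p a b" "last_passage p w a b = (\<Sum>i\<leftarrow>is. w i)"
    by (rule last_passage_attained)
  moreover from this assms have "is \<in> up_right_paths p a' b'"
    by (auto simp: up_right_paths_eq)
  ultimately show ?thesis using last_passage_upper by metis
qed

lemma last_passage_cong_points:
  "points_in a b = points_in a' b' \<Longrightarrow> last_passage p w a b = last_passage p w a' b'"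
  by (simp add: last_passage_def up_right_paths_eq)

lemma last_passage_empty: "points_in a b = {} \<Longrightarrow> last_passage p w a b = 0"
  using last_passage_attained[of a b] by (force simp: up_right_paths_eq)

lemma last_passage_mono:
  assumes "a' \<le> a" "b \<le> b'"
  shows "last_passage p w a b \<le> last_passage p w a' b'"
proof (rule last_passage_mono_points)
  show "points_in a b \<subseteq> points_in a' b'"
  proof
    fix i assume "i \<in> points_in a b"
    then have i: "a \<le> p i" "p i \<le> b" "p i \<noteq> a" by (auto simp: points_in_def)
    \<comment> \<open>The larger rectangle excludes its own corner: \<open>p i = a'\<close> would
      squeeze \<open>a\<close> between \<open>a'\<close> and \<open>p i\<close>, so that
      \<open>p i = a\<close>.\<close>
    have "p i \<noteq> a'" using i assms(1) by (metis order.antisym)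
    then show "i \<in> points_in a' b'"
      using i assms by (auto simp: points_in_def intro: order.trans)
  qed
qed

text \<open>Excluding the starting corner makes the junction \<open>b\<close> count only once: a
  point there may end the first path but cannot open the second, so the concatenation is strictly
  increasing.\<close>

lemma last_passage_superadditive:
  assumes "a \<le> b" "b \<le> c"
  shows "last_passage p w a b + last_passage p w b c \<le> last_passage p w a c"
proof -
  obtain xs where xs: "xs \<in> up_right_paths p a b" "last_passage p w a b = (\<Sum>i\<leftarrow>xs. w i)"
    by (rule last_passage_attained)
  obtain ys where ys: "ys \<in> up_right_paths p b c" "last_passage p w b c = (\<Sum>i\<leftarrow>ys. w i)"
    by (rule last_passage_attained)
  have x: "a \<le> p i" "p i \<le> b" "p i \<noteq> a" if "i \<in> set xs" for i
    using xs that by (auto simp: up_right_paths_def)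
  have y: "b \<le> p i" "p i \<le> c" "p i \<noteq> b" if "i \<in> set ys" for i
    using ys that by (auto simp: up_right_paths_def)
  have less: "p i < p j" if "i \<in> set xs" "j \<in> set ys" for i j
    using x(2)[OF that(1)] y(1,3)[OF that(2)] by (metis order.not_eq_order_implies_strict order.strict_trans1)
  have "p i \<in> {a..c} - {a}" if "i \<in> set (xs @ ys)" for i
  proof -
    have "i \<in> set xs \<or> i \<in> set ys" using that by simp
    then show ?thesis
    proof
      assume i: "i \<in> set xs"
      show ?thesis using x[OF i] assms by (simp add: order.trans[OF _ assms(2)])
    next
      assume i: "i \<in> set ys"
      have "p i \<noteq> a" using y(1,3)[OF i] assms(1) by (metis order.antisym)
      then show ?thesis using y[OF i] order.trans[OF assms(1)] by simp
    qed
  qed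
  then have "p ` set (xs @ ys) \<subseteq> {a..c} - {a}" by (rule image_subsetI)
  moreover have "sorted_wrt (\<lambda>i j. p i < p j) (xs @ ys)"
    using xs ys less by (simp add: up_right_paths_def sorted_wrt_append)
  ultimately have "xs @ ys \<in> up_right_paths p a c"
    unfolding up_right_paths_def by blast
  from last_passage_upper[OF this] show ?thesis using xs ys by simp
qed

text \<open>A maximal point of a chain is its greatest point, so its index can be put last;
  \<open>inj_points\<close> makes the comparison of different indices strict.\<close>

lemma finite_chain_enumeration:
  assumes "finite I" "\<And>i j. i \<in> I \<Longrightarrow> j \<in> I \<Longrightarrow> p i \<le> p j \<or> p j \<le> p i"
  shows "\<exists>is. sorted_wrt (\<lambda>i j. p i < p j) is \<and> set is = I"
  using assms
proof (induction "card I" arbitrary: I)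
  case 0
  then show ?case by auto
next
  case (Suc n)
  have "finite (p ` I)" "p ` I \<noteq> {}" using Suc by auto
  from finite_has_maximal[OF this] obtain m where
    m: "m \<in> I" "\<And>i. i \<in> I \<Longrightarrow> p m \<le> p i \<Longrightarrow> p m = p i" by auto
  have "n = card (I - {m})" using Suc m by simp
  from Suc.hyps(1)[OF this] Suc.prems obtain "is" where
    "is": "sorted_wrt (\<lambda>i j. p i < p j) is" "set is = I - {m}" by auto
  have "p i < p m" if "i \<in> I - {m}" for i
    using Suc.prems(2)[of i m] m that inj_points
    by (auto simp: inj_def less_le)
  then have "sorted_wrt (\<lambda>i j. p i < p j) (is @ [m])" "set (is @ [m]) = I"
    using "is" m by (auto simp: sorted_wrt_append)
  then show ?case by blast
qed

lemma chain_sum_le_last_passage: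
  assumes "I \<subseteq> points_in a b" "\<And>i j. i \<in> I \<Longrightarrow> j \<in> I \<Longrightarrow> p i \<le> p j \<or> p j \<le> p i"
  shows "sum w I \<le> last_passage p w a b"
proof -
  have "finite I" using assms finite_points_in finite_subset by blast
  from finite_chain_enumeration[OF this assms(2)] obtain "is" where
    "is": "sorted_wrt (\<lambda>i j. p i < p j) is" "set is = I" by auto
  have "sum w I = (\<Sum>i\<leftarrow>is. w i)"
    using sorted_distinct[OF "is"(1)] "is"(2) by (simp add: sum_list_distinct_conv_sum_set)
  also have "\<dots> \<le> last_passage p w a b"
    using "is" assms by (intro last_passage_upper) (auto simp: up_right_paths_eq)
  finally show ?thesis .
qed

text \<open>Together with \<open>chain_sum_le_last_passage\<close> this presents the passage time as
  a maximum over chains of indices, the form in which it can be compared with chains of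
  boxes.\<close>

lemma last_passage_chain:
  obtains I where "I \<subseteq> points_in a b" "last_passage p w a b = sum w I"
    "\<And>i j. i \<in> I \<Longrightarrow> j \<in> I \<Longrightarrow> p i \<le> p j \<or> p j \<le> p i"
proof -
  obtain xs where xs: "xs \<in> up_right_paths p a b" "last_passage p w a b = (\<Sum>i\<leftarrow>xs. w i)"
    by (rule last_passage_attained)
  have s: "sorted_wrt (\<lambda>i j. p i < p j) xs" using xs by (simp add: up_right_paths_eq)
  show ?thesis
  proof (rule that[of "set xs"])
    show "set xs \<subseteq> points_in a b" using xs by (simp add: up_right_paths_eq)
    show "last_passage p w a b = sum w (set xs)"
      using xs sorted_distinct[OF s] by (simp add: sum_list_distinct_conv_sum_set)
    fix i j assume "i \<in> set xs" "j \<in> set xs"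
    then show "p i \<le> p j \<or> p j \<le> p i" using s
      by (induction xs) (auto simp: less_le)
  qed
qed

end

section \<open>The grid model\<close>

text \<open>The order is the weak coordinatewise one, so a chain may use several boxes of one row or
  column. This matters because comparable points may share a row or column of boxes.\<close>

definition grid_chains :: "nat \<Rightarrow> nat \<Rightarrow> (nat \<times> nat) set set" where
  "grid_chains m n = {C. C \<subseteq> {..<m} \<times> {..<n} \<and> (\<forall>x\<in>C. \<forall>y\<in>C. x \<le> y \<or> y \<le> x)}"

definition grid_passage :: "nat \<Rightarrow> (nat \<times> nat \<Rightarrow> real) \<Rightarrow> real" where
  "grid_passage n W = Max ((\<lambda>C. \<Sum>B\<in>C. W B) ` grid_chains n n)"

lemma finite_grid_chains [simp]: "finite (grid_chains m n)"
  by (rule finite_subset[of _ "Pow ({..<m} \<times> {..<n})"]) (auto simp: grid_chains_def)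

lemma empty_grid_chain [simp]: "{} \<in> grid_chains m n"
  by (simp add: grid_chains_def)

lemma finite_grid_chain: "C \<in> grid_chains m n \<Longrightarrow> finite C"
  by (rule finite_subset[of _ "{..<m} \<times> {..<n}"]) (auto simp: grid_chains_def)

lemma grid_passage_upper: "C \<in> grid_chains n n \<Longrightarrow> (\<Sum>B\<in>C. W B) \<le> grid_passage n W"
  unfolding grid_passage_def by (intro Max_ge) auto

lemma grid_passage_attained:
  obtains C where "C \<in> grid_chains n n" "grid_passage n W = (\<Sum>B\<in>C. W B)"
proof -
  have "grid_passage n W \<in> (\<lambda>C. \<Sum>B\<in>C. W B) ` grid_chains n n"
    unfolding grid_passage_def
    using empty_grid_chain[of n n] by (intro Max_in finite_imageI finite_grid_chains) blast
  then show ?thesis using that by auto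
qed

lemma grid_passage_nonneg: "0 \<le> grid_passage n W"
  using grid_passage_upper[OF empty_grid_chain, of W n] by simp

lemma grid_chains_0: "m = 0 \<or> n = 0 \<Longrightarrow> grid_chains m n = {{}}"
  by (auto simp: grid_chains_def)

text \<open>Boxes (m, b) with b < n and (a, n) with a < m are incomparable, so a chain without the
  corner (m, n) misses the last column or the last row. This drives the inductions on the size and
  the number of chains.\<close>

lemma grid_chain_Suc:
  assumes C: "C \<in> grid_chains (Suc m) (Suc n)"
  obtains D where "D \<in> grid_chains m (Suc n) \<union> grid_chains (Suc m) n" "C = D \<or> C = insert (m, n) D"
proof (rule that[of "C - {(m, n)}"])
  have chain: "x \<le> y \<or> y \<le> x" if "x \<in> C" "y \<in> C" for x y
    using C that by (auto simp: grid_chains_def)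
  have "C - {(m, n)} \<subseteq> {..<m} \<times> {..<Suc n} \<or> C - {(m, n)} \<subseteq> {..<Suc m} \<times> {..<n}"
  proof (rule ccontr)
    assume "\<not> ?thesis"
    then obtain x y where xy: "x \<in> C" "x \<noteq> (m, n)" "x \<notin> {..<m} \<times> {..<Suc n}"
      "y \<in> C" "y \<noteq> (m, n)" "y \<notin> {..<Suc m} \<times> {..<n}" by blast
    have "x \<in> {..<Suc m} \<times> {..<Suc n}" "y \<in> {..<Suc m} \<times> {..<Suc n}"
      using xy C unfolding grid_chains_def by blast+
    then obtain a b where "x = (m, b)" "y = (a, n)" "a < m" "b < n"
      using xy by (cases x; cases y) (auto simp: less_Suc_eq)
    then show False using chain[OF xy(1,4)] by auto
  qed
  then show "C - {(m, n)} \<in> grid_chains m (Suc n) \<union> grid_chains (Suc m) n"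
    using chain unfolding grid_chains_def by blast
qed blast

lemma card_grid_chain: "C \<in> grid_chains m n \<Longrightarrow> card C \<le> m + n"
proof (induction m arbitrary: n C)
  case (Suc m)
  note IH = Suc.IH
  show ?case using Suc.prems
  proof (induction n arbitrary: C)
    case (Suc n)
    obtain D where D: "D \<in> grid_chains m (Suc n) \<union> grid_chains (Suc m) n" "C = D \<or> C = insert (m, n) D"
      by (rule grid_chain_Suc[OF Suc.prems])
    have "card D \<le> Suc (m + n)" using D(1) IH[of D "Suc n"] Suc.IH[of D] by auto
    moreover have "card C \<le> Suc (card D)" using D(2) card_insert_le_m1[of "Suc (card D)" D] by auto
    ultimately show ?case by simp
  qed (simp add: grid_chains_0)
qed (simp add: grid_chains_0)

text \<open>A chain of the larger grid comes from one of two smaller grids, with or without the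
  corner: at most 2 * 2 * 4^(m + n + 1) possibilities.\<close>

lemma card_grid_chains: "card (grid_chains m n) \<le> 4 ^ (m + n)"
proof (induction m arbitrary: n)
  case (Suc m)
  note IH = Suc
  show ?case
  proof (induction n)
    case (Suc n)
    define U where "U = grid_chains m (Suc n) \<union> grid_chains (Suc m) n"
    have fin: "finite U" by (simp add: U_def)
    have "grid_chains (Suc m) (Suc n) \<subseteq> U \<union> insert (m, n) ` U"
    proof
      fix C assume "C \<in> grid_chains (Suc m) (Suc n)"
      then show "C \<in> U \<union> insert (m, n) ` U" by (rule grid_chain_Suc) (auto simp: U_def)
    qed
    then have "card (grid_chains (Suc m) (Suc n)) \<le> card (U \<union> insert (m, n) ` U)"
      using fin by (intro card_mono) auto
    also have "\<dots> \<le> card U + card (insert (m, n) ` U)" by (rule card_Un_le)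
    also have "\<dots> \<le> 2 * card U" using card_image_le[OF fin, of "insert (m, n)"] by simp
    also have "card U \<le> card (grid_chains m (Suc n)) + card (grid_chains (Suc m) n)"
      unfolding U_def by (rule card_Un_le)
    finally show ?case using IH[of "Suc n"] Suc by simp
  qed (simp add: grid_chains_0)
qed (simp add: grid_chains_0)

text \<open>
  Concavity of \<open>min \<cdot> R\<close>, applied to the sum of the weights along an optimal chain, is what makes
  the truncated increments summable.
\<close>

lemma min_increment_le:
  fixes T v R :: real
  assumes "0 \<le> v" "v \<le> T" "0 < T" "0 \<le> R"
  shows "min T R - min (T - v) R \<le> v / T * min T R"
proof (cases "T \<le> R")
  case True
  then show ?thesis using assms by (simp add: min_def)
next
  case False
  show ?thesis
  proof (cases "T - v \<le> R")
    case True
    have "0 \<le> (T - R) * (T - v)" using False assms by simp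
    then have "(R - (T - v)) * T \<le> v * R" by (simp add: algebra_simps)
    then show ?thesis using True False assms by (simp add: min_def field_simps)
  next
    case F2: False
    then show ?thesis using False assms by (simp add: min_def)
  qed
qed

text \<open>Let D be the effect of deleting box B. If \<open>W B \<le> u\<close>, then D^2 is at
  most u D; otherwise D^2 is at most \<open>W B ^ 4 / u\<^sup>2\<close>. The linear terms add up to
  at most u times the value itself, however many boxes there are.\<close>

lemma grid_increments_le:
  fixes W :: "nat \<times> nat \<Rightarrow> real" and R u :: real
  assumes W: "\<And>B. B \<in> {..<n} \<times> {..<n} \<Longrightarrow> 0 \<le> W B" and R: "0 \<le> R" and u: "0 < u"
  defines "f \<equiv> \<lambda>V. min (grid_passage n V) R"
  shows "(\<Sum>B\<in>{..<n} \<times> {..<n}. (f W - f (W(B := 0)))\<^sup>2) \<le>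
    u * f W + (\<Sum>B\<in>{..<n} \<times> {..<n}. W B ^ 4) / u\<^sup>2"
proof -
  obtain C where C: "C \<in> grid_chains n n" "grid_passage n W = (\<Sum>B\<in>C. W B)"
    by (rule grid_passage_attained)
  have CJ: "C \<subseteq> {..<n} \<times> {..<n}" using C(1) by (auto simp: grid_chains_def)
  have fin: "finite C" by (rule finite_grid_chain[OF C(1)])
  define T where "T = grid_passage n W"
  have T0: "0 \<le> T" by (simp add: T_def grid_passage_nonneg)
  have le_T: "grid_passage n (W(B := 0)) \<le> T" if "B \<in> {..<n} \<times> {..<n}" for B
  proof -
    obtain C' where C': "C' \<in> grid_chains n n" "grid_passage n (W(B := 0)) = (\<Sum>b\<in>C'. (W(B := 0)) b)"
      by (rule grid_passage_attained)
    have "(\<Sum>b\<in>C'. (W(B := 0)) b) \<le> (\<Sum>b\<in>C'. W b)"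
      using W[OF that] by (intro sum_mono) auto
    then show ?thesis using C' grid_passage_upper[OF C'(1), of W] by (simp add: T_def)
  qed
  have ge_T: "T - (if B \<in> C then W B else 0) \<le> grid_passage n (W(B := 0))" for B
  proof -
    have "(\<Sum>b\<in>C. (W(B := 0)) b) = (\<Sum>b\<in>C. W b - (if b = B then W B else 0))"
      by (intro sum.cong) auto
    also have "\<dots> = T - (if B \<in> C then W B else 0)"
      using fin C by (simp add: sum_subtractf T_def)
    finally show ?thesis using grid_passage_upper[OF C(1), of "W(B := 0)"] by simp
  qed
  define D where "D B = f W - f (W(B := 0))" for B
  have D0: "0 \<le> D B" if "B \<in> {..<n} \<times> {..<n}" for B
    using le_T[OF that] by (auto simp: D_def f_def T_def min_def)
  have DW: "D B \<le> W B" if "B \<in> {..<n} \<times> {..<n}" for B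
    using ge_T[of B] W[OF that] by (auto simp: D_def f_def T_def min_def split: if_splits)
  have Dout: "D B = 0" if "B \<in> {..<n} \<times> {..<n}" "B \<notin> C" for B
    using ge_T[of B] le_T[OF that(1)] that by (simp add: D_def f_def T_def)
  \<comment> \<open>Only boxes of the optimal chain \<open>C\<close> count, and deleting B costs at
    most the fraction \<open>W B / T\<close> of the truncated value; over \<open>C\<close> these
    fractions add up to 1. The case \<open>T = 0\<close> is separate because of the
    division.\<close>
  have sumD: "(\<Sum>B\<in>{..<n} \<times> {..<n}. D B) \<le> f W"
  proof (cases "T = 0")
    case True
    have "D B \<le> 0" if "B \<in> {..<n} \<times> {..<n}" for B
      using True grid_passage_nonneg[of n "W(B := 0)"] R by (auto simp: D_def f_def T_def min_def)
    then have "(\<Sum>B\<in>{..<n} \<times> {..<n}. D B) \<le> 0" by (intro sum_nonpos) auto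
    also have "0 \<le> f W" using T0 R by (simp add: f_def T_def)
    finally show ?thesis .
  next
    case False
    then have T1: "0 < T" using T0 by simp
    have "(\<Sum>B\<in>{..<n} \<times> {..<n}. D B) = (\<Sum>B\<in>C. D B)"
      using Dout CJ by (intro sum.mono_neutral_right) auto
    also have "\<dots> \<le> (\<Sum>B\<in>C. W B / T * f W)"
    proof (rule sum_mono)
      fix B assume B: "B \<in> C"
      then have BJ: "B \<in> {..<n} \<times> {..<n}" using CJ by blast
      have "W B \<le> (\<Sum>b\<in>C. W b)"
        using B fin CJ W by (intro member_le_sum) auto
      then have "W B \<le> T" using C by (simp add: T_def)
      from min_increment_le[OF W[OF BJ] this T1 R]
      have "min T R - min (T - W B) R \<le> W B / T * f W" by (simp add: f_def T_def)
      moreover have "D B \<le> min T R - min (T - W B) R"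
        using ge_T[of B] B by (auto simp: D_def f_def T_def min_def)
      ultimately show "D B \<le> W B / T * f W" by simp
    qed
    also have "\<dots> = (\<Sum>B\<in>C. W B) / T * f W"
      by (simp add: sum_divide_distrib sum_distrib_right)
    also have "\<dots> = f W" using T1 C by (simp add: T_def)
    finally show ?thesis .
  qed
  have "(D B)\<^sup>2 \<le> u * D B + W B ^ 4 / u\<^sup>2" if B: "B \<in> {..<n} \<times> {..<n}" for B
  proof (cases "W B \<le> u")
    case True
    have "(D B)\<^sup>2 \<le> u * D B" unfolding power2_eq_square
      using True DW[OF B] D0[OF B] by (intro mult_right_mono) auto
    then show ?thesis by (simp add: add_increasing2)
  next
    case False
    have "(D B)\<^sup>2 \<le> (W B)\<^sup>2" using DW[OF B] D0[OF B] by (intro power_mono) auto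
    moreover have "u\<^sup>2 * (W B)\<^sup>2 \<le> (W B)\<^sup>2 * (W B)\<^sup>2"
      using False u by (intro mult_right_mono power_mono) auto
    then have "(W B)\<^sup>2 \<le> W B ^ 4 / u\<^sup>2"
      using u by (simp add: field_simps power2_eq_square power4_eq_xxxx)
    moreover have "0 \<le> u * D B" using u D0[OF B] by simp
    ultimately show ?thesis by linarith
  qed
  then have "(\<Sum>B\<in>{..<n} \<times> {..<n}. (D B)\<^sup>2) \<le> (\<Sum>B\<in>{..<n} \<times> {..<n}. u * D B + W B ^ 4 / u\<^sup>2)"
    by (intro sum_mono) auto
  also have "\<dots> = u * (\<Sum>B\<in>{..<n} \<times> {..<n}. D B) + (\<Sum>B\<in>{..<n} \<times> {..<n}. W B ^ 4) / u\<^sup>2"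
    by (simp add: sum.distrib sum_distrib_left sum_divide_distrib)
  also have "\<dots> \<le> u * f W + (\<Sum>B\<in>{..<n} \<times> {..<n}. W B ^ 4) / u\<^sup>2"
    using sumD u by simp
  finally show ?thesis by (simp add: D_def)
qed

section \<open>Subdivision of a rectangle into boxes\<close>

definition cell :: "real \<Rightarrow> real \<Rightarrow> nat \<Rightarrow> real \<Rightarrow> nat" where
  "cell x0 x1 n x = nat \<lfloor>(x - x0) * real n / (x1 - x0)\<rfloor>"

text \<open>Half-open intervals make the boxes disjoint, at the price of losing the top and right
  sides of the rectangle; these carry no point almost surely.\<close>

definition grid_interval :: "real \<Rightarrow> real \<Rightarrow> nat \<Rightarrow> nat \<Rightarrow> real set" where
  "grid_interval x0 x1 n i =
    {x0 + real i * ((x1 - x0) / real n)..<x0 + (real i + 1) * ((x1 - x0) / real n)}"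

definition grid_box :: "real \<times> real \<Rightarrow> real \<times> real \<Rightarrow> nat \<Rightarrow> nat \<times> nat \<Rightarrow> (real \<times> real) set" where
  "grid_box a b n B =
    grid_interval (fst a) (fst b) n (fst B) \<times> grid_interval (snd a) (snd b) n (snd B)"

text \<open>In \<open>cell\<close>, \<open>nat\<close> sends every point left of \<open>x0\<close>
  to cell 0, hence the separate condition on \<open>x0\<close> here.\<close>

lemma mem_grid_interval_iff:
  assumes "x0 < x1" "0 < n"
  shows "x \<in> grid_interval x0 x1 n i \<longleftrightarrow> x0 \<le> x \<and> cell x0 x1 n x = i"
proof -
  define r where "r = (x - x0) * real n / (x1 - x0)"
  define d where "d = (x1 - x0) / real n"
  have x: "x = x0 + r * d" using assms by (simp add: r_def d_def)
  have pos: "0 < d" using assms by (simp add: d_def)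
  have 1: "x \<in> grid_interval x0 x1 n i \<longleftrightarrow> real i \<le> r \<and> r < real i + 1"
    unfolding grid_interval_def d_def[symmetric] x using pos by simp
  have 2: "x0 \<le> x \<longleftrightarrow> 0 \<le> r" unfolding x using pos by (simp add: zero_le_mult_iff)
  have 3: "cell x0 x1 n x = nat \<lfloor>r\<rfloor>" by (simp add: cell_def r_def)
  show ?thesis unfolding 1 2 3 by linarith
qed

lemma cell_mono:
  assumes "x0 < x1" "x \<le> y" shows "cell x0 x1 n x \<le> cell x0 x1 n y"
  unfolding cell_def using assms
  by (intro nat_mono floor_mono divide_right_mono mult_right_mono) auto

lemma cell_less:
  assumes "x0 < x1" "x0 \<le> x" "x < x1" "0 < n" shows "cell x0 x1 n x < n"
proof -
  have "(x - x0) * real n / (x1 - x0) < real n" using assms by (simp add: field_simps)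
  moreover have "0 \<le> (x - x0) * real n / (x1 - x0)" using assms by simp
  ultimately show ?thesis unfolding cell_def by linarith
qed

text \<open>In units of the mesh the distance from \<open>x\<close> to \<open>y\<close> is
  \<open>d * real n\<close>; once it reaches 1 the integer parts differ.\<close>

lemma eventually_cell_less:
  assumes "x0 < x1" "x0 \<le> x" "x < y"
  shows "\<forall>\<^sub>F n in sequentially. cell x0 x1 n x < cell x0 x1 n y"
proof -
  define d where "d = (y - x) / (x1 - x0)"
  have "0 < d" using assms by (simp add: d_def)
  have "\<forall>\<^sub>F n in sequentially. 1 / d \<le> real n"
    by real_asymp
  then show ?thesis
  proof eventually_elim
    case (elim n)
    then have "1 \<le> d * real n" using \<open>0 < d\<close> by (simp add: field_simps)
    also have "d * real n = (y - x0) * real n / (x1 - x0) - (x - x0) * real n / (x1 - x0)"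
      unfolding d_def diff_divide_distrib[symmetric] by (simp add: algebra_simps)
    finally have "(x - x0) * real n / (x1 - x0) + 1 \<le> (y - x0) * real n / (x1 - x0)" by simp
    moreover have "0 \<le> (x - x0) * real n / (x1 - x0)" using assms by simp
    ultimately show ?case unfolding cell_def by linarith
  qed
qed

lemma bounded_grid_box: "bounded (grid_box a b n B)"
  unfolding grid_box_def grid_interval_def by (intro bounded_Times) auto

lemma disjoint_grid_box:
  assumes "fst a < fst b" "snd a < snd b" "0 < n"
  shows "disjoint_family (grid_box a b n)"
  unfolding disjoint_family_on_def grid_box_def
  using assms by (force simp: mem_grid_interval_iff)

definition box_weight ::
    "(nat \<Rightarrow> real \<times> real) \<Rightarrow> (nat \<Rightarrow> real) \<Rightarrow> (real \<times> real) set \<Rightarrow> real" where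
  "box_weight p w B = (\<Sum>i\<in>{i. p i \<in> B}. w i)"

section \<open>Comparison of passage times with the grid of box weights\<close>

context weighted_configuration
begin

lemma finite_in_grid_box: "finite {i. p i \<in> grid_box a b n B}"
  by (rule locally_finite[OF bounded_grid_box])

lemma box_weight_nonneg: "0 \<le> box_weight p w B"
  unfolding box_weight_def using weight_pos by (intro sum_nonneg) (auto intro: less_imp_le)

lemma sum_box_weight:
  assumes "fst a < fst b" "snd a < snd b" "0 < n" "finite C"
  shows "(\<Sum>B\<in>C. box_weight p w (grid_box a b n B)) = sum w (\<Union>B\<in>C. {i. p i \<in> grid_box a b n B})"
  unfolding box_weight_def
proof (rule sum.UNION_disjoint[symmetric, OF assms(4)])
  show "\<forall>B\<in>C. finite {i. p i \<in> grid_box a b n B}" using finite_in_grid_box by blast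
  have "grid_box a b n B \<inter> grid_box a b n B' = {}" if "B \<noteq> B'" for B B'
    using disjoint_grid_box[OF assms(1-3)] that unfolding disjoint_family_on_def by blast
  then show "\<forall>B\<in>C. \<forall>B'\<in>C. B \<noteq> B' \<longrightarrow>
    {i. p i \<in> grid_box a b n B} \<inter> {i. p i \<in> grid_box a b n B'} = {}" by blast
qed

text \<open>The boxes visited by an optimal path form a grid chain, because \<open>cell\<close> is
  monotone, and their weights include those of the whole path. This holds for every mesh;
  \<open>interior\<close> keeps the path inside the half-open boxes.\<close>

lemma last_passage_le_grid_passage:
  assumes ab: "fst a < fst b" "snd a < snd b" and n: "0 < n"
    and interior: "\<And>i. i \<in> points_in a b \<Longrightarrow> fst (p i) < fst b \<and> snd (p i) < snd b"
  shows "last_passage p w a b \<le> grid_passage n (\<lambda>B. box_weight p w (grid_box a b n B))"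
proof -
  obtain I where I: "I \<subseteq> points_in a b" "last_passage p w a b = sum w I"
    "\<And>i j. i \<in> I \<Longrightarrow> j \<in> I \<Longrightarrow> p i \<le> p j \<or> p j \<le> p i" by (rule last_passage_chain) blast
  define k where "k i = (cell (fst a) (fst b) n (fst (p i)), cell (snd a) (snd b) n (snd (p i)))" for i
  have fin: "finite I" using I finite_points_in finite_subset by blast
  have low: "fst a \<le> fst (p i)" "snd a \<le> snd (p i)" if "i \<in> I" for i
    using I(1) that by (auto simp: points_in_def less_eq_prod_def)
  have mem: "p i \<in> grid_box a b n (k i)" if "i \<in> I" for i
    using low[OF that] ab n
    by (cases "p i") (auto simp: grid_box_def mem_grid_interval_iff k_def)
  have "k ` I \<in> grid_chains n n"
    unfolding grid_chains_def
  proof (intro CollectI conjI ballI)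
    show "k ` I \<subseteq> {..<n} \<times> {..<n}"
      using low interior I(1) ab n by (auto simp: k_def intro!: cell_less)
    have mono: "k i \<le> k j" if "p i \<le> p j" for i j
      using that ab by (auto simp: k_def less_eq_prod_def intro!: cell_mono)
    fix x y assume "x \<in> k ` I" "y \<in> k ` I"
    then show "x \<le> y \<or> y \<le> x" using I(3) mono by blast
  qed
  have "sum w I \<le> sum w (\<Union>B\<in>k ` I. {i. p i \<in> grid_box a b n B})"
    using fin mem finite_in_grid_box weight_pos
    by (intro sum_mono2) (auto intro: less_imp_le)
  also have "\<dots> = (\<Sum>B\<in>k ` I. box_weight p w (grid_box a b n B))"
    using fin by (intro sum_box_weight[symmetric] ab n) auto
  also have "\<dots> \<le> grid_passage n (\<lambda>B. box_weight p w (grid_box a b n B))"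
    by (rule grid_passage_upper) fact
  finally show ?thesis using I by simp
qed

text \<open>
  Once the mesh separates the finitely many points of the rectangle in both coordinates, comparable
  boxes contain comparable points.
\<close>

lemma eventually_last_passage_eq_grid_passage:
  assumes ab: "fst a < fst b" "snd a < snd b"
    and interior: "\<And>i. i \<in> points_in a b \<Longrightarrow> fst (p i) < fst b \<and> snd (p i) < snd b"
    and corner: "\<And>i. p i \<noteq> a"
  shows "\<forall>\<^sub>F n in sequentially.
    grid_passage n (\<lambda>B. box_weight p w (grid_box a b n B)) = last_passage p w a b"
proof -
  define k where "k n i = (cell (fst a) (fst b) n (fst (p i)), cell (snd a) (snd b) n (snd (p i)))"
    for n i
  have sep: "\<forall>\<^sub>F n in sequentially. k n i \<le> k n j \<longrightarrow> p i \<le> p j"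
    if "i \<in> points_in a b" "j \<in> points_in a b" for i j
  proof (cases "p i \<le> p j")
    case False
    have low: "a \<le> p i" "a \<le> p j" using that by (auto simp: points_in_def)
    from False consider "fst (p j) < fst (p i)" | "snd (p j) < snd (p i)"
      by (auto simp: less_eq_prod_def)
    then show ?thesis
    proof cases
      case 1
      have "fst a \<le> fst (p j)" using low by (simp add: less_eq_prod_def)
      from eventually_cell_less[OF ab(1) this 1] show ?thesis
        by eventually_elim (auto simp: k_def)
    next
      case 2
      have "snd a \<le> snd (p j)" using low by (simp add: less_eq_prod_def)
      from eventually_cell_less[OF ab(2) this 2] show ?thesis
        by eventually_elim (auto simp: k_def)
    qed
  qed simp
  have "\<forall>\<^sub>F n in sequentially. \<forall>i\<in>points_in a b. \<forall>j\<in>points_in a b. k n i \<le> k n j \<longrightarrow> p i \<le> p j"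
    using sep by (intro eventually_ball_finite finite_points_in ballI) auto
  moreover have "\<forall>\<^sub>F n in sequentially. 0 < n" by (rule eventually_gt_at_top)
  ultimately show ?thesis
  proof eventually_elim
    case (elim n)
    have n: "0 < n" using elim by simp
    obtain C where C: "C \<in> grid_chains n n"
      "grid_passage n (\<lambda>B. box_weight p w (grid_box a b n B)) = (\<Sum>B\<in>C. box_weight p w (grid_box a b n B))"
      by (rule grid_passage_attained)
    define I where "I = (\<Union>B\<in>C. {i. p i \<in> grid_box a b n B})"
    have mem: "k n i = B \<and> a \<le> p i" if "p i \<in> grid_box a b n B" for i B
      using that ab n by (cases "p i"; cases B)
        (auto simp: grid_box_def mem_grid_interval_iff k_def less_eq_prod_def)
    have upper: "p i \<le> b" if "p i \<in> grid_box a b n B" "B \<in> C" for i B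
    proof -
      have B: "fst B < n" "snd B < n" using that(2) C(1) by (auto simp: grid_chains_def)
      have aux: "x \<le> x1" if "x \<in> grid_interval x0 x1 n j" "j < n" "x0 < x1" for x x0 x1 j
      proof -
        have "(real j + 1) * ((x1 - x0) / real n) \<le> real n * ((x1 - x0) / real n)"
          using that n by (intro mult_right_mono) auto
        then show ?thesis using that n by (simp add: grid_interval_def)
      qed
      show ?thesis using that(1) B ab
        by (auto simp: grid_box_def less_eq_prod_def mem_Times_iff intro!: aux)
    qed
    \<comment> \<open>The first box contains the corner \<open>a\<close>, which paths must skip;
      \<open>corner\<close> says that no point sits there.\<close>
    have I: "I \<subseteq> points_in a b"
      using mem upper corner by (auto simp: I_def points_in_def)
    have "sum w I \<le> last_passage p w a b"
    proof (rule chain_sum_le_last_passage[OF I])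
      fix i j assume ij: "i \<in> I" "j \<in> I"
      then have "k n i \<in> C" "k n j \<in> C" using mem by (auto simp: I_def)
      then have "k n i \<le> k n j \<or> k n j \<le> k n i" using C(1) by (auto simp: grid_chains_def)
      then show "p i \<le> p j \<or> p j \<le> p i" using elim(1) ij I by blast
    qed
    moreover have "(\<Sum>B\<in>C. box_weight p w (grid_box a b n B)) = sum w I"
      unfolding I_def by (rule sum_box_weight[OF ab n finite_grid_chain[OF C(1)]])
    ultimately show ?case
      using last_passage_le_grid_passage[OF ab n interior] C(2) by simp
  qed
qed

end

section \<open>Mass functions\<close>

text \<open>The two branches of \<open>mass_function\<close> fit together because the atom at 0
  belongs to the nonnegative side: the result is a distribution function of \<open>\<nu>\<close>
  whose left limit at 0 is 0.\<close>

lemma mass_function_diff: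
  assumes sets: "sets \<nu> = sets borel" and fin: "\<And>a b. emeasure \<nu> {a..b} < \<infinity>" and "y \<le> x"
  shows "mass_function \<nu> x - mass_function \<nu> y = measure \<nu> {y<..x}"
proof -
  have meas [simp]: "A \<in> sets \<nu>" if "A \<in> sets borel" for A using that sets by simp
  have fin': "emeasure \<nu> A \<noteq> \<infinity>" if "A \<subseteq> {a..b}" for A a b
    using order.strict_trans1[OF emeasure_mono[OF that, of \<nu>] fin[of a b]] by simp
  have fins: "emeasure \<nu> {a..b} \<noteq> \<infinity>" "emeasure \<nu> {a<..b} \<noteq> \<infinity>" "emeasure \<nu> {a<..<b} \<noteq> \<infinity>"
    for a b by (rule fin'[of _ a b]; auto)+
  consider "0 \<le> y" | "y < 0" "0 \<le> x" | "x < 0" by linarith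
  then show ?thesis
  proof cases
    case 1
    have "{0..x} = {0..y} \<union> {y<..x}" using 1 assms by auto
    then have "measure \<nu> {0..x} = measure \<nu> ({0..y} \<union> {y<..x})" by simp
    also have "\<dots> = measure \<nu> {0..y} + measure \<nu> {y<..x}"
      using 1 by (intro measure_Union fins) auto
    finally show ?thesis using 1 assms by (simp add: mass_function_def)
  next
    case 2
    have "{y<..x} = {y<..<0} \<union> {0..x}" using 2 by auto
    then have "measure \<nu> {y<..x} = measure \<nu> ({y<..<0} \<union> {0..x})" by simp
    also have "\<dots> = measure \<nu> {y<..<0} + measure \<nu> {0..x}"
      by (intro measure_Union fins) auto
    finally show ?thesis using 2 assms by (simp add: mass_function_def)
  next
    case 3
    have "{y<..<0} = {y<..x} \<union> {x<..<0}" using 3 assms by auto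
    then have "measure \<nu> {y<..<0} = measure \<nu> ({y<..x} \<union> {x<..<0})" by simp
    also have "\<dots> = measure \<nu> {y<..x} + measure \<nu> {x<..<0}"
      by (intro measure_Union fins) auto
    finally show ?thesis using 3 assms by (simp add: mass_function_def)
  qed
qed

lemma mass_function_mono:
  assumes "sets \<nu> = sets borel" "\<And>a b. emeasure \<nu> {a..b} < \<infinity>"
  shows "mono (mass_function \<nu>)"
proof (rule monoI)
  fix x y :: real assume "x \<le> y"
  from mass_function_diff[OF assms this] show "mass_function \<nu> x \<le> mass_function \<nu> y"
    using measure_nonneg[of \<nu> "{x<..y}"] by linarith
qed

lemma mass_function_right_continuous:
  assumes sets: "sets \<nu> = sets borel" and fin: "\<And>a b. emeasure \<nu> {a..b} < \<infinity>"
  shows "continuous (at_right x) (mass_function \<nu>)"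
proof (subst continuous_at_right_real_increasing)
  show "mass_function \<nu> a \<le> mass_function \<nu> b" if "a \<le> b" for a b
    using monoD[OF mass_function_mono[OF assms] that] .
  have "(\<lambda>n. measure \<nu> {x<..x + 1 / real (Suc n)}) \<longlonglongrightarrow> measure \<nu> (\<Inter>n. {x<..x + 1 / real (Suc n)})"
  proof (rule Lim_measure_decseq)
    show "range (\<lambda>n. {x<..x + 1 / real (Suc n)}) \<subseteq> sets \<nu>"
      by (simp add: sets image_subset_iff)
    show "decseq (\<lambda>n. {x<..x + 1 / real (Suc n)})"
    proof (rule decseq_SucI, rule subsetI)
      fix n y assume "y \<in> {x<..x + 1 / real (Suc (Suc n))}"
      moreover have "1 / real (Suc (Suc n)) \<le> 1 / real (Suc n)" by (simp add: field_simps)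
      ultimately show "y \<in> {x<..x + 1 / real (Suc n)}"
        unfolding greaterThanAtMost_iff by linarith
    qed
    show "emeasure \<nu> {x<..x + 1 / real (Suc n)} \<noteq> \<infinity>" for n
    proof -
      have "emeasure \<nu> {x<..x + 1 / real (Suc n)} \<le> emeasure \<nu> {x..x + 1 / real (Suc n)}"
        by (intro emeasure_mono) (simp_all add: sets greaterThanAtMost_subseteq_atLeastAtMost_iff)
      from order.strict_trans1[OF this fin] show ?thesis by simp
    qed
  qed
  moreover have "(\<Inter>n. {x<..x + 1 / real (Suc n)}) = {}"
  proof -
    have False if y: "y \<in> (\<Inter>n. {x<..x + 1 / real (Suc n)})" for y
    proof -
      have that: "y \<in> {x<..x + 1 / real (Suc n)}" for n using y by blast
      have "0 < y - x" using that[of 0] by simp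
      from reals_Archimedean[OF this] obtain n where "inverse (real (Suc n)) < y - x" ..
      then show False using that[of n] by (simp add: inverse_eq_divide)
    qed
    then show ?thesis by blast
  qed
  ultimately have lim: "(\<lambda>n. measure \<nu> {x<..x + 1 / real (Suc n)}) \<longlonglongrightarrow> 0" by simp
  show "\<forall>e>0. \<exists>d>0. mass_function \<nu> (x + d) - mass_function \<nu> x < e"
  proof (intro allI impI)
    fix e :: real assume "0 < e"
    from order_tendstoD(2)[OF lim this] obtain n where
      "measure \<nu> {x<..x + 1 / real (Suc n)} < e" by (auto simp: eventually_sequentially)
    then show "\<exists>d>0. mass_function \<nu> (x + d) - mass_function \<nu> x < e"
      by (intro exI[of _ "1 / real (Suc n)"]) (simp add: mass_function_diff[OF assms])
  qed
qed

lemma mass_function_add_atom: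
  assumes sets: "sets \<nu> = sets borel" and fin: "\<And>a b. emeasure \<nu> {a..b} < \<infinity>" and "0 \<le> \<epsilon>"
  shows "mass_function (add_atom \<epsilon> \<nu>) x = mass_function \<nu> x + (if 0 \<le> x then \<epsilon> else 0)"
proof -
  have meas: "A \<in> sets \<nu>" if "A \<in> sets borel" for A using that sets by simp
  show ?thesis
  proof (cases "0 \<le> x")
    case True
    have "measure (add_atom \<epsilon> \<nu>) {0..x} = enn2real (emeasure \<nu> {0..x} + ennreal \<epsilon>)"
      using True by (simp add: measure_def emeasure_add_atom meas)
    also have "\<dots> = measure \<nu> {0..x} + \<epsilon>"
      using fin[of 0 x] assms(3) by (simp add: enn2real_plus measure_def less_top[symmetric])
    finally show ?thesis using True by (simp add: mass_function_def)
  next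
    case False
    then show ?thesis by (simp add: mass_function_def measure_def emeasure_add_atom meas)
  qed
qed

text \<open>The closed interval has mass H(x) minus the left limit of H at a. Functions that agree
  below a have the same left limit there, so it cancels. With a = 0 this turns the masses in the
  definition of the second-class particle into heights.\<close>

lemma measure_interval_measure_diff:
  fixes H H' :: "real \<Rightarrow> real"
  assumes "mono H" "\<And>x. continuous (at_right x) H" "mono H'" "\<And>x. continuous (at_right x) H'"
    and eq: "\<And>x. x < a \<Longrightarrow> H' x = H x" and "a \<le> x"
  shows "measure (interval_measure H') {a..x} - measure (interval_measure H) {a..x} = H' x - H x"
proof -
  have lim: "(\<lambda>n. G x - G (a - 1 / real (Suc n))) \<longlonglongrightarrow> measure (interval_measure G) {a..x}"
    if "mono G" "\<And>x. continuous (at_right x) G" for G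
  proof -
    have le: "G (a - 1 / real (Suc n)) \<le> G x" for n
      by (rule monoD[OF that(1)], rule order.trans[OF _ \<open>a \<le> x\<close>]) simp
    have meas: "emeasure (interval_measure G) {a - 1 / real (Suc n)<..x}
        = ennreal (G x - G (a - 1 / real (Suc n)))" for n
    proof (rule emeasure_interval_measure_Ioc)
      show "a - 1 / real (Suc n) \<le> x" by (rule order.trans[OF _ \<open>a \<le> x\<close>]) simp
      show "G y \<le> G z" if "y \<le> z" for y z using monoD[OF \<open>mono G\<close> that] .
    qed (rule that(2))
    have "(\<lambda>n. measure (interval_measure G) {a - 1 / real (Suc n)<..x}) \<longlonglongrightarrow>
        measure (interval_measure G) (\<Inter>n. {a - 1 / real (Suc n)<..x})"
    proof (rule Lim_measure_decseq)
      show "decseq (\<lambda>n. {a - 1 / real (Suc n)<..x})"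
      proof (rule decseq_SucI, rule subsetI)
        fix n y assume "y \<in> {a - 1 / real (Suc (Suc n))<..x}"
        moreover have "1 / real (Suc (Suc n)) \<le> 1 / real (Suc n)" by (simp add: field_simps)
        ultimately show "y \<in> {a - 1 / real (Suc n)<..x}"
          unfolding greaterThanAtMost_iff by linarith
      qed
      show "range (\<lambda>n. {a - 1 / real (Suc n)<..x}) \<subseteq> sets (interval_measure G)"
        by (simp add: image_subset_iff)
      show "emeasure (interval_measure G) {a - 1 / real (Suc n)<..x} \<noteq> \<infinity>" for n
        unfolding meas by simp
    qed
    moreover have "(\<Inter>n. {a - 1 / real (Suc n)<..x}) = {a..x}"
    proof (intro equalityI subsetI)
      fix y assume y: "y \<in> (\<Inter>n. {a - 1 / real (Suc n)<..x})"
      have "a \<le> y"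
      proof (rule ccontr)
        assume "\<not> a \<le> y"
        then have "0 < a - y" by simp
        from reals_Archimedean[OF this] obtain n where "inverse (real (Suc n)) < a - y" ..
        moreover have "a - 1 / real (Suc n) < y" using INT_D[OF y UNIV_I[of n]] by simp
        ultimately show False by (simp add: inverse_eq_divide)
      qed
      moreover have "y \<le> x" using y by simp
      ultimately show "y \<in> {a..x}" by simp
    next
      fix y assume "y \<in> {a..x}"
      then have "y \<in> {a - 1 / real (Suc n)<..x}" for n
        using less_le_trans[of "a - 1 / real (Suc n)" a y] by simp
      then show "y \<in> (\<Inter>n. {a - 1 / real (Suc n)<..x})" by blast
    qed
    moreover have "measure (interval_measure G) {a - 1 / real (Suc n)<..x}
        = G x - G (a - 1 / real (Suc n))" for n
      unfolding measure_def meas using le[of n] by simp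
    ultimately show ?thesis by simp
  qed
  have "(\<lambda>n. (H' x - H' (a - 1 / real (Suc n))) - (H x - H (a - 1 / real (Suc n))))
      \<longlonglongrightarrow> measure (interval_measure H') {a..x} - measure (interval_measure H) {a..x}"
    using lim[OF assms(3,4)] lim[OF assms(1,2)] by (rule tendsto_diff)
  moreover have "(H' x - H' (a - 1 / real (Suc n))) - (H x - H (a - 1 / real (Suc n)))
      = H' x - H x" for n using eq by simp
  ultimately have "(\<lambda>n::nat. H' x - H x)
      \<longlonglongrightarrow> measure (interval_measure H') {a..x} - measure (interval_measure H) {a..x}" by simp
  then show ?thesis using LIMSEQ_unique tendsto_const by blast
qed

section \<open>Last-passage heights\<close>

lemma right_continuous_increment:
  fixes v :: "real \<Rightarrow> real"
  assumes "mono v" "continuous (at_right x) v" "0 < e"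
  shows "\<exists>d>0. v (x + d) - v x < e"
  using assms continuous_at_right_real_increasing[of v x] monoD[OF assms(1)] by blast

context weighted_configuration
begin

definition passage_time :: "real \<Rightarrow> real \<Rightarrow> real \<Rightarrow> real" where
  "passage_time t z x = last_passage p w (z, 0) (x, t)"

text \<open>The fluid height for an arbitrary profile \<open>v\<close>, so that \<open>\<nu>\<close>
  with and without the extra atom is treated alike.\<close>

definition height :: "(real \<Rightarrow> real) \<Rightarrow> real \<Rightarrow> real \<Rightarrow> real" where
  "height v t x = (SUP z\<in>{..x}. v z + passage_time t z x)"

lemma passage_time_nonneg: "0 \<le> passage_time t z x"
  by (simp add: passage_time_def last_passage_nonneg)

lemma passage_time_mono:
  "z' \<le> z \<Longrightarrow> x \<le> x' \<Longrightarrow> t \<le> t' \<Longrightarrow> passage_time t z x \<le> passage_time t' z' x'"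
  unfolding passage_time_def by (rule last_passage_mono) auto

lemma height_mono:
  assumes "\<And>x. bdd_above ((\<lambda>z. v z + passage_time t z x) ` {..x})"
  shows "mono (height v t)"
proof (rule monoI)
  fix x y :: real assume "x \<le> y"
  then show "height v t x \<le> height v t y"
    unfolding height_def using assms
    by (intro cSUP_mono) (force intro: add_left_mono passage_time_mono)+
qed

text \<open>Only finitely many points lie in the strip to the right of \<open>x\<close>, so for
  small d no point has first coordinate in (x, x + d]. Starting points up to \<open>x\<close> then
  see the same passage time, and those beyond \<open>x\<close> see 0 and gain only an increment of
  \<open>v\<close>.\<close>

lemma height_right_continuous:
  assumes bdd: "\<And>x. bdd_above ((\<lambda>z. v z + passage_time t z x) ` {..x})"
    and v: "mono v" "\<And>x. continuous (at_right x) v"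
  shows "continuous (at_right x) (height v t)"
proof (subst continuous_at_right_real_increasing)
  show "height v t a \<le> height v t b" if "a \<le> b" for a b
    using monoD[OF height_mono[OF bdd] that] .
  show "\<forall>e>0. \<exists>d>0. height v t (x + d) - height v t x < e"
  proof (intro allI impI)
    fix e :: real assume e: "0 < e"
    define S where "S = {i. p i \<in> {x..x + 1} \<times> {0..t}}"
    have fin: "finite S" unfolding S_def by (rule locally_finite) (intro bounded_Times; simp)
    have "\<exists>d>0. v (x + d) - v x < e / 2"
      by (rule right_continuous_increment[OF v]) (use e in simp)
    then obtain d0 where d0: "0 < d0" "v (x + d0) - v x < e / 2" by blast
    have "\<forall>\<^sub>F d in at_right 0. \<forall>i\<in>S. \<not> (x < fst (p i) \<and> fst (p i) \<le> x + d)"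
    proof (intro eventually_ball_finite fin ballI)
      fix i assume "i \<in> S"
      show "\<forall>\<^sub>F d in at_right 0. \<not> (x < fst (p i) \<and> fst (p i) \<le> x + d)"
      proof (cases "x < fst (p i)")
        case True
        have "\<forall>\<^sub>F d in at_right 0. d < fst (p i) - x"
          using True by (intro order_tendstoD(2)[OF tendsto_ident_at]) auto
        then show ?thesis by eventually_elim auto
      qed simp
    qed
    moreover have "\<forall>\<^sub>F d in at_right 0. d < min 1 d0"
      using d0 by (intro order_tendstoD(2)[OF tendsto_ident_at]) auto
    moreover have "\<forall>\<^sub>F d in at_right (0::real). 0 < d" by (simp add: eventually_at_right_less)
    ultimately have "\<forall>\<^sub>F d in at_right 0. 0 < d \<and> d < min 1 d0 \<and>
        (\<forall>i\<in>S. \<not> (x < fst (p i) \<and> fst (p i) \<le> x + d))"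
      by eventually_elim auto
    then obtain d where d: "0 < d" "d < 1" "d < d0"
      "\<And>i. i \<in> S \<Longrightarrow> \<not> (x < fst (p i) \<and> fst (p i) \<le> x + d)"
      using eventually_happens'[OF trivial_limit_at_right_real] by (metis (no_types, lifting) min_less_iff_conj)
    have nopoint: "fst (p i) \<le> x" if "fst (p i) \<le> x + d" "0 \<le> snd (p i)" "snd (p i) \<le> t" for i
    proof (rule ccontr)
      assume "\<not> fst (p i) \<le> x"
      then have "i \<in> S" using that d by (cases "p i") (auto simp: S_def)
      then show False using d(4)[of i] that \<open>\<not> fst (p i) \<le> x\<close> by auto
    qed
    have vd: "v (x + d) < v x + e / 2" using d0 d monoD[OF v(1), of "x + d" "x + d0"] by linarith
    have "v x + passage_time t x x \<le> height v t x"
      unfolding height_def by (intro cSUP_upper bdd) auto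
    then have vx: "v x \<le> height v t x" using passage_time_nonneg[of t x x] by linarith
    have "height v t (x + d) \<le> height v t x + e / 2"
      unfolding height_def[of v t "x + d"]
    proof (rule cSUP_least)
      fix z assume z: "z \<in> {..x + d}"
      show "v z + passage_time t z (x + d) \<le> height v t x + e / 2"
      proof (cases "z \<le> x")
        case True
        have "points_in (z, 0) (x + d, t) = points_in (z, 0) (x, t)"
          using nopoint d by (auto simp: points_in_def less_eq_prod_def)
        then have "passage_time t z (x + d) = passage_time t z x"
          unfolding passage_time_def by (rule last_passage_cong_points)
        moreover have "v z + passage_time t z x \<le> height v t x"
          unfolding height_def using True by (intro cSUP_upper bdd) auto
        ultimately show ?thesis using e by simp
      next
        case False
        have "points_in (z, 0) (x + d, t) = {}"
          using nopoint False by (fastforce simp: points_in_def less_eq_prod_def)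
        then have "passage_time t z (x + d) = 0"
          unfolding passage_time_def by (rule last_passage_empty)
        moreover have "v z \<le> v (x + d)" using z by (intro monoD[OF v(1)]) auto
        ultimately show ?thesis using vd vx by linarith
      qed
    qed auto
    then show "\<exists>d>0. height v t (x + d) - height v t x < e"
      using d e by (intro exI[of _ d]) auto
  qed
qed

text \<open>Let A and B be the suprema over z < 0 and over 0 to x. The atom raises exactly the
  second, so the height changes from max A B to max A (B + \<epsilon>); the gain is the full
  \<epsilon> iff A is at most B. In particular \<epsilon> leaves the criterion.\<close>

lemma second_class_criterion:
  assumes bdd: "\<And>x. bdd_above ((\<lambda>z. v z + passage_time t z x) ` {..x})"
    and "0 < \<epsilon>" "0 \<le> x"
    and v': "v' = (\<lambda>z. v z + (if 0 \<le> z then \<epsilon> else 0))"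
  shows "height v' t x = height v t x + \<epsilon> \<longleftrightarrow>
    (SUP z\<in>{..<0}. v z + passage_time t z x) \<le> (SUP z\<in>{0..x}. v z + passage_time t z x)"
proof -
  define g where "g z = v z + passage_time t z x" for z
  have split: "{..x} = {..<0} \<union> {0..x}" using assms by auto
  have b1: "bdd_above (g ` {..<0})"
    by (rule bdd_above_mono[OF bdd[of x]]) (use assms in \<open>auto simp: g_def\<close>)
  have b2: "bdd_above (g ` {0..x})"
    by (rule bdd_above_mono[OF bdd[of x]]) (use assms in \<open>auto simp: g_def\<close>)
  have ne: "{0..x} \<noteq> {}" using assms by simp
  have 1: "height v t x = max (SUP z\<in>{..<0}. g z) (SUP z\<in>{0..x}. g z)"
    unfolding height_def split g_def[symmetric]
    using cSUP_union[OF _ b1 ne b2] by (simp add: sup_max)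
  have shift: "(SUP z\<in>{0..x}. g z + \<epsilon>) = (SUP z\<in>{0..x}. g z) + \<epsilon>"
  proof (rule antisym)
    show "(SUP z\<in>{0..x}. g z + \<epsilon>) \<le> (SUP z\<in>{0..x}. g z) + \<epsilon>"
      using b2 by (intro cSUP_least ne add_right_mono cSUP_upper)
    have "bdd_above ((\<lambda>z. g z + \<epsilon>) ` {0..x})"
      using b2 by (auto simp: bdd_above_def intro!: add_right_mono)
    then have "g z + \<epsilon> \<le> (SUP z\<in>{0..x}. g z + \<epsilon>)" if "z \<in> {0..x}" for z
      using that by (intro cSUP_upper)
    then have "(SUP z\<in>{0..x}. g z) \<le> (SUP z\<in>{0..x}. g z + \<epsilon>) - \<epsilon>"
      by (intro cSUP_least ne) (simp add: le_diff_eq)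
    then show "(SUP z\<in>{0..x}. g z) + \<epsilon> \<le> (SUP z\<in>{0..x}. g z + \<epsilon>)" by simp
  qed
  have "height v' t x = (SUP z\<in>{..<0} \<union> {0..x}. g z + (if 0 \<le> z then \<epsilon> else 0))"
    unfolding height_def split g_def v' by (intro SUP_cong) auto
  also have "\<dots> = sup (SUP z\<in>{..<0}. g z + (if 0 \<le> z then \<epsilon> else 0))
      (SUP z\<in>{0..x}. g z + (if 0 \<le> z then \<epsilon> else 0))"
  proof (rule cSUP_union[OF _ _ ne])
    have "(\<lambda>z. g z + (if 0 \<le> z then \<epsilon> else 0)) ` {..<0} = g ` {..<0}"
      by (intro image_cong) auto
    then show "bdd_above ((\<lambda>z. g z + (if 0 \<le> z then \<epsilon> else 0)) ` {..<0})" using b1 by simp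
    obtain K where "\<And>z. z \<in> {0..x} \<Longrightarrow> g z \<le> K" using b2 unfolding bdd_above_def by blast
    then show "bdd_above ((\<lambda>z. g z + (if 0 \<le> z then \<epsilon> else 0)) ` {0..x})"
      by (intro bdd_aboveI[of _ "K + \<epsilon>"]) auto
  qed auto
  also have "(SUP z\<in>{..<0}. g z + (if 0 \<le> z then \<epsilon> else 0)) = (SUP z\<in>{..<0}. g z)"
    by (intro SUP_cong) auto
  also have "(SUP z\<in>{0..x}. g z + (if 0 \<le> z then \<epsilon> else 0)) = (SUP z\<in>{0..x}. g z + \<epsilon>)"
    by (intro SUP_cong) auto
  finally have 2: "height v' t x = max (SUP z\<in>{..<0}. g z) ((SUP z\<in>{0..x}. g z) + \<epsilon>)"
    by (simp add: shift sup_max)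
  show ?thesis unfolding 1 2 g_def[symmetric] using assms(2) by (auto simp: max_def)
qed

text \<open>From here on the evolved measures are replaced by a race between starting points left
  and right of the origin. Boundedness is assumed because the suprema are real-valued.\<close>

lemma second_class_particle_eq:
  assumes \<nu>: "\<nu> \<in> fluid_measures" and "0 < \<epsilon>"
    and bdd: "\<And>x. bdd_above ((\<lambda>z. mass_function \<nu> z + passage_time t z x) ` {..x})"
  shows "second_class_particle p w \<epsilon> \<nu> t = (INF x\<in>{x. 0 \<le> x \<and>
    (SUP z\<in>{..<0}. mass_function \<nu> z + passage_time t z x) \<le>
    (SUP z\<in>{0..x}. mass_function \<nu> z + passage_time t z x)}. ereal x)"
proof -
  have sets: "sets \<nu> = sets borel" and fin: "\<And>a b. emeasure \<nu> {a..b} < \<infinity>"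
    using \<nu> by (auto simp: fluid_measures_def)
  define v where "v = mass_function \<nu>"
  define v' where "v' = (\<lambda>z. v z + (if 0 \<le> z then \<epsilon> else 0))"
  have v: "mono v" "\<And>x. continuous (at_right x) v"
    unfolding v_def by (intro mass_function_mono mass_function_right_continuous sets fin)+
  have add: "mass_function (add_atom \<epsilon> \<nu>) = v'"
    using mass_function_add_atom[OF sets fin] assms(2) by (auto simp: v'_def v_def fun_eq_iff)
  have v': "mono v'"
    using v(1) assms(2) by (auto simp: mono_def v'_def add_increasing2 intro: add_mono)
  have cv': "continuous (at_right x) v'" for x
  proof (subst continuous_at_right_real_increasing)
    show "v' a \<le> v' b" if "a \<le> b" for a b using monoD[OF v' that] .
    show "\<forall>e>0. \<exists>d>0. v' (x + d) - v' x < e"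
    proof (intro allI impI)
      fix e :: real assume "0 < e"
      then obtain d where d: "0 < d" "v (x + d) - v x < e"
        using right_continuous_increment[OF v, of e x] by blast
      \<comment> \<open>The step is shortened so that \<open>x\<close> and \<open>x + d'\<close> lie
        on the same side of the jump of \<open>v'\<close> at 0.\<close>
      define d' where "d' = (if x < 0 then min d (- x / 2) else d)"
      have d': "0 < d'" "d' \<le> d" "0 \<le> x + d' \<longleftrightarrow> 0 \<le> x"
        using d by (auto simp: d'_def min_def)
      have "v (x + d') \<le> v (x + d)" using d' by (intro monoD[OF v(1)]) auto
      then have "v' (x + d') - v' x < e" using d d' by (auto simp: v'_def)
      then show "\<exists>d>0. v' (x + d) - v' x < e" using d' by blast
    qed
  qed
  have bdd: "bdd_above ((\<lambda>z. v z + passage_time t z x) ` {..x})" for x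
    using bdd by (simp add: v_def)
  have bdd': "bdd_above ((\<lambda>z. v' z + passage_time t z x) ` {..x})" for x
  proof -
    obtain K where "\<And>z. z \<in> {..x} \<Longrightarrow> v z + passage_time t z x \<le> K"
      using bdd[of x] unfolding bdd_above_def by blast
    then have "v' z + passage_time t z x \<le> K + \<epsilon>" if "z \<in> {..x}" for z
      using that assms(2) by (fastforce simp: v'_def)
    then show ?thesis by (intro bdd_aboveI[of _ "K + \<epsilon>"]) blast
  qed
  have "(\<lambda>x. fluid_height p w \<nu>' x t) = height (mass_function \<nu>') t" for \<nu>'
    by (simp add: fun_eq_iff fluid_height_def height_def passage_time_def)
  then have "fluid_evolution p w \<nu>' t = interval_measure (height (mass_function \<nu>') t)" for \<nu>'
    by (simp add: fluid_evolution_def)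
  then have H: "mass_function (fluid_evolution p w \<nu>' t) x =
      measure (interval_measure (height (mass_function \<nu>') t)) {0..x}" if "0 \<le> x" for \<nu>' x
    using that by (simp add: mass_function_def[of "interval_measure _"])
  \<comment> \<open>Left of the origin only z < 0 competes, where the atom is invisible; this is the
    agreement below 0 that makes the left limits cancel.\<close>
  have early: "height v' t x = height v t x" if "x < 0" for x
    using that unfolding height_def v'_def by (intro SUP_cong) auto
  have "mass_function (fluid_evolution p w (add_atom \<epsilon> \<nu>) t) x =
      mass_function (fluid_evolution p w \<nu> t) x + \<epsilon> \<longleftrightarrow> height v' t x = height v t x + \<epsilon>"
    if "0 \<le> x" for x
    using measure_interval_measure_diff[OF height_mono[OF bdd]
      height_right_continuous[OF bdd v] height_mono[OF bdd']
      height_right_continuous[OF bdd' v' cv'] early that]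
    by (simp add: H[OF that] add v_def[symmetric]) linarith
  moreover have "height v' t x = height v t x + \<epsilon> \<longleftrightarrow>
      (SUP z\<in>{..<0}. v z + passage_time t z x) \<le> (SUP z\<in>{0..x}. v z + passage_time t z x)"
    if "0 \<le> x" for x
    by (rule second_class_criterion[OF bdd assms(2) that v'_def])
  ultimately show ?thesis
    unfolding second_class_particle_def v_def[symmetric]
    by (intro arg_cong[where f = "\<lambda>S. INF x\<in>S. ereal x"]) auto
qed

end

section \<open>The deterministic limit\<close>

context weighted_configuration
begin

text \<open>
  The limits at rational \<open>a < b\<close> are locally uniform by monotonicity. They are needed along the
  sequence \<open>T j = (j + 1)\<^sup>4\<close> only, because \<open>T (j + 1) / T j \<rightarrow> 1\<close>.
\<close>

definition uniform_passage :: "real \<Rightarrow> 'b filter \<Rightarrow> ('b \<Rightarrow> real) \<Rightarrow> bool" where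
  "uniform_passage \<gamma> F T \<longleftrightarrow> (\<forall>K e. 0 < e \<longrightarrow>
    (\<forall>\<^sub>F j in F. \<forall>a b. - K \<le> a \<and> a \<le> b \<and> b \<le> K \<longrightarrow>
      \<bar>passage_time (T j) (a * T j) (b * T j) - \<gamma> * sqrt (b - a) * T j\<bar> \<le> e * T j))"

lemma uniform_passageD:
  assumes "uniform_passage \<gamma> at_top (\<lambda>t. t)" "0 < e"
  shows "\<forall>\<^sub>F t in at_top. \<forall>a b. - K \<le> a \<and> a \<le> b \<and> b \<le> K \<longrightarrow>
    \<bar>passage_time t (a * t) (b * t) - \<gamma> * sqrt (b - a) * t\<bar> \<le> e * t"
  using assms unfolding uniform_passage_def by blast

text \<open>The passage time is monotone in both endpoints, so it lies between its values at inner
  and outer neighbours on a finite rational mesh; only finitely many limits have to be waited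
  for.\<close>

lemma uniform_passage_rational:
  assumes lim: "\<And>a b. a \<in> \<rat> \<Longrightarrow> b \<in> \<rat> \<Longrightarrow> a < b \<Longrightarrow>
      ((\<lambda>j. passage_time (T j) (a * T j) (b * T j) / T j) \<longlongrightarrow> \<gamma> * sqrt (b - a)) F"
    and T: "\<And>j. 0 < T j" and \<gamma>: "0 \<le> \<gamma>"
  shows "uniform_passage \<gamma> F T"
  unfolding uniform_passage_def
proof (intro allI impI)
  fix K e :: real assume e: "0 < e"
  show "\<forall>\<^sub>F j in F. \<forall>a b. - K \<le> a \<and> a \<le> b \<and> b \<le> K \<longrightarrow>
    \<bar>passage_time (T j) (a * T j) (b * T j) - \<gamma> * sqrt (b - a) * T j\<bar> \<le> e * T j"
proof -
  \<comment> \<open>Moving both endpoints to neighbouring mesh points changes b - a by at most 2/m;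
    as the square root is subadditive, the limit then changes by less than e/2.\<close>
  have "(\<lambda>m::nat. \<gamma> * sqrt (2 / real m)) \<longlonglongrightarrow> 0" by real_asymp
  from order_tendstoD(2)[OF this, of "e / 2"] e
  have "\<forall>\<^sub>F m in sequentially. \<gamma> * sqrt (2 / real m) < e / 2 \<and> 0 < m"
    using eventually_gt_at_top by (auto intro: eventually_conj)
  then obtain m :: nat where m: "\<gamma> * sqrt (2 / real m) < e / 2" "0 < m"
    by (auto simp: eventually_sequentially)
  define N where "N = \<lceil>K * real m\<rceil> + 2"
  define q where "q i = real_of_int i / real m" for i
  have q_diff: "q j - q i = (real_of_int j - real_of_int i) / real m" for i j
    by (simp add: q_def diff_divide_distrib)
  have "\<forall>\<^sub>F l in F. \<forall>i\<in>{-N..N}. \<forall>j\<in>{-N..N}. i < j \<longrightarrow>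
      \<bar>passage_time (T l) (q i * T l) (q j * T l) / T l - \<gamma> * sqrt (q j - q i)\<bar> < e / 2"
  proof (intro eventually_ball_finite ballI finite_atLeastAtMost_int)
    fix i j
    show "\<forall>\<^sub>F l in F. i < j \<longrightarrow>
        \<bar>passage_time (T l) (q i * T l) (q j * T l) / T l - \<gamma> * sqrt (q j - q i)\<bar> < e / 2"
    proof (cases "i < j")
      case True
      have "((\<lambda>l. passage_time (T l) (q i * T l) (q j * T l) / T l) \<longlongrightarrow> \<gamma> * sqrt (q j - q i)) F"
        using True m by (intro lim) (auto simp: q_def divide_strict_right_mono)
      from tendstoD[OF this, of "e / 2"] e show ?thesis by (simp add: dist_real_def)
    qed simp
  qed
  then show ?thesis
  proof eventually_elim
    case (elim l)
    define t where "t = T l"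
    have t: "0 < t" using T by (simp add: t_def)
    note elim = elim[folded t_def]
    have grid: "\<bar>passage_time t (q i * t) (q j * t) - \<gamma> * sqrt (q j - q i) * t\<bar> \<le> e / 2 * t"
      if "i \<in> {-N..N}" "j \<in> {-N..N}" "i < j" for i j
    proof -
      have "\<bar>passage_time t (q i * t) (q j * t) / t - \<gamma> * sqrt (q j - q i)\<bar> * t < e / 2 * t"
        using elim that t by (intro mult_strict_right_mono) auto
      moreover have "\<bar>passage_time t (q i * t) (q j * t) / t - \<gamma> * sqrt (q j - q i)\<bar> * t =
          \<bar>passage_time t (q i * t) (q j * t) - \<gamma> * sqrt (q j - q i) * t\<bar>"
        using t by (subst abs_mult_pos) (simp_all add: left_diff_distrib)
      ultimately show ?thesis by simp
    qed
    show ?case unfolding t_def[symmetric]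
    proof (intro allI impI)
      fix a b assume ab: "- K \<le> a \<and> a \<le> b \<and> b \<le> K"
      \<comment> \<open>\<open>q i\<close> and \<open>q j\<close> enclose a and b from outside,
        \<open>q (i + 1)\<close> and \<open>q (j - 1)\<close> from inside; the extra 2 in
        \<open>N\<close> leaves room for this rounding.\<close>
      define i where "i = \<lfloor>a * real m\<rfloor>"
      define j where "j = \<lfloor>b * real m\<rfloor> + 1"
      have am: "- (K * real m) \<le> a * real m" "a * real m \<le> b * real m" "b * real m \<le> K * real m"
        using ab m mult_right_mono[of "-K" a "real m"] by (auto intro: mult_right_mono)
      have ranges: "i \<in> {-N..N}" "j \<in> {-N..N}" "i + 1 \<in> {-N..N}" "j - 1 \<in> {-N..N}" "i < j"
        using am unfolding i_def j_def N_def by auto linarith+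
      have q1: "q (i + 1) = q i + 1 / real m" "q (j - 1) = q j - 1 / real m"
        by (simp_all add: q_def add_divide_distrib diff_divide_distrib)
      have bi: "q i \<le> a" "a < q (i + 1)" "a - 1 / real m < q i"
      proof -
        have "real_of_int i \<le> a * real m" "a * real m < real_of_int i + 1"
          unfolding i_def by linarith+
        then show "q i \<le> a" "a < q (i + 1)"
          using m by (simp_all add: q_def field_simps)
        then show "a - 1 / real m < q i" using q1 by linarith
      qed
      have bj: "q (j - 1) \<le> b" "b < q j" "q j \<le> b + 1 / real m"
      proof -
        have "real_of_int j - 1 \<le> b * real m" "b * real m < real_of_int j"
          unfolding j_def by linarith+
        then show "q (j - 1) \<le> b" "b < q j"
          using m by (simp_all add: q_def field_simps)
        then show "q j \<le> b + 1 / real m" using q1 by linarith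
      qed
      have m2: "2 / real m = 1 / real m + 1 / real m" by simp
      have root: "\<gamma> * sqrt (r + 2 / real m) \<le> \<gamma> * sqrt r + e / 2" if "0 \<le> r" for r
      proof -
        have "\<gamma> * sqrt (r + 2 / real m) \<le> \<gamma> * (sqrt r + sqrt (2 / real m))"
          using \<gamma> that by (intro mult_left_mono sqrt_add_le_add_sqrt) auto
        then show ?thesis using m by (simp add: distrib_left)
      qed
      have "passage_time t (a * t) (b * t) \<le> passage_time t (q i * t) (q j * t)"
        using bi bj t by (intro passage_time_mono mult_right_mono) auto
      also have "\<dots> \<le> \<gamma> * sqrt (q j - q i) * t + e / 2 * t"
        using grid[OF ranges(1,2,5)] by linarith
      also have "\<gamma> * sqrt (q j - q i) * t \<le> (\<gamma> * sqrt (b - a) + e / 2) * t"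
      proof (rule mult_right_mono)
        have "q j - q i \<le> b - a + 2 / real m" using bi bj m2 by linarith
        then have "\<gamma> * sqrt (q j - q i) \<le> \<gamma> * sqrt (b - a + 2 / real m)"
          using \<gamma> by (intro mult_left_mono real_sqrt_le_mono)
        also have "\<dots> \<le> \<gamma> * sqrt (b - a) + e / 2" using ab by (intro root) auto
        finally show "\<gamma> * sqrt (q j - q i) \<le> \<gamma> * sqrt (b - a) + e / 2" .
      qed (use t in simp)
      finally have upper: "passage_time t (a * t) (b * t) \<le> \<gamma> * sqrt (b - a) * t + e * t"
        by (simp add: distrib_right)
      have lower: "\<gamma> * sqrt (b - a) * t \<le> passage_time t (a * t) (b * t) + e * t"
      \<comment> \<open>If the inner interval degenerates, then b - a is at most 2/m and the claimed
        limit is itself within the error, so nonnegativity of the passage time suffices.\<close>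
      proof (cases "i + 1 < j - 1")
        case True
        have "\<gamma> * sqrt (b - a) \<le> \<gamma> * sqrt (q (j - 1) - q (i + 1) + 2 / real m)"
          using \<gamma> bi bj q1 m2 by (intro mult_left_mono real_sqrt_le_mono) linarith+
        also have "\<dots> \<le> \<gamma> * sqrt (q (j - 1) - q (i + 1)) + e / 2"
          using True m by (intro root) (simp add: q_diff)
        finally have "\<gamma> * sqrt (b - a) * t \<le> (\<gamma> * sqrt (q (j - 1) - q (i + 1)) + e / 2) * t"
          using t by (intro mult_right_mono) auto
        also have "\<dots> = \<gamma> * sqrt (q (j - 1) - q (i + 1)) * t + e / 2 * t" by (simp add: distrib_right)
        also have "\<dots> \<le> passage_time t (q (i + 1) * t) (q (j - 1) * t) + e / 2 * t + e / 2 * t"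
          using grid[OF ranges(3,4) True] by linarith
        also have "passage_time t (q (i + 1) * t) (q (j - 1) * t) \<le> passage_time t (a * t) (b * t)"
          using bi bj t by (intro passage_time_mono mult_right_mono) auto
        finally show ?thesis by simp
      next
        case False
        then have "j - i \<le> 2" by simp
        then have "q j - q i \<le> 2 / real m"
          unfolding q_diff using m by (intro divide_right_mono) linarith+
        then have "b - a \<le> 2 / real m" using bi bj by linarith
        then have "\<gamma> * sqrt (b - a) \<le> \<gamma> * sqrt (2 / real m)"
          using \<gamma> by (intro mult_left_mono real_sqrt_le_mono)
        then have "\<gamma> * sqrt (b - a) * t \<le> e * t"
          using m e t by (intro mult_right_mono) linarith+
        then show ?thesis using passage_time_nonneg[of t "a * t" "b * t"] by linarith
      qed
      show "\<bar>passage_time t (a * t) (b * t) - \<gamma> * sqrt (b - a) * t\<bar> \<le> e * t"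
        using upper lower by linarith
    qed
  qed
  qed
qed

text \<open>Between consecutive times \<open>T j\<close> and \<open>T (Suc j)\<close> the passage
  time at t is squeezed by those at the two ends with the same spatial endpoints. In the units of
  \<open>T i\<close> these endpoints are stretched by t / T i, which tends to 1.\<close>

lemma uniform_passage_interpolate:
  assumes U: "uniform_passage \<gamma> sequentially (\<lambda>j. real (Suc j) ^ 4)" and \<gamma>: "0 \<le> \<gamma>"
  shows "uniform_passage \<gamma> at_top (\<lambda>t. t)"
  unfolding uniform_passage_def
proof (intro allI impI)
  fix K e :: real assume e: "0 < e"
  define T where "T j = real (Suc j) ^ 4" for j
  have T0: "0 < T j" for j by (simp add: T_def)
  \<comment> \<open>Bounds \<open>\<gamma> * sqrt (b - a)\<close> on the window. For negative
    \<open>K\<close> the claim is vacuous and \<open>C\<close> may be negative, hence the absolute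
    value in \<open>d\<close>.\<close>
  define C where "C = \<gamma> * sqrt (2 * K) + 1"
  define d where "d = min 1 (e / (2 * \<bar>C\<bar> + 1))"
  have d: "0 < d" "d \<le> 1" using e by (auto simp: d_def)
  have dC: "C * d \<le> e / 2"
  proof -
    have "C * d \<le> \<bar>C\<bar> * (e / (2 * \<bar>C\<bar> + 1))" using d by (intro mult_mono) (auto simp: d_def)
    also have "\<dots> \<le> e / 2" using e by (simp add: field_simps)
    finally show ?thesis .
  qed
  have "(\<lambda>j. real (Suc (Suc j)) ^ 4 / real (Suc j) ^ 4) \<longlonglongrightarrow> 1" by real_asymp
  from order_tendstoD(2)[OF this, of "1 + d"] d
  have "\<forall>\<^sub>F j in sequentially. T (Suc j) / T j < 1 + d" by (simp add: T_def)
  moreover have "0 < e / 4" using e by simp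
  \<comment> \<open>The window is doubled because rescaling from t to \<open>T i\<close> stretches
    the endpoints by a factor of up to 2.\<close>
  note U[unfolded uniform_passage_def, THEN spec, THEN spec, THEN mp, OF this, of "2 * K", folded T_def]
  ultimately have "\<forall>\<^sub>F j in sequentially. T (Suc j) / T j < 1 + d \<and>
      (\<forall>a b. - (2 * K) \<le> a \<and> a \<le> b \<and> b \<le> 2 * K \<longrightarrow>
        \<bar>passage_time (T j) (a * T j) (b * T j) - \<gamma> * sqrt (b - a) * T j\<bar> \<le> e / 4 * T j)"
    by (rule eventually_conj)
  then obtain J where J: "\<And>j. J \<le> j \<Longrightarrow> T (Suc j) / T j < 1 + d"
    "\<And>j a b. J \<le> j \<Longrightarrow> - (2 * K) \<le> a \<and> a \<le> b \<and> b \<le> 2 * K \<Longrightarrow>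
      \<bar>passage_time (T j) (a * T j) (b * T j) - \<gamma> * sqrt (b - a) * T j\<bar> \<le> e / 4 * T j"
    unfolding eventually_sequentially by blast
  have "\<forall>\<^sub>F t in at_top. T J \<le> t" by (rule eventually_ge_at_top)
  then show "\<forall>\<^sub>F t in at_top. \<forall>a b. - K \<le> a \<and> a \<le> b \<and> b \<le> K \<longrightarrow>
      \<bar>passage_time t (a * t) (b * t) - \<gamma> * sqrt (b - a) * t\<bar> \<le> e * t"
  proof eventually_elim
    case (elim t)
    have t: "0 < t" using elim T0[of J] by linarith
    define j where "j = (LEAST j. t < T (Suc j))"
    have "\<forall>\<^sub>F j in sequentially. t < T (Suc j)" unfolding T_def by real_asymp
    then obtain n where n: "t < T (Suc n)" unfolding eventually_sequentially by blast
    have "t < T (Suc j)" unfolding j_def by (rule LeastI[of "\<lambda>j. t < T (Suc j)", OF n])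
    have mono: "T i \<le> T k" if "i \<le> k" for i k using that by (auto simp: T_def intro: power_mono)
    have "J \<le> j"
    proof (rule ccontr)
      assume "\<not> J \<le> j"
      then have "T (Suc j) \<le> T J" by (intro mono) simp
      then show False using elim \<open>t < T (Suc j)\<close> by simp
    qed
    have "T j \<le> t"
    proof (cases "j = J")
      case False
      then obtain k where "j = Suc k" using \<open>J \<le> j\<close> by (cases j) auto
      then show ?thesis using not_less_Least[of k "\<lambda>j. t < T (Suc j)"] by (simp add: j_def)
    qed (use elim in simp)
    have ratio: "T (Suc j) \<le> (1 + d) * T j" using J(1)[OF \<open>J \<le> j\<close>] T0[of j] by (simp add: divide_less_eq)
    show ?case
    proof (intro allI impI)
      fix a b assume ab: "- K \<le> a \<and> a \<le> b \<and> b \<le> K"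
      define s where "s = \<gamma> * sqrt (b - a)"
      have s: "0 \<le> s" "s \<le> C"
      proof -
        have "\<gamma> * sqrt (b - a) \<le> \<gamma> * sqrt (2 * K)"
          using \<gamma> ab by (intro mult_left_mono real_sqrt_le_mono) auto
        then show "0 \<le> s" "s \<le> C" using \<gamma> ab by (auto simp: s_def C_def)
      qed
      have sd: "s * d \<le> e / 2" using dC mult_right_mono[OF s(2), of d] d by linarith
      have rescaled: "\<bar>passage_time (T i) (a * t) (b * t) - \<gamma> * sqrt ((b - a) * (t / T i)) * T i\<bar> \<le> e / 4 * T i"
        if "J \<le> i" "t \<le> 2 * T i" for i
      proof -
        have r: "0 \<le> t / T i" "t / T i \<le> 2" using that t T0[of i] by (auto simp: divide_le_eq)
        have "K * (t / T i) \<le> K * 2" using ab r by (intro mult_left_mono) auto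
        moreover have "- K * (t / T i) \<le> a * (t / T i)" "a * (t / T i) \<le> b * (t / T i)" "b * (t / T i) \<le> K * (t / T i)"
          using ab r by (intro mult_right_mono; simp)+
        ultimately have "- (2 * K) \<le> a * (t / T i) \<and> a * (t / T i) \<le> b * (t / T i) \<and> b * (t / T i) \<le> 2 * K"
          by auto
        from J(2)[OF that(1) this] show ?thesis
          using T0[of i] unfolding left_diff_distrib[symmetric] by simp
      qed
      have "passage_time t (a * t) (b * t) \<le> passage_time (T (Suc j)) (a * t) (b * t)"
        using \<open>t < T (Suc j)\<close> by (intro passage_time_mono) auto
      also have "\<dots> \<le> \<gamma> * sqrt ((b - a) * (t / T (Suc j))) * T (Suc j) + e / 4 * T (Suc j)"
      proof -
        have "J \<le> Suc j" "t \<le> 2 * T (Suc j)" using \<open>J \<le> j\<close> \<open>t < T (Suc j)\<close> t by linarith+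
        from rescaled[OF this] show ?thesis by linarith
      qed
      also have "\<dots> \<le> s * T (Suc j) + e / 4 * T (Suc j)"
      proof (intro add_right_mono mult_right_mono)
        have "(b - a) * (t / T (Suc j)) \<le> (b - a) * 1"
          using ab \<open>t < T (Suc j)\<close> T0[of "Suc j"] by (intro mult_left_mono) (auto simp: divide_le_eq)
        then show "\<gamma> * sqrt ((b - a) * (t / T (Suc j))) \<le> s"
          unfolding s_def using \<gamma> by (intro mult_left_mono real_sqrt_le_mono) auto
      qed (use T0[of "Suc j"] in simp)
      also have "\<dots> = (s + e / 4) * T (Suc j)" by (simp add: distrib_right)
      also have "\<dots> \<le> (s + e / 4) * ((1 + d) * t)"
        using ratio \<open>T j \<le> t\<close> d e s by (intro mult_left_mono order.trans[OF ratio]) auto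
      also have "\<dots> = s * t + (s * d + e / 4 + e / 4 * d) * t" by (simp add: algebra_simps)
      also have "\<dots> \<le> s * t + e * t"
      proof (intro add_left_mono mult_right_mono)
        have "e / 4 * d \<le> e / 4 * 1" using d e by (intro mult_left_mono) auto
        then show "s * d + e / 4 + e / 4 * d \<le> e" using sd by linarith
      qed (use t in simp)
      finally have upper: "passage_time t (a * t) (b * t) \<le> s * t + e * t" .
      have small: "t \<le> (1 + d) * T j" using ratio \<open>t < T (Suc j)\<close> by simp
      also have "\<dots> \<le> 2 * T j" using d T0[of j] by (intro mult_right_mono) auto
      finally have "t \<le> 2 * T j" .
      have "s * T j \<le> \<gamma> * sqrt ((b - a) * (t / T j)) * T j"
      proof (rule mult_right_mono)
        have "(b - a) * 1 \<le> (b - a) * (t / T j)"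
          using ab \<open>T j \<le> t\<close> T0[of j] by (intro mult_left_mono) (auto simp: le_divide_eq)
        then show "s \<le> \<gamma> * sqrt ((b - a) * (t / T j))"
          unfolding s_def using \<gamma> by (intro mult_left_mono real_sqrt_le_mono) auto
      qed (use T0[of j] in simp)
      also have "\<dots> \<le> passage_time (T j) (a * t) (b * t) + e / 4 * T j"
        using rescaled[OF \<open>J \<le> j\<close> \<open>t \<le> 2 * T j\<close>] by linarith
      also have "\<dots> \<le> passage_time t (a * t) (b * t) + e / 4 * t"
        using passage_time_mono[OF order.refl order.refl \<open>T j \<le> t\<close>] \<open>T j \<le> t\<close> e
        by (intro add_mono) auto
      finally have lower: "s * T j \<le> passage_time t (a * t) (b * t) + e / 4 * t" .
      have "s * t \<le> s * T j + s * d * T j"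
        using mult_left_mono[OF small s(1)] by (simp add: algebra_simps)
      also have "s * d * T j \<le> e / 2 * t"
        using sd \<open>T j \<le> t\<close> T0[of j] e by (intro mult_mono) auto
      finally show "\<bar>passage_time t (a * t) (b * t) - \<gamma> * sqrt (b - a) * t\<bar> \<le> e * t"
        using upper lower e t mult_pos_pos[OF e t] unfolding s_def[symmetric] by (simp add: abs_le_iff)
    qed
  qed
qed

end

text \<open>The two limits control \<open>v\<close> only for large arguments; on the remaining
  compact interval monotonicity bounds the error by a constant. So the error is at most d |x| + C
  for all x, and each term takes half of e t once t is large.\<close>

lemma linear_growth_uniform:
  fixes v :: "real \<Rightarrow> real"
  assumes v: "mono v" and top: "((\<lambda>x. v x / x) \<longlongrightarrow> \<rho>) at_top"
    and bot: "((\<lambda>x. v x / x) \<longlongrightarrow> \<rho>) at_bot" and e: "0 < e" and K: "0 < K"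
  shows "\<forall>\<^sub>F t in at_top. \<forall>a. \<bar>a\<bar> \<le> K \<longrightarrow> \<bar>v (a * t) - \<rho> * a * t\<bar> \<le> e * t"
proof -
  define d where "d = e / (2 * K)"
  have d: "0 < d" using e K by (simp add: d_def)
  obtain X1 where X1: "\<And>x. X1 \<le> x \<Longrightarrow> \<bar>v x / x - \<rho>\<bar> < d"
    using tendstoD[OF top d] by (auto simp: eventually_at_top_linorder dist_real_def)
  obtain X2 where X2: "\<And>x. x \<le> X2 \<Longrightarrow> \<bar>v x / x - \<rho>\<bar> < d"
    using tendstoD[OF bot d] by (auto simp: eventually_at_bot_linorder dist_real_def)
  define X where "X = max 1 (max X1 (- X2))"
  define C where "C = \<bar>v X\<bar> + \<bar>v (- X)\<bar> + \<bar>\<rho>\<bar> * X"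
  have bound: "\<bar>v x - \<rho> * x\<bar> \<le> d * \<bar>x\<bar> + C" for x
  proof (cases "\<bar>x\<bar> \<le> X")
    case True
    then have "v (- X) \<le> v x" "v x \<le> v X" by (auto intro!: monoD[OF v])
    moreover have "\<bar>\<rho> * x\<bar> \<le> \<bar>\<rho>\<bar> * X" using True by (auto simp: abs_mult intro: mult_left_mono)
    moreover have "0 \<le> d * \<bar>x\<bar>" using d by simp
    ultimately show ?thesis unfolding C_def by linarith
  next
    case False
    then have "X1 \<le> x \<or> x \<le> X2" "x \<noteq> 0" unfolding X_def by auto
    then have "\<bar>v x / x - \<rho>\<bar> * \<bar>x\<bar> \<le> d * \<bar>x\<bar>"
      using X1 X2 by (intro mult_right_mono) (auto intro: less_imp_le)
    moreover have "\<bar>v x / x - \<rho>\<bar> * \<bar>x\<bar> = \<bar>v x - \<rho> * x\<bar>"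
      using \<open>x \<noteq> 0\<close> by (simp add: abs_mult[symmetric] left_diff_distrib)
    moreover have "0 \<le> C" by (simp add: C_def X_def)
    ultimately show ?thesis by linarith
  qed
  have "\<forall>\<^sub>F t in at_top. max 1 (2 * C / e) \<le> t" by (rule eventually_ge_at_top)
  then show ?thesis
  proof eventually_elim
    case (elim t)
    then have t: "0 < t" "2 * C \<le> e * t" using e by (auto simp: field_simps)
    show ?case
    proof (intro allI impI)
      fix a assume a: "\<bar>a\<bar> \<le> K"
      have "d * \<bar>a * t\<bar> \<le> d * (K * t)"
        using a t d by (intro mult_left_mono) (auto simp: abs_mult intro: mult_right_mono)
      also have "\<dots> = e / 2 * t" using K by (simp add: d_def)
      finally show "\<bar>v (a * t) - \<rho> * a * t\<bar> \<le> e * t"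
        using bound[of "a * t"] t(2) by (simp add: mult.assoc)
    qed
  qed
qed

lemma parabola_identity:
  fixes \<rho> c\<^sub>0 c z :: real
  assumes "0 \<le> c\<^sub>0" "z \<le> c"
  shows "\<rho> * z + 2 * \<rho> * sqrt c\<^sub>0 * sqrt (c - z) = \<rho> * (c + c\<^sub>0) - \<rho> * (sqrt (c - z) - sqrt c\<^sub>0)\<^sup>2"
  using assms by (simp add: power2_diff algebra_simps)

section \<open>Far-away starting points and the speed of the second-class particle\<close>

context weighted_configuration
begin

text \<open>At distance K s to the left the profile loses at least \<rho> K s / 2, while the passage
  time grows only like sqrt (K + c) times s; a large K makes the loss win.\<close>

lemma far_field:
  assumes U: "uniform_passage \<gamma> at_top (\<lambda>t. t)" and \<rho>: "0 < \<rho>"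
    and bot: "((\<lambda>x. v x / x) \<longlongrightarrow> \<rho>) at_bot" and c: "0 \<le> c"
  obtains K S where "0 < K" "0 < S"
    "\<And>s z x t. S \<le> s \<Longrightarrow> z \<le> - K * s \<Longrightarrow> t \<le> s \<Longrightarrow> x \<le> c * s \<Longrightarrow> v z + passage_time t z x \<le> 0"
proof -
  have "((\<lambda>K. (\<gamma> * sqrt (K + c) + 1) / K) \<longlongrightarrow> 0) at_top" by real_asymp
  from order_tendstoD(2)[OF this, of "\<rho> / 2"] \<rho>
  have "\<forall>\<^sub>F K in at_top. (\<gamma> * sqrt (K + c) + 1) / K < \<rho> / 2 \<and> c + 1 \<le> K"
    using eventually_ge_at_top by (auto intro: eventually_conj)
  then obtain K where K: "(\<gamma> * sqrt (K + c) + 1) / K < \<rho> / 2" "c + 1 \<le> K"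
    by (auto simp: eventually_at_top_linorder)
  then have K0: "0 < K" using c by simp
  obtain S1 where S1: "\<And>t a b. S1 \<le> t \<Longrightarrow> - K \<le> a \<and> a \<le> b \<and> b \<le> K \<Longrightarrow>
      \<bar>passage_time t (a * t) (b * t) - \<gamma> * sqrt (b - a) * t\<bar> \<le> 1 * t"
    using uniform_passageD[OF U, of 1 K] unfolding eventually_at_top_linorder by auto
  have "\<forall>\<^sub>F x in at_bot. \<rho> / 2 < v x / x" using order_tendstoD(1)[OF bot, of "\<rho> / 2"] \<rho> by simp
  then obtain Z where Z: "\<And>x. x \<le> Z \<Longrightarrow> \<rho> / 2 < v x / x" by (auto simp: eventually_at_bot_linorder)
  define S where "S = max 1 (max S1 (- Z / K))"
  show ?thesis
  proof (rule that[of K S])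
    show "0 < K" by fact
    show "0 < S" by (simp add: S_def)
    fix s z x t assume s: "S \<le> s" and z: "z \<le> - K * s" and t: "t \<le> s" and x: "x \<le> c * s"
    \<comment> \<open>Each z is treated at its own scale \<open>s'\<close>, at which it sits exactly
      at \<open>- K\<close>. Thus one compact window of the uniform limit covers all z down to minus
      infinity.\<close>
    define s' where "s' = - z / K"
    have s': "s \<le> s'" "z = - K * s'" using z K0 by (auto simp: s'_def field_simps)
    have pos: "0 < s'" "S1 \<le> s'" "- Z / K \<le> s'" using s s' by (auto simp: S_def)
    then have "z \<le> Z" using s' K0 by (simp add: field_simps)
    moreover have "z < 0" using s' K0 pos by simp
    ultimately have "v z < \<rho> / 2 * z" using Z[of z] by (simp add: field_simps)
    moreover have "passage_time t z x \<le> passage_time s' (- K * s') (c * s')"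
      using s' t x mult_left_mono[OF s'(1) c] by (intro passage_time_mono) auto
    moreover have "passage_time s' (- K * s') (c * s') \<le> (\<gamma> * sqrt (K + c) + 1) * s'"
      using S1[OF pos(2), of "- K" c] K c by (simp add: distrib_right add.commute)
    moreover have "(\<gamma> * sqrt (K + c) + 1) * s' \<le> \<rho> / 2 * K * s'"
      using K(1) K0 pos by (intro mult_right_mono) (auto simp: field_simps)
    ultimately show "v z + passage_time t z x \<le> 0" using s'(2) by simp
  qed
qed

text \<open>Distant z contribute at most 0 by \<open>far_field\<close>; the others are bounded by
  monotonicity of \<open>v\<close> and of the passage time.\<close>

lemma bdd_above_heights:
  assumes U: "uniform_passage \<gamma> at_top (\<lambda>t. t)" and \<rho>: "0 < \<rho>"
    and bot: "((\<lambda>x. v x / x) \<longlongrightarrow> \<rho>) at_bot" and v: "mono v"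
  shows "bdd_above ((\<lambda>z. v z + passage_time t z x) ` {..x})"
proof -
  obtain K S where K: "0 < K" "0 < S"
    "\<And>s z x t. S \<le> s \<Longrightarrow> z \<le> - K * s \<Longrightarrow> t \<le> s \<Longrightarrow> x \<le> 1 * s \<Longrightarrow> v z + passage_time t z x \<le> 0"
    using far_field[OF U \<rho> bot, of 1] by auto
  define s where "s = max S (max t x)"
  have "v z + passage_time t z x \<le> max 0 (v x + passage_time t (- K * s) x)" if "z \<le> x" for z
  proof (cases "z \<le> - K * s")
    case True
    then have "v z + passage_time t z x \<le> 0" by (intro K(3)[of s]) (auto simp: s_def)
    then show ?thesis by simp
  next
    case False
    then have "v z + passage_time t z x \<le> v x + passage_time t (- K * s) x"
      using that by (intro add_mono monoD[OF v] passage_time_mono) auto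
    then show ?thesis by simp
  qed
  then show ?thesis by (intro bdd_aboveI) auto
qed

text \<open>The particle is an infimum, so the two bounds differ in kind: the lower bound must
  reject every x below (c0 - \<delta>) t, hence the uniformity in the endpoints, while the upper
  bound only has to accept x = (c0 + \<delta>) t.\<close>

theorem second_class_speed:
  assumes U: "uniform_passage (2 * \<rho> * sqrt c\<^sub>0) at_top (\<lambda>t. t)"
    and \<rho>: "0 < \<rho>" and c0: "0 < c\<^sub>0" and \<nu>: "\<nu> \<in> fluid_measures" and \<epsilon>: "0 < \<epsilon>"
    and top: "((\<lambda>x. mass_function \<nu> x / x) \<longlongrightarrow> \<rho>) at_top"
    and bot: "((\<lambda>x. mass_function \<nu> x / x) \<longlongrightarrow> \<rho>) at_bot"
  shows "((\<lambda>t. second_class_particle p w \<epsilon> \<nu> t / ereal t) \<longlongrightarrow> ereal c\<^sub>0) at_top"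
proof -
  define v where "v = mass_function \<nu>"
  define \<gamma> where "\<gamma> = 2 * \<rho> * sqrt c\<^sub>0"
  have U: "uniform_passage \<gamma> at_top (\<lambda>t. t)" using U by (simp add: \<gamma>_def)
  have v: "mono v" using \<nu> by (auto simp: v_def fluid_measures_def intro!: mass_function_mono)
  have top: "((\<lambda>x. v x / x) \<longlongrightarrow> \<rho>) at_top" and bot: "((\<lambda>x. v x / x) \<longlongrightarrow> \<rho>) at_bot"
    using top bot by (simp_all add: v_def)
  have bdd: "bdd_above ((\<lambda>z. v z + passage_time t z x) ` {..x})" for t x
    by (rule bdd_above_heights[OF U \<rho> bot v])
  define L where "L x t = (SUP z\<in>{..<0}. v z + passage_time t z x)" for x t
  define R where "R x t = (SUP z\<in>{0..x}. v z + passage_time t z x)" for x t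
  have X: "second_class_particle p w \<epsilon> \<nu> t = (INF x\<in>{x. 0 \<le> x \<and> L x t \<le> R x t}. ereal x)" for t
    unfolding L_def R_def v_def
    by (rule second_class_particle_eq[OF \<nu> \<epsilon> bdd[unfolded v_def]])
  have bddL: "bdd_above ((\<lambda>z. v z + passage_time t z x) ` {..<0})" if "0 \<le> x" for t x
    by (rule bdd_above_mono[OF bdd[of t x]]) (use that in auto)
  have bddR: "bdd_above ((\<lambda>z. v z + passage_time t z x) ` {0..x})" for t x
    by (rule bdd_above_mono[OF bdd[of t x]]) auto
  have uniform: "\<forall>\<^sub>F t in at_top. \<forall>z c. - K \<le> z \<and> z \<le> c \<and> c \<le> K \<longrightarrow>
      \<bar>v (z * t) + passage_time t (z * t) (c * t) -
        (\<rho> * (c + c\<^sub>0) - \<rho> * (sqrt (c - z) - sqrt c\<^sub>0)\<^sup>2) * t\<bar> \<le> 2 * e * t" if "0 < e" "0 < K" for e K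
    using uniform_passageD[OF U that(1), of K] linear_growth_uniform[OF v top bot that]
  proof eventually_elim
    case (elim t)
    show ?case
    proof (intro allI impI)
      fix z c assume zc: "- K \<le> z \<and> z \<le> c \<and> c \<le> K"
      then have 1: "\<bar>passage_time t (z * t) (c * t) - \<gamma> * sqrt (c - z) * t\<bar> \<le> e * t"
        using elim(1) by blast
      have 2: "\<bar>v (z * t) - \<rho> * z * t\<bar> \<le> e * t" using elim(2) zc by auto
      have "(\<rho> * (c + c\<^sub>0) - \<rho> * (sqrt (c - z) - sqrt c\<^sub>0)\<^sup>2) * t =
          \<rho> * z * t + \<gamma> * sqrt (c - z) * t"
        using parabola_identity[of c\<^sub>0 z c \<rho>] zc c0 by (simp add: \<gamma>_def distrib_right[symmetric])
      then show "\<bar>v (z * t) + passage_time t (z * t) (c * t) -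
        (\<rho> * (c + c\<^sub>0) - \<rho> * (sqrt (c - z) - sqrt c\<^sub>0)\<^sup>2) * t\<bar> \<le> 2 * e * t"
        using 1 2 by linarith
    qed
  qed
  have lower: "\<forall>\<^sub>F t in at_top. ereal ((c\<^sub>0 - \<delta>) * t) \<le> second_class_particle p w \<epsilon> \<nu> t"
    if \<delta>: "0 < \<delta>" "\<delta> < c\<^sub>0" for \<delta>
  proof -
    \<comment> \<open>For z at least 0 and c below \<open>c\<^sub>0 - \<delta>\<close> the root of c
      - z stays below that of \<open>c\<^sub>0 - \<delta>\<close>, so every such start falls short
      of the vertex value by at least \<open>m\<close>.\<close>
    define m where "m = \<rho> * (sqrt c\<^sub>0 - sqrt (c\<^sub>0 - \<delta>))\<^sup>2"
    have m: "0 < m" using \<rho> \<delta> by (simp add: m_def)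
    have "0 < m / 8" using m by simp
    from uniform[OF this c0] eventually_gt_at_top[of 0]
    show ?thesis
    proof eventually_elim
      case (elim t)
      show ?case unfolding X
      proof (rule INF_greatest)
        fix x assume "x \<in> {x. 0 \<le> x \<and> L x t \<le> R x t}"
        then have x: "0 \<le> x" "L x t \<le> R x t" by auto
        show "ereal ((c\<^sub>0 - \<delta>) * t) \<le> ereal x"
        proof (rule ccontr)
          assume "\<not> ?thesis"
          then have small: "x < (c\<^sub>0 - \<delta>) * t" by simp
          define c where "c = x / t"
          have c: "x = c * t" "0 \<le> c" "c < c\<^sub>0 - \<delta>" using elim(2) x small
            by (auto simp: c_def field_simps)
          \<comment> \<open>The vertex of the parabola, where the square vanishes; it is negative
            and hence a competitor on the left.\<close>
          have "\<bar>v ((c - c\<^sub>0) * t) + passage_time t ((c - c\<^sub>0) * t) (c * t) - \<rho> * (c + c\<^sub>0) * t\<bar> \<le> m / 4 * t"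
            using elim(1)[rule_format, of "c - c\<^sub>0" c] c \<delta> c0 by simp
          then have "(\<rho> * (c + c\<^sub>0) - m / 4) * t \<le> v ((c - c\<^sub>0) * t) + passage_time t ((c - c\<^sub>0) * t) x"
            unfolding left_diff_distrib[of "\<rho> * (c + c\<^sub>0)"] c(1) by linarith
          also have "\<dots> \<le> L x t"
            unfolding L_def using c \<delta> elim(2) x
            by (intro cSUP_upper bddL) (auto simp: mult_less_0_iff)
          finally have 1: "(\<rho> * (c + c\<^sub>0) - m / 4) * t \<le> L x t" .
          have 2: "R x t \<le> (\<rho> * (c + c\<^sub>0) - m + m / 4) * t"
            unfolding R_def
          proof (rule cSUP_least)
            show "{0..x} \<noteq> {}" using x by simp
            fix z assume z: "z \<in> {0..x}"
            define a where "a = z / t"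
            have a: "z = a * t" "0 \<le> a" "a \<le> c" using z elim(2)
              by (auto simp: a_def c_def divide_right_mono)
            have "sqrt (c - a) \<le> sqrt (c\<^sub>0 - \<delta>)" using a c by (intro real_sqrt_le_mono) auto
            moreover have "sqrt (c\<^sub>0 - \<delta>) \<le> sqrt c\<^sub>0" using \<delta> by (intro real_sqrt_le_mono) auto
            ultimately have "(sqrt c\<^sub>0 - sqrt (c\<^sub>0 - \<delta>))\<^sup>2 \<le> (sqrt c\<^sub>0 - sqrt (c - a))\<^sup>2"
              by (intro power_mono) auto
            then have "m \<le> \<rho> * (sqrt (c - a) - sqrt c\<^sub>0)\<^sup>2"
              unfolding m_def using \<rho> by (simp add: power2_commute[of "sqrt (c - a)"])
            then have "(\<rho> * (c + c\<^sub>0) - \<rho> * (sqrt (c - a) - sqrt c\<^sub>0)\<^sup>2) * t \<le> (\<rho> * (c + c\<^sub>0) - m) * t"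
              using elim(2) by (intro mult_right_mono) auto
            moreover have "\<bar>v (a * t) + passage_time t (a * t) (c * t) -
                (\<rho> * (c + c\<^sub>0) - \<rho> * (sqrt (c - a) - sqrt c\<^sub>0)\<^sup>2) * t\<bar> \<le> m / 4 * t"
              using elim(1)[rule_format, of a c] a c \<delta> c0 by simp
            then have "v z + passage_time t z x \<le>
                (\<rho> * (c + c\<^sub>0) - \<rho> * (sqrt (c - a) - sqrt c\<^sub>0)\<^sup>2) * t + m / 4 * t"
              unfolding a(1) c(1) by linarith
            ultimately show "v z + passage_time t z x \<le> (\<rho> * (c + c\<^sub>0) - m + m / 4) * t"
              by (simp add: distrib_right left_diff_distrib)
          qed
          have "(\<rho> * (c + c\<^sub>0) - m + m / 4) * t < (\<rho> * (c + c\<^sub>0) - m / 4) * t"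
            using m elim(2) by (intro mult_strict_right_mono) auto
          then show False using 1 2 x(2) by linarith
        qed
      qed
    qed
  qed
  have upper: "\<forall>\<^sub>F t in at_top. second_class_particle p w \<epsilon> \<nu> t \<le> ereal ((c\<^sub>0 + \<delta>) * t)"
    if \<delta>: "0 < \<delta>" for \<delta>
  proof -
    define c where "c = c\<^sub>0 + \<delta>"
    have c: "0 < c" "c\<^sub>0 < c" using \<delta> c0 by (auto simp: c_def)
    obtain K S where K: "0 < K" "0 < S"
      "\<And>s z x t. S \<le> s \<Longrightarrow> z \<le> - K * s \<Longrightarrow> t \<le> s \<Longrightarrow> x \<le> c * s \<Longrightarrow> v z + passage_time t z x \<le> 0"
      using far_field[OF U \<rho> bot, of c] c by auto
    \<comment> \<open>For z < 0 the root of c - z is at least sqrt c, which exceeds the root of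
      \<open>c\<^sub>0\<close>: now the left side falls short by at least \<open>m\<close>.\<close>
    define m where "m = \<rho> * (sqrt c - sqrt c\<^sub>0)\<^sup>2"
    have m: "0 < m" using \<rho> c by (simp add: m_def)
    \<comment> \<open>The second entry keeps the value reached on the right nonnegative, so that it
      also beats the bound 0 from \<open>far_field\<close>.\<close>
    have "0 < min (m / 8) (\<rho> * (c + c\<^sub>0) / 8)" using m \<rho> c c0 by simp
    from uniform[OF this, of "K + c"] K c eventually_ge_at_top[of S]
    have "\<forall>\<^sub>F t in at_top. (\<forall>z d. - (K + c) \<le> z \<and> z \<le> d \<and> d \<le> K + c \<longrightarrow>
      \<bar>v (z * t) + passage_time t (z * t) (d * t) -
        (\<rho> * (d + c\<^sub>0) - \<rho> * (sqrt (d - z) - sqrt c\<^sub>0)\<^sup>2) * t\<bar> \<le>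
        2 * min (m / 8) (\<rho> * (c + c\<^sub>0) / 8) * t) \<and> S \<le> t" by (auto intro: eventually_conj)
    then show ?thesis
    proof eventually_elim
      case (elim t)
      define e where "e = 2 * min (m / 8) (\<rho> * (c + c\<^sub>0) / 8)"
      have e: "e \<le> m / 4" "e \<le> \<rho> * (c + c\<^sub>0) / 4" by (auto simp: e_def)
      have t: "0 < t" "S \<le> t" using elim K by auto
      have u: "\<bar>v (z * t) + passage_time t (z * t) (c * t) -
        (\<rho> * (c + c\<^sub>0) - \<rho> * (sqrt (c - z) - sqrt c\<^sub>0)\<^sup>2) * t\<bar> \<le> e * t"
        if "- (K + c) \<le> z" "z \<le> c" for z
        using elim that K unfolding e_def by auto
      \<comment> \<open>Here \<open>\<delta>\<close> is the vertex \<open>c - c\<^sub>0\<close>, now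
        to the right of the origin.\<close>
      have "\<bar>v (\<delta> * t) + passage_time t (\<delta> * t) (c * t) - \<rho> * (c + c\<^sub>0) * t\<bar> \<le> e * t"
        using u[of \<delta>] K c \<delta> c0 by (simp add: c_def)
      then have "(\<rho> * (c + c\<^sub>0) - e) * t \<le> v (\<delta> * t) + passage_time t (\<delta> * t) (c * t)"
        by (simp add: left_diff_distrib)
      also have "\<dots> \<le> R (c * t) t"
        unfolding R_def using \<delta> t c0 by (intro cSUP_upper bddR) (auto simp: c_def)
      finally have 1: "(\<rho> * (c + c\<^sub>0) - e) * t \<le> R (c * t) t" .
      have 2: "L (c * t) t \<le> (\<rho> * (c + c\<^sub>0) - e) * t"
        unfolding L_def
      proof (rule cSUP_least)
        fix z :: real assume z: "z \<in> {..<0}"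
        show "v z + passage_time t z (c * t) \<le> (\<rho> * (c + c\<^sub>0) - e) * t"
        proof (cases "z \<le> - K * t")
          case True
          then have "v z + passage_time t z (c * t) \<le> 0" using t by (intro K(3)[of t]) auto
          also have "0 \<le> (\<rho> * (c + c\<^sub>0) - e) * t"
          proof (rule mult_nonneg_nonneg)
            have "0 < \<rho> * (c + c\<^sub>0)" using \<rho> c c0 by simp
            then show "0 \<le> \<rho> * (c + c\<^sub>0) - e" using e(2) by linarith
          qed (use t in simp)
          finally show ?thesis .
        next
          case False
          define a where "a = z / t"
          have "- K * t < a * t" using False t by (simp add: a_def)
          then have "- K < a" by (rule mult_right_less_imp_less) (use t in simp)
          then have "- (K + c) \<le> a" using c by linarith
          moreover have "z = a * t" "a < 0" using z t by (auto simp: a_def divide_neg_pos)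
          ultimately have a: "z = a * t" "- (K + c) \<le> a" "a < 0" by blast+
          have "sqrt c \<le> sqrt (c - a)" using a by (intro real_sqrt_le_mono) auto
          moreover have "sqrt c\<^sub>0 \<le> sqrt c" using c by (intro real_sqrt_le_mono) auto
          ultimately have "(sqrt c - sqrt c\<^sub>0)\<^sup>2 \<le> (sqrt (c - a) - sqrt c\<^sub>0)\<^sup>2"
            by (intro power_mono) auto
          then have "m \<le> \<rho> * (sqrt (c - a) - sqrt c\<^sub>0)\<^sup>2" unfolding m_def using \<rho> by simp
          then have "(\<rho> * (c + c\<^sub>0) - \<rho> * (sqrt (c - a) - sqrt c\<^sub>0)\<^sup>2) * t + e * t \<le>
              (\<rho> * (c + c\<^sub>0) - m) * t + e * t"
            using t by (intro add_right_mono mult_right_mono) auto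
          also have "\<dots> \<le> (\<rho> * (c + c\<^sub>0) - e) * t"
          proof -
            have "e + e \<le> m" using e m by linarith
            then have "(e + e) * t \<le> m * t" using t by (intro mult_right_mono) auto
            then show ?thesis by (simp add: distrib_right left_diff_distrib)
          qed
          finally show ?thesis using u[OF a(2)] a c by auto
        qed
      qed auto
      show ?case unfolding X c_def[symmetric]
        using 1 2 c t by (intro INF_lower) auto
    qed
  qed
  show ?thesis
  proof (rule order_tendstoI)
    fix l assume "l < ereal c\<^sub>0"
    obtain \<delta> where \<delta>: "0 < \<delta>" "\<delta> < c\<^sub>0" "l < ereal (c\<^sub>0 - \<delta>)"
    proof -
      from \<open>l < ereal c\<^sub>0\<close> c0 have "max l 0 < ereal c\<^sub>0" by simp
      from ereal_dense2[OF this] obtain r where r: "max l 0 < ereal r" "ereal r < ereal c\<^sub>0" by blast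
      show ?thesis by (rule that[of "c\<^sub>0 - r"]) (use r in auto)
    qed
    from lower[OF \<delta>(1,2)] eventually_gt_at_top[of 0]
    show "\<forall>\<^sub>F t in at_top. l < second_class_particle p w \<epsilon> \<nu> t / ereal t"
    proof eventually_elim
      case (elim t)
      have "ereal (c\<^sub>0 - \<delta>) \<le> second_class_particle p w \<epsilon> \<nu> t / ereal t"
        using elim by (intro ereal_le_divide_pos[THEN iffD2]) (auto simp: mult.commute)
      then show ?case using \<delta>(3) by (rule less_le_trans[rotated])
    qed
  next
    fix l assume "ereal c\<^sub>0 < l"
    from ereal_dense2[OF this] obtain r where r: "ereal c\<^sub>0 < ereal r" "ereal r < l" by blast
    then have "0 < r - c\<^sub>0" by simp
    from upper[OF this] eventually_gt_at_top[of 0]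
    show "\<forall>\<^sub>F t in at_top. second_class_particle p w \<epsilon> \<nu> t / ereal t < l"
    proof eventually_elim
      case (elim t)
      have "second_class_particle p w \<epsilon> \<nu> t / ereal t \<le> ereal r"
        using elim by (intro ereal_divide_le_pos[THEN iffD2]) (auto simp: mult.commute)
      then show ?case using r(2) by (rule le_less_trans)
    qed
  qed
qed

end

section \<open>The Efron--Stein inequality\<close>

lemma (in prob_space) bounded_integrable:
  fixes f :: "'a \<Rightarrow> real"
  assumes "f \<in> borel_measurable M" "\<And>x. \<bar>f x\<bar> \<le> R"
  shows "integrable M f"
  using assms by (intro integrable_const_bound[of _ R]) auto

lemma square_bound:
  fixes r R :: real shows "\<bar>r\<bar> \<le> R \<Longrightarrow> \<bar>r\<^sup>2\<bar> \<le> R\<^sup>2"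
  by (metis abs_ge_zero abs_power2 power2_abs power_mono)

lemma (in prob_space) second_moment_about:
  fixes f :: "'a \<Rightarrow> real"
  assumes [measurable]: "f \<in> borel_measurable M" and bound: "\<And>x. \<bar>f x\<bar> \<le> R"
  shows "expectation (\<lambda>x. (f x - a)\<^sup>2) = expectation (\<lambda>x. (f x)\<^sup>2) - 2 * a * expectation f + a\<^sup>2"
proof -
  have [simp]: "integrable M f" by (rule bounded_integrable[OF assms])
  have [simp]: "integrable M (\<lambda>x. (f x)\<^sup>2)"
    by (rule bounded_integrable[of _ "R\<^sup>2"], measurable, rule square_bound[OF bound])
  have "expectation (\<lambda>x. (f x - a)\<^sup>2) = expectation (\<lambda>x. (f x)\<^sup>2 - 2 * a * f x + a\<^sup>2)"
    by (intro Bochner_Integration.integral_cong) (auto simp: power2_eq_square algebra_simps)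
  then show ?thesis by (simp add: prob_space)
qed

lemma (in prob_space) variance_le_second_moment_about:
  fixes f :: "'a \<Rightarrow> real"
  assumes "f \<in> borel_measurable M" "\<And>x. \<bar>f x\<bar> \<le> R"
  shows "expectation (\<lambda>x. (f x)\<^sup>2) - (expectation f)\<^sup>2 \<le> expectation (\<lambda>x. (f x - a)\<^sup>2)"
  unfolding second_moment_about[OF assms]
  using zero_le_power2[of "expectation f - a"] by (simp add: power2_eq_square algebra_simps)

text \<open>Stated without measurability so that it also bounds integrals of sections at points
  outside the space; a non-integrable function has integral 0 by convention.\<close>

lemma (in prob_space) integral_bound:
  fixes f :: "'a \<Rightarrow> real"
  assumes bound: "\<And>x. \<bar>f x\<bar> \<le> R"
  shows "\<bar>expectation f\<bar> \<le> R"
proof (cases "integrable M f")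
  case True
  have "\<bar>expectation f\<bar> \<le> expectation (\<lambda>x. \<bar>f x\<bar>)" by (rule integral_abs_bound)
  also have "\<dots> \<le> expectation (\<lambda>_. R)" using True bound by (intro integral_mono) auto
  finally show ?thesis by (simp add: prob_space)
next
  case False
  then show ?thesis using bound[of undefined] by (simp add: not_integrable_integral_eq)
qed

text \<open>Subadditivity of the variance over two factors. By the total variance formula the excess
  over the first term on the right is the variance of h(x), the integral of F over y. As h(x) -
  \<mu> is the integral of F(x, y) - k(y), Jensen and Fubini bound it by the mean of the variances
  in x.\<close>

lemma pair_variance_le:
  fixes F :: "'a \<times> 'b \<Rightarrow> real"
  assumes "prob_space M1" "prob_space M2"
    and F [measurable]: "F \<in> borel_measurable (M1 \<Otimes>\<^sub>M M2)" and bound: "\<And>z. \<bar>F z\<bar> \<le> R"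
  shows "(\<integral>x. \<integral>y. (F (x, y))\<^sup>2 \<partial>M2 \<partial>M1) - (\<integral>x. \<integral>y. F (x, y) \<partial>M2 \<partial>M1)\<^sup>2 \<le>
    (\<integral>x. (\<integral>y. (F (x, y))\<^sup>2 \<partial>M2) - (\<integral>y. F (x, y) \<partial>M2)\<^sup>2 \<partial>M1) +
    (\<integral>y. (\<integral>x. (F (x, y))\<^sup>2 \<partial>M1) - (\<integral>x. F (x, y) \<partial>M1)\<^sup>2 \<partial>M2)"
proof -
  interpret M1: prob_space M1 by fact
  interpret M2: prob_space M2 by fact
  interpret P: pair_prob_space M1 M2 ..
  define h where "h x = (\<integral>y. F (x, y) \<partial>M2)" for x
  define k where "k y = (\<integral>x. F (x, y) \<partial>M1)" for y
  define \<mu> where "\<mu> = (\<integral>x. h x \<partial>M1)"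
  have mx: "x \<in> space M1 \<Longrightarrow> (\<lambda>y. F (x, y)) \<in> borel_measurable M2" for x by measurable
  have my: "y \<in> space M2 \<Longrightarrow> (\<lambda>x. F (x, y)) \<in> borel_measurable M1" for y by measurable
  have [measurable]: "h \<in> borel_measurable M1" unfolding h_def by measurable
  have [measurable]: "k \<in> borel_measurable M2" unfolding k_def
    by (rule M1.borel_measurable_lebesgue_integral) measurable
  have hb: "\<bar>h x\<bar> \<le> R" for x unfolding h_def by (rule M2.integral_bound) (rule bound)
  have kb: "\<bar>k y\<bar> \<le> R" for y unfolding k_def by (rule M1.integral_bound) (rule bound)
  have FP: "integrable (M1 \<Otimes>\<^sub>M M2) F" by (rule P.bounded_integrable[OF F bound])
  have F2P: "integrable (M1 \<Otimes>\<^sub>M M2) (\<lambda>z. (F z)\<^sup>2)"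
    by (rule P.bounded_integrable[of _ "R\<^sup>2"], measurable, rule square_bound[OF bound])
  have GP: "integrable (M1 \<Otimes>\<^sub>M M2) (\<lambda>z. (F z - k (snd z))\<^sup>2)"
  proof (rule P.bounded_integrable[of _ "(2 * R)\<^sup>2"])
    show "\<bar>(F z - k (snd z))\<^sup>2\<bar> \<le> (2 * R)\<^sup>2" for z
      using bound[of z] kb[of "snd z"] by (intro square_bound) linarith
  qed measurable
  have i_h: "integrable M1 h" by (rule M1.bounded_integrable[of _ R]) (auto intro: hb)
  have i_h2: "integrable M1 (\<lambda>x. (h x)\<^sup>2)"
    by (rule M1.bounded_integrable[of _ "R\<^sup>2"], measurable, rule square_bound[OF hb])
  have i_k: "integrable M2 k" by (rule M2.bounded_integrable[of _ R]) (auto intro: kb)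
  have i_k2: "integrable M2 (\<lambda>x. (k x)\<^sup>2)"
    by (rule M2.bounded_integrable[of _ "R\<^sup>2"], measurable, rule square_bound[OF kb])
  have \<mu>k: "\<mu> = (\<integral>y. k y \<partial>M2)"
    unfolding \<mu>_def h_def k_def using P.Fubini_integral[of "\<lambda>x y. F (x, y)"] FP by simp
  have "(\<integral>x. (h x - \<mu>)\<^sup>2 \<partial>M1) \<le> (\<integral>x. (\<integral>y. (F (x, y) - k y)\<^sup>2 \<partial>M2) \<partial>M1)"
  proof (rule integral_mono)
    show "integrable M1 (\<lambda>x. (h x - \<mu>)\<^sup>2)"
    proof (rule M1.bounded_integrable[of _ "(R + \<bar>\<mu>\<bar>)\<^sup>2"])
      show "\<bar>(h x - \<mu>)\<^sup>2\<bar> \<le> (R + \<bar>\<mu>\<bar>)\<^sup>2" for x using hb[of x] by (intro square_bound) linarith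
    qed measurable
    show "integrable M1 (\<lambda>x. \<integral>y. (F (x, y) - k y)\<^sup>2 \<partial>M2)"
      using P.integrable_fst'[OF GP] by simp
    fix x assume x: "x \<in> space M1"
    have m: "(\<lambda>y. F (x, y) - k y) \<in> borel_measurable M2" using mx[OF x] by measurable
    have b: "\<bar>F (x, y) - k y\<bar> \<le> 2 * R" for y using bound[of "(x, y)"] kb[of y] by linarith
    have "integrable M2 (\<lambda>y. F (x, y))"
      using mx[OF x] by (rule M2.bounded_integrable) (rule bound)
    then have a: "(\<integral>y. F (x, y) - k y \<partial>M2) = h x - \<mu>"
      using i_k by (simp add: h_def \<mu>k)
    \<comment> \<open>Jensen's inequality for the square, in the form that a variance is
      nonnegative.\<close>
    have "0 \<le> (\<integral>y. (F (x, y) - k y - (\<integral>y. F (x, y) - k y \<partial>M2))\<^sup>2 \<partial>M2)" by simp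
    then show "(h x - \<mu>)\<^sup>2 \<le> (\<integral>y. (F (x, y) - k y)\<^sup>2 \<partial>M2)"
      unfolding M2.second_moment_about[OF m b] a mult.assoc power2_eq_square[of "h x - \<mu>"] by linarith
  qed
  also have "\<dots> = (\<integral>y. (\<integral>x. (F (x, y) - k y)\<^sup>2 \<partial>M1) \<partial>M2)"
    using P.Fubini_integral[of "\<lambda>x y. (F (x, y) - k y)\<^sup>2"] GP by (simp add: case_prod_beta')
  also have "\<dots> = (\<integral>y. (\<integral>x. (F (x, y))\<^sup>2 \<partial>M1) - (k y)\<^sup>2 \<partial>M2)"
  proof (intro Bochner_Integration.integral_cong refl)
    fix y assume "y \<in> space M2"
    then have "(\<lambda>x. F (x, y)) \<in> borel_measurable M1" by (rule my)
    from M1.second_moment_about[OF this bound, of "k y"]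
    show "(\<integral>x. (F (x, y) - k y)\<^sup>2 \<partial>M1) = (\<integral>x. (F (x, y))\<^sup>2 \<partial>M1) - (k y)\<^sup>2"
      unfolding k_def[symmetric] by (simp add: power2_eq_square[of "k y"])
  qed
  finally have 1: "(\<integral>x. (h x - \<mu>)\<^sup>2 \<partial>M1) \<le> (\<integral>y. (\<integral>x. (F (x, y))\<^sup>2 \<partial>M1) - (k y)\<^sup>2 \<partial>M2)" .
  have 2: "(\<integral>x. (h x - \<mu>)\<^sup>2 \<partial>M1) = (\<integral>x. (h x)\<^sup>2 \<partial>M1) - \<mu>\<^sup>2"
    by (subst M1.second_moment_about[of h R]) (auto simp: hb \<mu>_def[symmetric] power2_eq_square)
  have 3: "(\<integral>x. (\<integral>y. (F (x, y))\<^sup>2 \<partial>M2) - (h x)\<^sup>2 \<partial>M1) =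
      (\<integral>x. \<integral>y. (F (x, y))\<^sup>2 \<partial>M2 \<partial>M1) - (\<integral>x. (h x)\<^sup>2 \<partial>M1)"
    using P.integrable_fst'[OF F2P] i_h2 by simp
  show ?thesis
    using 1 2 3 unfolding h_def[symmetric] k_def[symmetric] \<mu>_def[symmetric] by linarith
qed

text \<open>In one coordinate the variance is at most the second moment about any constant, in
  particular about the value of f with that coordinate frozen at \<open>c i\<close>. A fixed value
  thus takes the place of an independent copy. Induction over coordinates by
  \<open>pair_variance_le\<close>.\<close>

theorem efron_stein:
  fixes D :: "'i \<Rightarrow> 'b measure" and f :: "('i \<Rightarrow> 'b) \<Rightarrow> real"
  assumes D: "\<And>i. prob_space (D i)" and c: "\<And>i. c i \<in> space (D i)" and "finite I"
    and "f \<in> borel_measurable (Pi\<^sub>M I D)" "\<And>x. \<bar>f x\<bar> \<le> R"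
  shows "(\<integral>x. (f x)\<^sup>2 \<partial>Pi\<^sub>M I D) - (\<integral>x. f x \<partial>Pi\<^sub>M I D)\<^sup>2 \<le>
    (\<Sum>i\<in>I. \<integral>x. (f x - f (x(i := c i)))\<^sup>2 \<partial>Pi\<^sub>M I D)"
  using assms(3-)
proof (induction I arbitrary: f rule: finite_induct)
  case empty
  then show ?case by (simp add: PiM_empty lebesgue_integral_count_space_finite)
next
  case (insert i I)
  interpret D: product_sigma_finite D
    using D by (simp add: product_sigma_finite_def prob_space_imp_sigma_finite)
  interpret Di: prob_space "D i" by (rule D)
  interpret PI: prob_space "Pi\<^sub>M I D" by (intro prob_space_PiM D)
  interpret PJ: prob_space "Pi\<^sub>M (insert i I) D" by (intro prob_space_PiM D)
  interpret P: pair_prob_space "Pi\<^sub>M I D" "D i" ..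
  note [measurable] = insert.prems(1)
  note bound = insert.prems(2)
  define F where "F z = f ((fst z)(i := snd z))" for z
  have add_dim: "(\<lambda>z. (fst z)(i := snd z)) \<in> measurable (Pi\<^sub>M I D \<Otimes>\<^sub>M D i) (Pi\<^sub>M (insert i I) D)"
    using measurable_add_dim[of i I D] by (simp add: case_prod_beta')
  have F [measurable]: "F \<in> borel_measurable (Pi\<^sub>M I D \<Otimes>\<^sub>M D i)"
    unfolding F_def using measurable_compose[OF add_dim insert.prems(1)] .
  have Fb: "\<bar>F z\<bar> \<le> R" for z unfolding F_def by (rule bound)
  have upd: "(\<lambda>x. x(k := c k)) \<in> measurable (Pi\<^sub>M J D) (Pi\<^sub>M J D)" if "k \<in> J" for k J
    by (rule measurable_fun_upd[OF _ measurable_ident_sets]) (use that c in auto)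
  have fm: "(\<lambda>x. f (x(k := c k))) \<in> borel_measurable (Pi\<^sub>M (insert i I) D)" if "k \<in> insert i I" for k
    using measurable_compose[OF upd[OF that] insert.prems(1)] .
  have fold: "(\<integral>x. g x \<partial>Pi\<^sub>M (insert i I) D) = (\<integral>x. \<integral>y. g (x(i := y)) \<partial>D i \<partial>Pi\<^sub>M I D)"
    if "g \<in> borel_measurable (Pi\<^sub>M (insert i I) D)" "\<And>x. \<bar>g x\<bar> \<le> K" for g :: "('i \<Rightarrow> 'b) \<Rightarrow> real" and K
    by (rule D.product_integral_insert[OF insert.hyps PJ.bounded_integrable[OF that]])
  have db: "\<bar>(f x - f (x(k := c k)))\<^sup>2\<bar> \<le> (2 * R)\<^sup>2" for x k
    using bound[of x] bound[of "x(k := c k)"] by (intro square_bound) linarith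
  have Fdm: "(\<lambda>z. F (fst z, snd z) - F ((fst z)(k := c k), snd z)) \<in> borel_measurable (Pi\<^sub>M I D \<Otimes>\<^sub>M D i)"
    if "k \<in> I" for k
  proof -
    have "(\<lambda>z. ((fst z)(k := c k), snd z)) \<in> measurable (Pi\<^sub>M I D \<Otimes>\<^sub>M D i) (Pi\<^sub>M I D \<Otimes>\<^sub>M D i)"
      using measurable_compose[OF measurable_fst upd[OF that]] by measurable
    from measurable_compose[OF this F] show ?thesis by measurable
  qed
  have Fdb: "\<bar>(F (x, y) - F (x(k := c k), y))\<^sup>2\<bar> \<le> (2 * R)\<^sup>2" for x y k
    using Fb[of "(x, y)"] Fb[of "(x(k := c k), y)"] by (intro square_bound) linarith
  have Fdi: "integrable (Pi\<^sub>M I D \<Otimes>\<^sub>M D i) (\<lambda>(x, y). (F (x, y) - F (x(k := c k), y))\<^sup>2)"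
    if "k \<in> I" for k
    unfolding case_prod_beta'
    by (rule P.bounded_integrable[of _ "(2 * R)\<^sup>2"], rule borel_measurable_power[OF Fdm[OF that]],
        rule Fdb)
  let ?I = "Pi\<^sub>M I D" and ?J = "Pi\<^sub>M (insert i I) D"
  have s1: "(\<integral>x. (f x)\<^sup>2 \<partial>?J) - (\<integral>x. f x \<partial>?J)\<^sup>2 =
      (\<integral>x. \<integral>y. (F (x, y))\<^sup>2 \<partial>D i \<partial>?I) - (\<integral>x. \<integral>y. F (x, y) \<partial>D i \<partial>?I)\<^sup>2"
    unfolding F_def fst_conv snd_conv
    by (simp only: fold[OF insert.prems]
        fold[OF borel_measurable_power[OF insert.prems(1)] square_bound[OF bound]])
  have s2: "(\<integral>x. \<integral>y. (F (x, y))\<^sup>2 \<partial>D i \<partial>?I) - (\<integral>x. \<integral>y. F (x, y) \<partial>D i \<partial>?I)\<^sup>2 \<le> (\<integral>x. (\<integral>y. (F (x, y))\<^sup>2 \<partial>D i) - (\<integral>y. F (x, y) \<partial>D i)\<^sup>2 \<partial>?I) +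
      (\<integral>y. (\<integral>x. (F (x, y))\<^sup>2 \<partial>?I) - (\<integral>x. F (x, y) \<partial>?I)\<^sup>2 \<partial>D i)"
    by (rule pair_variance_le[OF _ _ F Fb]) unfold_locales
  \<comment> \<open>With x fixed, \<open>F (x, c i)\<close> is a constant in y about which the
    second moment can be taken.\<close>
  have s3: "(\<integral>x. (\<integral>y. (F (x, y))\<^sup>2 \<partial>D i) - (\<integral>y. F (x, y) \<partial>D i)\<^sup>2 \<partial>?I) \<le>
      (\<integral>x. \<integral>y. (F (x, y) - F (x, c i))\<^sup>2 \<partial>D i \<partial>?I)"
  proof (rule integral_mono)
    have m1: "(\<lambda>x. F (x, c i)) \<in> borel_measurable (?I)" using c by measurable
    have "integrable (?I \<Otimes>\<^sub>M D i) (\<lambda>z. (F z - F (fst z, c i))\<^sup>2)"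
    proof (rule P.bounded_integrable[of _ "(2 * R)\<^sup>2"])
      show "(\<lambda>z. (F z - F (fst z, c i))\<^sup>2) \<in> borel_measurable (?I \<Otimes>\<^sub>M D i)"
        using measurable_compose[OF measurable_fst m1] by measurable
      show "\<bar>(F z - F (fst z, c i))\<^sup>2\<bar> \<le> (2 * R)\<^sup>2" for z
        using Fb[of z] Fb[of "(fst z, c i)"] by (intro square_bound) linarith
    qed
    from P.integrable_fst'[OF this]
    show "integrable (?I) (\<lambda>x. \<integral>y. (F (x, y) - F (x, c i))\<^sup>2 \<partial>D i)" by simp
    have m2: "(\<lambda>x. (\<integral>y. F (x, y) \<partial>D i)) \<in> borel_measurable (?I)" by measurable
    have i1: "integrable (?I \<Otimes>\<^sub>M D i) (\<lambda>z. (F z)\<^sup>2)"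
      by (rule P.bounded_integrable[of _ "R\<^sup>2"], measurable, rule square_bound[OF Fb])
    have i2: "integrable (?I) (\<lambda>x. (\<integral>y. F (x, y) \<partial>D i)\<^sup>2)"
      by (rule PI.bounded_integrable[OF borel_measurable_power[OF m2] square_bound[OF Di.integral_bound[OF Fb]]])
    show "integrable (?I) (\<lambda>x. (\<integral>y. (F (x, y))\<^sup>2 \<partial>D i) - (\<integral>y. F (x, y) \<partial>D i)\<^sup>2)"
      using P.integrable_fst'[OF i1] i2 by simp
    fix x assume "x \<in> space (?I)"
    then have "(\<lambda>y. F (x, y)) \<in> borel_measurable (D i)" by measurable
    then show "(\<integral>y. (F (x, y))\<^sup>2 \<partial>D i) - (\<integral>y. F (x, y) \<partial>D i)\<^sup>2 \<le>
        (\<integral>y. (F (x, y) - F (x, c i))\<^sup>2 \<partial>D i)"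
      by (rule Di.variance_le_second_moment_about) (rule Fb)
  qed
  have s4: "(\<integral>x. \<integral>y. (F (x, y) - F (x, c i))\<^sup>2 \<partial>D i \<partial>?I) =
      (\<integral>x. (f x - f (x(i := c i)))\<^sup>2 \<partial>?J)"
    using fm[of i] by (subst fold[OF _ db]) (auto simp: F_def)
  \<comment> \<open>The induction hypothesis, applied to the section of \<open>F\<close> at each
    fixed value y of the new coordinate.\<close>
  have s5: "(\<integral>y. (\<integral>x. (F (x, y))\<^sup>2 \<partial>?I) - (\<integral>x. F (x, y) \<partial>?I)\<^sup>2 \<partial>D i) \<le>
      (\<integral>y. (\<Sum>k\<in>I. \<integral>x. (F (x, y) - F (x(k := c k), y))\<^sup>2 \<partial>?I) \<partial>D i)"
  proof (rule integral_mono)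
    show "integrable (D i) (\<lambda>y. \<Sum>k\<in>I. \<integral>x. (F (x, y) - F (x(k := c k), y))\<^sup>2 \<partial>?I)"
      using P.integrable_snd[OF Fdi] by (intro Bochner_Integration.integrable_sum) auto
    have m2: "(\<lambda>y. (\<integral>x. F (x, y) \<partial>?I)) \<in> borel_measurable (D i)"
      by (rule PI.borel_measurable_lebesgue_integral) measurable
    have i1: "integrable (?I \<Otimes>\<^sub>M D i) (\<lambda>(x, y). (F (x, y))\<^sup>2)"
      unfolding case_prod_beta' prod.collapse
      by (rule P.bounded_integrable[of _ "R\<^sup>2"], measurable, rule square_bound[OF Fb])
    have i2: "integrable (D i) (\<lambda>y. (\<integral>x. F (x, y) \<partial>?I)\<^sup>2)"
      by (rule Di.bounded_integrable[OF borel_measurable_power[OF m2] square_bound[OF PI.integral_bound[OF Fb]]])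
    show "integrable (D i) (\<lambda>y. (\<integral>x. (F (x, y))\<^sup>2 \<partial>?I) - (\<integral>x. F (x, y) \<partial>?I)\<^sup>2)"
      using P.integrable_snd[OF i1] i2 by simp
    fix y assume "y \<in> space (D i)"
    then have "(\<lambda>x. F (x, y)) \<in> borel_measurable (?I)" by measurable
    then show "(\<integral>x. (F (x, y))\<^sup>2 \<partial>?I) - (\<integral>x. F (x, y) \<partial>?I)\<^sup>2 \<le>
        (\<Sum>k\<in>I. \<integral>x. (F (x, y) - F (x(k := c k), y))\<^sup>2 \<partial>?I)"
      by (rule insert.IH) (rule Fb)
  qed
  have s6: "(\<integral>y. (\<Sum>k\<in>I. \<integral>x. (F (x, y) - F (x(k := c k), y))\<^sup>2 \<partial>?I) \<partial>D i) =
      (\<Sum>k\<in>I. \<integral>y. \<integral>x. (F (x, y) - F (x(k := c k), y))\<^sup>2 \<partial>?I \<partial>D i)"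
    using P.integrable_snd[OF Fdi] by (intro Bochner_Integration.integral_sum) auto
  have s7: "(\<Sum>k\<in>I. \<integral>y. \<integral>x. (F (x, y) - F (x(k := c k), y))\<^sup>2 \<partial>?I \<partial>D i) = (\<Sum>k\<in>I. \<integral>x. (f x - f (x(k := c k)))\<^sup>2 \<partial>?J)"
  proof (rule sum.cong[OF refl])
    fix k assume k: "k \<in> I"
    then have "k \<noteq> i" using insert.hyps by auto
    have "(\<integral>y. \<integral>x. (F (x, y) - F (x(k := c k), y))\<^sup>2 \<partial>?I \<partial>D i) =
        (\<integral>x. \<integral>y. (F (x, y) - F (x(k := c k), y))\<^sup>2 \<partial>D i \<partial>?I)"
      by (rule P.Fubini_integral[OF Fdi[OF k]])
    also have "\<dots> = (\<integral>x. (f x - f (x(k := c k)))\<^sup>2 \<partial>?J)"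
      using fm[of k] k \<open>k \<noteq> i\<close> by (subst fold[OF _ db]) (auto simp: F_def fun_upd_twist)
    finally show "(\<integral>y. \<integral>x. (F (x, y) - F (x(k := c k), y))\<^sup>2 \<partial>?I \<partial>D i) =
      (\<integral>x. (f x - f (x(k := c k)))\<^sup>2 \<partial>?J)" .
  qed
  show ?case unfolding sum.insert[OF insert.hyps] using s1 s2 s3 s4 s5 s6 s7 by linarith
qed

section \<open>Compound Poisson laws\<close>

primrec convolution_power :: "real measure \<Rightarrow> nat \<Rightarrow> real measure" where
  "convolution_power D 0 = return borel 0"
| "convolution_power D (Suc n) = convolution D (convolution_power D n)"

definition compound_poisson :: "real measure \<Rightarrow> real \<Rightarrow> real measure" where
  "compound_poisson D a = measure_pmf (poisson_pmf a) \<bind> convolution_power D"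

lemma sets_convolution_power [simp, measurable_cong]: "sets (convolution_power D n) = sets borel"
  by (cases n) auto

lemma prob_space_convolution:
  fixes M N :: "real measure"
  assumes "prob_space M" "prob_space N" and s: "sets M = sets borel" "sets N = sets borel"
  shows "prob_space (convolution M N)"
proof -
  interpret M: prob_space M by fact
  interpret N: prob_space N by fact
  interpret pair_prob_space M N ..
  have "(\<lambda>(x, y). x + y) \<in> measurable (M \<Otimes>\<^sub>M N) (borel :: real measure)"
    unfolding measurable_cong_sets[OF sets_pair_measure_cong[OF s] refl] by measurable
  then show ?thesis unfolding convolution_def by (rule prob_space_distr)
qed

lemma prob_space_convolution_power:
  "prob_space D \<Longrightarrow> sets D = sets borel \<Longrightarrow> prob_space (convolution_power D n)"
  by (induction n) (auto intro: prob_space_return prob_space_convolution)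

lemma convolution_power_kernel:
  assumes "prob_space D" "sets D = sets borel"
  shows "convolution_power D \<in> measurable (measure_pmf q) (subprob_algebra borel)"
  using prob_space_convolution_power[OF assms]
  by (auto simp: space_subprob_algebra intro!: prob_space_imp_subprob_space)

lemma sets_compound_poisson [simp, measurable_cong]:
  assumes "prob_space D" "sets D = sets borel"
  shows "sets (compound_poisson D a) = sets borel"
  unfolding compound_poisson_def
  by (rule sets_bind) (auto simp: sets_kernel[OF convolution_power_kernel[OF assms]])

lemma prob_space_compound_poisson:
  assumes "prob_space D" "sets D = sets borel"
  shows "prob_space (compound_poisson D a)"
  unfolding compound_poisson_def
  by (rule measure_pmf.prob_space_bind[OF _ convolution_power_kernel[OF assms]])
    (simp add: prob_space_convolution_power[OF assms])

lemma emeasure_compound_poisson: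
  assumes "prob_space D" "sets D = sets borel" "A \<in> sets borel"
  shows "emeasure (compound_poisson D a) A =
    (\<integral>\<^sup>+k. emeasure (convolution_power D k) A \<partial>measure_pmf (poisson_pmf a))"
  unfolding compound_poisson_def
  by (rule emeasure_bind[OF _ convolution_power_kernel[OF assms(1,2)] assms(3)]) simp

lemma nn_integral_exp_convolution_power:
  assumes "prob_space D" "sets D = sets borel"
  shows "(\<integral>\<^sup>+x. ennreal (exp (\<theta> * x)) \<partial>convolution_power D n) =
    (\<integral>\<^sup>+x. ennreal (exp (\<theta> * x)) \<partial>D) ^ n"
proof (induction n)
  case 0
  then show ?case by (simp add: nn_integral_return)
next
  case (Suc n)
  interpret D: prob_space D by fact
  interpret C: prob_space "convolution_power D n" by (rule prob_space_convolution_power[OF assms])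
  have "(\<integral>\<^sup>+x. ennreal (exp (\<theta> * x)) \<partial>convolution_power D (Suc n)) =
      (\<integral>\<^sup>+x. \<integral>\<^sup>+y. ennreal (exp (\<theta> * (x + y))) \<partial>convolution_power D n \<partial>D)"
    using assms(2) by (simp, subst nn_integral_convolution)
      (auto simp: D.finite_measure_axioms C.finite_measure_axioms)
  also have "\<dots> = (\<integral>\<^sup>+x. ennreal (exp (\<theta> * x)) *
      (\<integral>\<^sup>+y. ennreal (exp (\<theta> * y)) \<partial>convolution_power D n) \<partial>D)"
    by (intro nn_integral_cong)
      (simp add: distrib_left exp_add ennreal_mult nn_integral_cmult)
  also have "\<dots> = (\<integral>\<^sup>+x. ennreal (exp (\<theta> * x)) \<partial>D) *
      (\<integral>\<^sup>+y. ennreal (exp (\<theta> * y)) \<partial>convolution_power D n)"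
    by (intro nn_integral_multc) (simp add: measurable_cong_sets[OF assms(2) refl])
  finally show ?case by (simp add: Suc)
qed

text \<open>Conditioning on the number k of summands leaves the mean of \<phi>^k, the generating
  function of the Poisson law at \<phi>.\<close>

lemma nn_integral_exp_compound_poisson:
  assumes D: "prob_space D" "sets D = sets borel" and a: "0 < a"
    and \<phi>: "(\<integral>\<^sup>+x. ennreal (exp (\<theta> * x)) \<partial>D) = ennreal \<phi>" "0 \<le> \<phi>"
  shows "(\<integral>\<^sup>+x. ennreal (exp (\<theta> * x)) \<partial>compound_poisson D a) = ennreal (exp (a * (\<phi> - 1)))"
proof -
  have "(\<integral>\<^sup>+x. ennreal (exp (\<theta> * x)) \<partial>compound_poisson D a) =
      (\<integral>\<^sup>+k. \<integral>\<^sup>+x. ennreal (exp (\<theta> * x)) \<partial>convolution_power D k \<partial>measure_pmf (poisson_pmf a))"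
    unfolding compound_poisson_def
    by (rule nn_integral_bind[OF _ convolution_power_kernel[OF D]]) measurable
  also have "\<dots> = (\<integral>\<^sup>+k. ennreal (\<phi> ^ k) \<partial>measure_pmf (poisson_pmf a))"
    using \<phi> by (simp add: nn_integral_exp_convolution_power[OF D] ennreal_power)
  also have "\<dots> = (\<integral>\<^sup>+k. ennreal (pmf (poisson_pmf a) k) * ennreal (\<phi> ^ k) \<partial>count_space UNIV)"
    by (rule nn_integral_measure_pmf)
  also have "\<dots> = (\<Sum>k. ennreal ((a * \<phi>) ^ k / fact k * exp (- a)))"
    using a \<phi> by (simp add: nn_integral_count_space_nat ennreal_mult[symmetric] power_mult_distrib
        mult_ac)
  also have "\<dots> = ennreal (exp (a * \<phi>) * exp (- a))"
  proof (rule suminf_ennreal_eq)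
    show "0 \<le> (a * \<phi>) ^ k / fact k * exp (- a)" for k using a \<phi> by simp
    have "(\<lambda>k. (a * \<phi>) ^ k /\<^sub>R fact k) sums exp (a * \<phi>)" by (rule exp_converges)
    then show "(\<lambda>k. (a * \<phi>) ^ k / fact k * exp (- a)) sums (exp (a * \<phi>) * exp (- a))"
      by (intro sums_mult2) (simp add: divide_inverse mult.commute)
  qed
  also have "exp (a * \<phi>) * exp (- a) = exp (a * (\<phi> - 1))"
    by (simp add: exp_add[symmetric] algebra_simps)
  finally show ?thesis .
qed

section \<open>Weights of disjoint sets\<close>

context weighted_poisson_process
begin

definition weight_law :: "real measure" where
  "weight_law = distr M borel (w 0)"

lemma weight_measurable [measurable]: "random_variable borel (w i)"
  using weights_indep by (simp add: indep_vars_def)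

declare points_measurable [measurable]

lemma weight_law_prob: "prob_space weight_law" and sets_weight_law: "sets weight_law = sets borel"
  unfolding weight_law_def by (auto intro: prob_space_distr)

lemma distr_weight: "distr M borel (w i) = weight_law"
  unfolding weight_law_def
  by (rule cdf_unique) (auto intro!: real_distribution_distr simp: weights_distribution)

lemma distr_sum_weights:
  "finite I \<Longrightarrow> distr M borel (\<lambda>\<omega>. \<Sum>i\<in>I. w i \<omega>) = convolution_power weight_law (card I)"
proof (induction I rule: finite_induct)
  case empty
  show ?case by (simp add: distr_const prob_space_axioms)
next
  case (insert i I)
  have "indep_var borel (w i) borel (\<lambda>\<omega>. \<Sum>i\<in>I. w i \<omega>)"
    using insert.hyps indep_vars_subset[OF weights_indep, of "insert i I"]
    by (intro indep_vars_sum) auto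
  from sum_indep_random_variable[OF this] insert show ?case by (simp add: distr_weight)
qed

lemma prob_sum_weights:
  assumes "finite I" "A \<in> sets borel"
  shows "emeasure M {\<omega> \<in> space M. (\<Sum>i\<in>I. w i \<omega>) \<in> A} =
    emeasure (convolution_power weight_law (card I)) A"
  using assms by (simp add: distr_sum_weights[symmetric] emeasure_distr vimage_def Int_def conj_commute)

definition box_count :: "(real \<times> real) set \<Rightarrow> 'a \<Rightarrow> nat" where
  "box_count B \<omega> = card {i. p i \<omega> \<in> B}"

definition random_box_weight :: "(real \<times> real) set \<Rightarrow> 'a \<Rightarrow> real" where
  "random_box_weight B \<omega> = box_weight (\<lambda>i. p i \<omega>) (\<lambda>i. w i \<omega>) B"

text \<open>The index set of the sum is random; indicators turn the sum into a series over all
  indices, measurable term by term.\<close>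

lemma random_box_weight_measurable:
  assumes "B \<in> sets borel" "bounded B"
  shows "random_variable borel (random_box_weight B)"
proof -
  have "random_box_weight B \<omega> = (\<Sum>i. w i \<omega> * indicator B (p i \<omega>))" if "\<omega> \<in> space M" for \<omega>
  proof -
    have "(\<Sum>i. w i \<omega> * indicator B (p i \<omega>)) = (\<Sum>i\<in>{i. p i \<omega> \<in> B}. w i \<omega> * indicator B (p i \<omega>))"
      using points_locally_finite[OF that assms(2)] by (intro suminf_finite) auto
    also have "\<dots> = random_box_weight B \<omega>"
      unfolding random_box_weight_def box_weight_def by (intro sum.cong) auto
    finally show ?thesis by simp
  qed
  moreover have "(\<lambda>\<omega>. \<Sum>i. w i \<omega> * indicator B (p i \<omega>)) \<in> borel_measurable M"
    using assms(1) by measurable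
  ultimately show ?thesis by (simp cong: measurable_cong)
qed

lemma distr_box_count:
  assumes "B \<in> sets borel" "bounded B" "0 < measure lborel B"
    and [measurable]: "box_count B \<in> measurable M (count_space UNIV)"
  shows "distr M (count_space UNIV) (box_count B) = measure_pmf (poisson_pmf (measure lborel B))"
proof (rule measure_eqI_countable[of _ UNIV])
  fix k :: nat
  have "emeasure (distr M (count_space UNIV) (box_count B)) {k} =
      emeasure M {\<omega> \<in> space M. card {i. p i \<omega> \<in> B} = k}"
    by (simp add: emeasure_distr vimage_def Int_def conj_commute box_count_def)
  also have "\<dots> = ennreal (measure lborel B ^ k / fact k * exp (- measure lborel B))"
    using poisson_count[OF assms(1,2), of k] by (simp add: emeasure_eq_measure)
  finally show "emeasure (distr M (count_space UNIV) (box_count B)) {k} =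
      emeasure (measure_pmf (poisson_pmf (measure lborel B))) {k}"
    using assms(3) by (simp add: emeasure_pmf_single)
qed auto

text \<open>
  Given which points lie in which box, the box weights are sums over disjoint index sets of the
  weights, which are independent of the points.
\<close>

lemma prob_boxes_given_indices:
  fixes J :: "'j set" and I :: "'j \<Rightarrow> nat set"
  assumes J: "finite J" "J \<noteq> {}" and B: "\<And>j. j \<in> J \<Longrightarrow> B j \<in> sets borel"
    and disj: "disjoint_family_on B J" and A: "\<And>j. j \<in> J \<Longrightarrow> A j \<in> sets borel"
    and I: "\<And>j. j \<in> J \<Longrightarrow> finite (I j)"
  shows "emeasure M {\<omega> \<in> space M. (\<forall>j\<in>J. {i. p i \<omega> \<in> B j} = I j) \<and>
      (\<forall>j\<in>J. (\<Sum>i\<in>I j. w i \<omega>) \<in> A j)} =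
    emeasure M {\<omega> \<in> space M. \<forall>j\<in>J. {i. p i \<omega> \<in> B j} = I j} *
      (\<Prod>j\<in>J. emeasure (convolution_power weight_law (card (I j))) (A j))"
proof (cases "disjoint_family_on I J")
  \<comment> \<open>Disjoint boxes cannot share an index, so the event is empty and both sides
    vanish.\<close>
  case False
  then obtain j k i where "j \<in> J" "k \<in> J" "j \<noteq> k" "i \<in> I j" "i \<in> I k"
    by (auto simp: disjoint_family_on_def)
  moreover have "B j \<inter> B k = {}" using disj calculation by (auto simp: disjoint_family_on_def)
  ultimately have e: "{\<omega> \<in> space M. \<forall>j\<in>J. {i. p i \<omega> \<in> B j} = I j} = {}" by blast
  then have e': "{\<omega> \<in> space M. (\<forall>j\<in>J. {i. p i \<omega> \<in> B j} = I j) \<and>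
      (\<forall>j\<in>J. (\<Sum>i\<in>I j. w i \<omega>) \<in> A j)} = {}" by blast
  show ?thesis unfolding e e' by simp
next
  case True
  \<comment> \<open>\<open>points_weights_indep\<close> speaks about these two generated
    sigma-algebras, so the events have to be placed in them and not merely in
    \<open>M\<close>.\<close>
  define P where "P = vimage_algebra (space M) (\<lambda>\<omega> i. p i \<omega>) (\<Pi>\<^sub>M i\<in>UNIV. borel)"
  define V where "V = vimage_algebra (space M) (\<lambda>\<omega> i. w i \<omega>) (\<Pi>\<^sub>M i\<in>UNIV. borel)"
  have [measurable]: "p i \<in> borel_measurable P" for i
  proof -
    have "(\<lambda>\<omega> i. p i \<omega>) \<in> measurable P (\<Pi>\<^sub>M i\<in>UNIV. borel)"
      unfolding P_def by (rule measurable_vimage_algebra1) (simp add: space_PiM)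
    from measurable_compose[OF this measurable_component_singleton[of i]] show ?thesis by simp
  qed
  have [measurable]: "w i \<in> borel_measurable V" for i
  proof -
    have "(\<lambda>\<omega> i. w i \<omega>) \<in> measurable V (\<Pi>\<^sub>M i\<in>UNIV. borel)"
      unfolding V_def by (rule measurable_vimage_algebra1) (simp add: space_PiM)
    from measurable_compose[OF this measurable_component_singleton[of i]] show ?thesis by simp
  qed
  have sp: "space P = space M" "space V = space M" by (simp_all add: P_def V_def)
  have E_eq: "{\<omega> \<in> space M. \<forall>j\<in>J. {i. p i \<omega> \<in> B j} = I j} =
      {\<omega> \<in> space P. \<forall>j\<in>J. \<forall>i. p i \<omega> \<in> B j \<longleftrightarrow> i \<in> I j}" by (auto simp: sp)
  have E: "{\<omega> \<in> space M. \<forall>j\<in>J. {i. p i \<omega> \<in> B j} = I j} \<in> sets P"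
    unfolding E_eq
  proof (intro sets.sets_Collect_countable_All sets.sets_Collect_finite_All J(1))
    fix j i assume "j \<in> J"
    then have [measurable]: "B j \<in> sets borel" using B by simp
    show "{\<omega> \<in> space P. (p i \<omega> \<in> B j) = (i \<in> I j)} \<in> sets P" by measurable
  qed
  have F_eq: "{\<omega> \<in> space M. \<forall>j\<in>J. (\<Sum>i\<in>I j. w i \<omega>) \<in> A j} =
      {\<omega> \<in> space V. \<forall>j\<in>J. (\<Sum>i\<in>I j. w i \<omega>) \<in> A j}" by (simp add: sp)
  have F: "{\<omega> \<in> space M. \<forall>j\<in>J. (\<Sum>i\<in>I j. w i \<omega>) \<in> A j} \<in> sets V"
    unfolding F_eq
  proof (intro sets.sets_Collect_finite_All J(1))
    fix j assume "j \<in> J"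
    then have [measurable]: "A j \<in> sets borel" using A by simp
    show "{\<omega> \<in> space V. (\<Sum>i\<in>I j. w i \<omega>) \<in> A j} \<in> sets V" by measurable
  qed
  have "indep_vars (\<lambda>j. \<Pi>\<^sub>M i\<in>I j. borel) (\<lambda>j \<omega>. restrict (\<lambda>i. w i \<omega>) (I j)) J"
    by (rule indep_vars_restrict[OF weights_indep _ True]) auto
  then have "indep_vars (\<lambda>_. borel) (\<lambda>j \<omega>. (\<lambda>f. \<Sum>i\<in>I j. f i) (restrict (\<lambda>i. w i \<omega>) (I j))) J"
    by (rule indep_vars_compose2) measurable
  then have ind: "indep_vars (\<lambda>_. borel) (\<lambda>j \<omega>. \<Sum>i\<in>I j. w i \<omega>) J"
    by (rule indep_vars_cong[THEN iffD1, rotated -1]) auto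
  have "{\<omega> \<in> space M. \<forall>j\<in>J. (\<Sum>i\<in>I j. w i \<omega>) \<in> A j} =
      (\<Inter>j\<in>J. (\<lambda>\<omega>. \<Sum>i\<in>I j. w i \<omega>) -` A j \<inter> space M)" using J by auto
  then have probF: "prob {\<omega> \<in> space M. \<forall>j\<in>J. (\<Sum>i\<in>I j. w i \<omega>) \<in> A j} =
      (\<Prod>j\<in>J. prob {\<omega> \<in> space M. (\<Sum>i\<in>I j. w i \<omega>) \<in> A j})"
    using indep_varsD_finite[OF ind J(2,1) A] by (simp add: vimage_def Int_def conj_commute)
  have "{\<omega> \<in> space M. (\<forall>j\<in>J. {i. p i \<omega> \<in> B j} = I j) \<and> (\<forall>j\<in>J. (\<Sum>i\<in>I j. w i \<omega>) \<in> A j)} =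
      {\<omega> \<in> space M. \<forall>j\<in>J. {i. p i \<omega> \<in> B j} = I j} \<inter>
      {\<omega> \<in> space M. \<forall>j\<in>J. (\<Sum>i\<in>I j. w i \<omega>) \<in> A j}" by auto
  moreover have "prob \<dots> = prob {\<omega> \<in> space M. \<forall>j\<in>J. {i. p i \<omega> \<in> B j} = I j} *
      prob {\<omega> \<in> space M. \<forall>j\<in>J. (\<Sum>i\<in>I j. w i \<omega>) \<in> A j}"
    using indep_setD[OF points_weights_indep] E F unfolding P_def V_def by blast
  ultimately have "emeasure M {\<omega> \<in> space M. (\<forall>j\<in>J. {i. p i \<omega> \<in> B j} = I j) \<and>
      (\<forall>j\<in>J. (\<Sum>i\<in>I j. w i \<omega>) \<in> A j)} =
    emeasure M {\<omega> \<in> space M. \<forall>j\<in>J. {i. p i \<omega> \<in> B j} = I j} *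
      (\<Prod>j\<in>J. emeasure M {\<omega> \<in> space M. (\<Sum>i\<in>I j. w i \<omega>) \<in> A j})"
    by (simp add: emeasure_eq_measure probF ennreal_mult prod_nonneg prod_ennreal)
  also have "(\<Prod>j\<in>J. emeasure M {\<omega> \<in> space M. (\<Sum>i\<in>I j. w i \<omega>) \<in> A j}) =
      (\<Prod>j\<in>J. emeasure (convolution_power weight_law (card (I j))) (A j))"
    using A I by (intro prod.cong refl prob_sum_weights)
  finally show ?thesis .
qed

text \<open>The space is cut into countably many events E I that fix the indices found in each box.
  On each the probability of X is that of E I times a product depending on the counts only;
  independence of the counts then splits the expectation.\<close>

lemma prob_boxes:
  fixes B :: "nat \<Rightarrow> (real \<times> real) set"
  assumes m: "0 < m"
    and B: "\<And>j. j < m \<Longrightarrow> B j \<in> sets borel" "\<And>j. j < m \<Longrightarrow> bounded (B j)"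
      "\<And>j. j < m \<Longrightarrow> 0 < measure lborel (B j)"
    and disj: "disjoint_family_on B {..<m}" and A: "\<And>j. j < m \<Longrightarrow> A j \<in> sets borel"
  shows "emeasure M {\<omega> \<in> space M. \<forall>j<m. random_box_weight (B j) \<omega> \<in> A j} =
    (\<Prod>j<m. emeasure (compound_poisson weight_law (measure lborel (B j))) (A j))"
proof -
  define q where "q j k = emeasure (convolution_power weight_law k) (A j)" for j k
  define X where "X = {\<omega> \<in> space M. \<forall>j<m. random_box_weight (B j) \<omega> \<in> A j}"
  define g where "g \<omega> = (\<Prod>j<m. q j (box_count (B j) \<omega>))" for \<omega>
  \<comment> \<open>Almost all of the bookkeeping rests on this set being countable: by local
    finiteness only finite index sets occur.\<close>
  define S where "S = (\<Pi>\<^sub>E j\<in>{..<m}. Collect (finite :: nat set \<Rightarrow> bool))"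
  define E where "E I = {\<omega> \<in> space M. \<forall>j<m. {i. p i \<omega> \<in> B j} = I j}" for I
  have cS: "countable S" unfolding S_def by (intro countable_PiE) (auto simp: countable_Collect_finite)
  have ind: "indep_vars (\<lambda>_. count_space UNIV) (\<lambda>j \<omega>. box_count (B j) \<omega>) {..<m}"
    unfolding box_count_def using B disj by (intro counts_indep) auto
  then have Nm: "box_count (B j) \<in> measurable M (count_space UNIV)" if "j < m" for j
    using that by (auto simp: indep_vars_def)
  have qm: "(\<lambda>\<omega>. q j (box_count (B j) \<omega>)) \<in> borel_measurable M" if "j < m" for j
    by (rule measurable_compose[OF Nm[OF that]]) simp
  have gm: "g \<in> borel_measurable M" unfolding g_def using qm by (intro borel_measurable_prod_ennreal) auto
  have Xm: "X \<in> sets M"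
  proof -
    have "X = {\<omega> \<in> space M. \<forall>j\<in>{..<m}. random_box_weight (B j) \<omega> \<in> A j}" by (auto simp: X_def)
    also have "\<dots> \<in> sets M"
      using B A random_box_weight_measurable
      by (intro sets.sets_Collect_finite_All) (auto intro!: measurable_sets_Collect)
    finally show ?thesis .
  qed
  have Em: "E I \<in> sets M" for I
  proof -
    have "E I = {\<omega> \<in> space M. \<forall>j\<in>{..<m}. \<forall>i. p i \<omega> \<in> B j \<longleftrightarrow> i \<in> I j}" by (auto simp: E_def)
    also have "\<dots> \<in> sets M"
    proof (intro sets.sets_Collect_finite_All sets.sets_Collect_countable_All)
      fix j i assume "j \<in> {..<m}"
      then have [measurable]: "B j \<in> sets borel" using B by simp
      show "{\<omega> \<in> space M. (p i \<omega> \<in> B j) = (i \<in> I j)} \<in> sets M" by measurable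
    qed simp
    finally show ?thesis .
  qed
  have disjE: "disjoint_family_on E S"
    unfolding disjoint_family_on_def
  proof (intro ballI impI)
    fix I I' assume I: "I \<in> S" "I' \<in> S" "I \<noteq> I'"
    then obtain j where "j < m" "I j \<noteq> I' j" unfolding S_def by (metis PiE_ext lessThan_iff)
    then show "E I \<inter> E I' = {}" by (auto simp: E_def)
  qed
  have cover: "(\<Union>I\<in>S. E I) = space M"
  proof (intro equalityI subsetI)
    fix \<omega> assume \<omega>: "\<omega> \<in> space M"
    let ?I = "\<lambda>j\<in>{..<m}. {i. p i \<omega> \<in> B j}"
    have "?I \<in> S" using points_locally_finite[OF \<omega>] B by (auto simp: S_def)
    moreover have "\<omega> \<in> E ?I" using \<omega> by (auto simp: E_def)
    ultimately show "\<omega> \<in> (\<Union>I\<in>S. E I)" by blast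
  qed (auto simp: E_def)
  \<comment> \<open>In effect \<open>g\<close> is the conditional probability of \<open>X\<close>
    given the points.\<close>
  have eq: "(\<integral>\<^sup>+\<omega>. indicator X \<omega> * indicator (E I) \<omega> \<partial>M) = (\<integral>\<^sup>+\<omega>. g \<omega> * indicator (E I) \<omega> \<partial>M)"
    if "I \<in> S" for I
  proof -
    have "(\<integral>\<^sup>+\<omega>. indicator X \<omega> * indicator (E I) \<omega> \<partial>M) = emeasure M (X \<inter> E I)"
      using Xm Em by (simp add: indicator_inter_arith[symmetric])
    also have "X \<inter> E I = {\<omega> \<in> space M. (\<forall>j\<in>{..<m}. {i. p i \<omega> \<in> B j} = I j) \<and>
        (\<forall>j\<in>{..<m}. (\<Sum>i\<in>I j. w i \<omega>) \<in> A j)}"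
      by (auto simp: X_def E_def random_box_weight_def box_weight_def)
    also have "emeasure M \<dots> = emeasure M {\<omega> \<in> space M. \<forall>j\<in>{..<m}. {i. p i \<omega> \<in> B j} = I j} *
        (\<Prod>j<m. q j (card (I j)))"
      unfolding q_def using m B A disj that
      by (intro prob_boxes_given_indices) (auto simp: S_def)
    also have "{\<omega> \<in> space M. \<forall>j\<in>{..<m}. {i. p i \<omega> \<in> B j} = I j} = E I" by (auto simp: E_def)
    also have "emeasure M (E I) * (\<Prod>j<m. q j (card (I j))) =
        (\<integral>\<^sup>+\<omega>. (\<Prod>j<m. q j (card (I j))) * indicator (E I) \<omega> \<partial>M)"
      by (subst nn_integral_cmult_indicator[OF Em]) (rule mult.commute)
    also have "\<dots> = (\<integral>\<^sup>+\<omega>. g \<omega> * indicator (E I) \<omega> \<partial>M)"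
      by (intro nn_integral_cong) (auto simp: g_def box_count_def E_def indicator_def intro!: prod.cong)
    finally show ?thesis .
  qed
  have whole: "(\<integral>\<^sup>+\<omega>. f \<omega> \<partial>M) = (\<integral>\<^sup>+I. (\<integral>\<^sup>+\<omega>. f \<omega> * indicator (E I) \<omega> \<partial>M) \<partial>count_space S)"
    if fm: "f \<in> borel_measurable M" for f :: "'a \<Rightarrow> ennreal"
  proof -
    have "(\<integral>\<^sup>+\<omega>. f \<omega> \<partial>M) = emeasure (density M f) (\<Union>I\<in>S. E I)"
      unfolding cover using fm by (simp add: emeasure_density cong: nn_integral_cong)
    also have "\<dots> = (\<integral>\<^sup>+I. emeasure (density M f) (E I) \<partial>count_space S)"
      using Em cS disjE by (intro emeasure_UN_countable) auto
    also have "\<dots> = (\<integral>\<^sup>+I. (\<integral>\<^sup>+\<omega>. f \<omega> * indicator (E I) \<omega> \<partial>M) \<partial>count_space S)"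
      using fm Em by (simp add: emeasure_density)
    finally show ?thesis .
  qed
  have "emeasure M X = (\<integral>\<^sup>+\<omega>. indicator X \<omega> \<partial>M)" using Xm by simp
  also have "\<dots> = (\<integral>\<^sup>+\<omega>. g \<omega> \<partial>M)"
    unfolding whole[OF borel_measurable_indicator[OF Xm]] whole[OF gm]
    by (rule nn_integral_cong) (rule eq, simp)
  also have "\<dots> = (\<Prod>j<m. \<integral>\<^sup>+\<omega>. q j (box_count (B j) \<omega>) \<partial>M)"
    unfolding g_def
  proof (rule indep_vars_nn_integral)
    show "indep_vars (\<lambda>_. borel) (\<lambda>j \<omega>. q j (box_count (B j) \<omega>)) {..<m}"
      by (rule indep_vars_compose2[OF ind]) simp
  qed auto
  also have "\<dots> = (\<Prod>j<m. emeasure (compound_poisson weight_law (measure lborel (B j))) (A j))"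
  proof (rule prod.cong[OF refl])
    fix j assume "j \<in> {..<m}"
    then have j: "j < m" by simp
    have "(\<integral>\<^sup>+\<omega>. q j (box_count (B j) \<omega>) \<partial>M) =
        (\<integral>\<^sup>+k. q j k \<partial>distr M (count_space UNIV) (box_count (B j)))"
      using Nm[OF j] by (simp add: nn_integral_distr)
    also have "\<dots> = emeasure (compound_poisson weight_law (measure lborel (B j))) (A j)"
      using A[OF j] unfolding q_def distr_box_count[OF B[OF j] Nm[OF j]]
      by (simp add: emeasure_compound_poisson[OF weight_law_prob sets_weight_law])
    finally show "(\<integral>\<^sup>+\<omega>. q j (box_count (B j) \<omega>) \<partial>M) =
        emeasure (compound_poisson weight_law (measure lborel (B j))) (A j)" .
  qed
  finally show ?thesis by (simp add: X_def)
qed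

text \<open>The joint law depends on the boxes only through their common area; this is where the
  dependence of passage times on the area alone originates. Product laws are determined on
  rectangles, which \<open>prob_boxes\<close> evaluates after renumbering.\<close>

lemma distr_boxes:
  fixes B :: "'j \<Rightarrow> (real \<times> real) set"
  assumes J: "finite J" "J \<noteq> {}"
    and B: "\<And>j. j \<in> J \<Longrightarrow> B j \<in> sets borel" "\<And>j. j \<in> J \<Longrightarrow> bounded (B j)"
      "\<And>j. j \<in> J \<Longrightarrow> measure lborel (B j) = a" and a: "0 < a"
    and disj: "disjoint_family_on B J"
  shows "distr M (\<Pi>\<^sub>M j\<in>J. borel) (\<lambda>\<omega>. \<lambda>j\<in>J. random_box_weight (B j) \<omega>) =
    (\<Pi>\<^sub>M j\<in>J. compound_poisson weight_law a)"
proof -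
  let ?c = "compound_poisson weight_law a"
  have c: "prob_space ?c" "sets ?c = sets borel"
    by (simp_all add: prob_space_compound_poisson weight_law_prob sets_weight_law)
  interpret product_sigma_finite "\<lambda>_ :: 'j. ?c"
    using c by (simp add: product_sigma_finite_def prob_space_imp_sigma_finite)
  have Wm: "(\<lambda>\<omega>. \<lambda>j\<in>J. random_box_weight (B j) \<omega>) \<in> measurable M (\<Pi>\<^sub>M j\<in>J. borel)"
    using B by (intro measurable_restrict random_box_weight_measurable)
  have sP: "sets (\<Pi>\<^sub>M j\<in>J. ?c) = sets (\<Pi>\<^sub>M j\<in>J. borel)"
    using c by (intro sets_PiM_cong) auto
  show ?thesis
  proof (rule PiM_eqI[OF J(1)])
    show "sets (distr M (\<Pi>\<^sub>M j\<in>J. borel) (\<lambda>\<omega>. \<lambda>j\<in>J. random_box_weight (B j) \<omega>)) =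
        sets (\<Pi>\<^sub>M j\<in>J. ?c)" by (simp add: sP)
    fix A assume "\<And>j. j \<in> J \<Longrightarrow> A j \<in> sets ?c"
    then have A: "\<And>j. j \<in> J \<Longrightarrow> A j \<in> sets borel" using c by simp
    define m where "m = card J"
    obtain h where h: "bij_betw h {..<m} J"
      using ex_bij_betw_nat_finite[OF J(1)] by (auto simp: m_def atLeast0LessThan)
    have hJ: "h i \<in> J" if "i < m" for i using h that by (auto simp: bij_betw_def)
    have surj: "\<exists>i<m. j = h i" if "j \<in> J" for j using h that by (auto simp: bij_betw_def)
    have "emeasure (distr M (\<Pi>\<^sub>M j\<in>J. borel) (\<lambda>\<omega>. \<lambda>j\<in>J. random_box_weight (B j) \<omega>)) (Pi\<^sub>E J A) =
        emeasure M ((\<lambda>\<omega>. \<lambda>j\<in>J. random_box_weight (B j) \<omega>) -` Pi\<^sub>E J A \<inter> space M)"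
      using A J by (intro emeasure_distr Wm sets_PiM_I_finite) auto
    also have "(\<lambda>\<omega>. \<lambda>j\<in>J. random_box_weight (B j) \<omega>) -` Pi\<^sub>E J A \<inter> space M =
        {\<omega> \<in> space M. \<forall>i<m. random_box_weight (B (h i)) \<omega> \<in> A (h i)}"
      using hJ surj by (auto simp: PiE_iff) blast
    also have "emeasure M \<dots> =
        (\<Prod>i<m. emeasure (compound_poisson weight_law (measure lborel (B (h i)))) (A (h i)))"
    proof (rule prob_boxes)
      show "0 < m" using J by (simp add: m_def card_gt_0_iff)
      show "disjoint_family_on (\<lambda>i. B (h i)) {..<m}"
        unfolding disjoint_family_on_def
      proof (intro ballI impI)
        fix i k assume "i \<in> {..<m}" "k \<in> {..<m}" "i \<noteq> k"
        then have "h i \<noteq> h k" "h i \<in> J" "h k \<in> J"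
          using h by (auto simp: bij_betw_def inj_on_def)
        then show "B (h i) \<inter> B (h k) = {}" using disj by (auto simp: disjoint_family_on_def)
      qed
    qed (use B A hJ a in auto)
    also have "\<dots> = (\<Prod>i<m. emeasure ?c (A (h i)))"
      using B hJ by (intro prod.cong) auto
    also have "\<dots> = (\<Prod>j\<in>J. emeasure ?c (A j))"
      by (rule prod.reindex_bij_betw[OF h])
    finally show "emeasure (distr M (\<Pi>\<^sub>M j\<in>J. borel) (\<lambda>\<omega>. \<lambda>j\<in>J. random_box_weight (B j) \<omega>)) (Pi\<^sub>E J A) =
        (\<Prod>j\<in>J. emeasure ?c (A j))" .
  qed
qed

end

section \<open>Moments of last-passage times\<close>

lemma grid_passage_cong:
  assumes "\<And>B. B \<in> {..<n} \<times> {..<n} \<Longrightarrow> W B = W' B"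
  shows "grid_passage n W = grid_passage n W'"
proof -
  have "(\<lambda>C. \<Sum>B\<in>C. W B) ` grid_chains n n = (\<lambda>C. \<Sum>B\<in>C. W' B) ` grid_chains n n"
    using assms by (intro image_cong sum.cong refl) (auto simp: grid_chains_def)
  then show ?thesis by (simp add: grid_passage_def)
qed

lemma grid_passage_measurable:
  assumes D: "sets D = sets borel"
  shows "grid_passage n \<in> borel_measurable (\<Pi>\<^sub>M B\<in>{..<n} \<times> {..<n}. D)"
  unfolding grid_passage_def
proof (rule borel_measurable_Max[OF finite_grid_chains])
  fix C assume C: "C \<in> grid_chains n n"
  show "(\<lambda>W. \<Sum>B\<in>C. W B) \<in> borel_measurable (\<Pi>\<^sub>M B\<in>{..<n} \<times> {..<n}. D)"
  proof (rule borel_measurable_sum)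
    fix B assume "B \<in> C"
    then have "B \<in> {..<n} \<times> {..<n}" using C by (auto simp: grid_chains_def)
    from measurable_component_singleton[OF this, of "\<lambda>_. D"]
    show "(\<lambda>W. W B) \<in> borel_measurable (\<Pi>\<^sub>M B\<in>{..<n} \<times> {..<n}. D)"
      unfolding measurable_cong_sets[OF refl D] .
  qed
qed

lemma measure_grid_box:
  assumes "fst a < fst b" "snd a < snd b" "0 < n"
  shows "measure lborel (grid_box a b n B) = (fst b - fst a) * (snd b - snd a) / (real n)\<^sup>2"
proof -
  have len: "emeasure lborel (grid_interval x0 x1 n i) = ennreal ((x1 - x0) / real n)"
    if "x0 < x1" for x0 x1 i
  proof -
    define d where "d = (x1 - x0) / real n"
    have "0 \<le> d" using that by (simp add: d_def)
    then show ?thesis unfolding grid_interval_def d_def[symmetric]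
      by (simp add: distrib_right)
  qed
  have "emeasure lborel (grid_box a b n B) = emeasure (lborel \<Otimes>\<^sub>M lborel) (grid_box a b n B)"
    by (simp add: lborel_prod)
  also have "\<dots> = ennreal ((fst b - fst a) / real n) * ennreal ((snd b - snd a) / real n)"
    unfolding grid_box_def using assms
    by (subst lborel.emeasure_pair_measure_Times) (simp_all add: len, simp_all add: grid_interval_def)
  also have "\<dots> = ennreal ((fst b - fst a) * (snd b - snd a) / (real n)\<^sup>2)"
    using assms by (simp add: ennreal_mult[symmetric] power2_eq_square)
  finally show ?thesis using assms by (simp add: measure_def)
qed

lemma grid_box_borel: "grid_box a b n B \<in> sets borel"
  unfolding grid_box_def grid_interval_def borel_prod[symmetric] by (intro pair_measureI) auto

lemma exp_ge_square: "0 \<le> x \<Longrightarrow> x\<^sup>2 / 2 \<le> exp (x::real)"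
  using exp_lower_Taylor_quadratic[of x] by simp

text \<open>Square the quadratic Taylor bound at x/2; the last term gives x^4/64. Subtracting 1
  matters: for a small box the mean of exp (\<theta> W) - 1 is of the order of its area, so the sum
  over all boxes stays bounded as the mesh shrinks.\<close>

lemma exp_minus_one_ge_fourth:
  assumes "0 \<le> (x::real)" shows "x ^ 4 / 64 \<le> exp x - 1"
proof -
  have "(1 + (x / 2 + (x / 2)\<^sup>2 / 2))\<^sup>2 \<le> (exp (x / 2))\<^sup>2"
    using exp_lower_Taylor_quadratic[of "x / 2"] assms by (intro power_mono) auto
  also have "(exp (x / 2))\<^sup>2 = exp x" by (simp add: exp_double[symmetric])
  also have "(1 + (x / 2 + (x / 2)\<^sup>2 / 2))\<^sup>2 = 1 + x ^ 4 / 64 + (x + x\<^sup>2 / 2 + x ^ 3 / 8)"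
    by (simp add: power2_eq_square power3_eq_cube power4_eq_xxxx field_simps)
  finally have "1 + x ^ 4 / 64 + (x + x\<^sup>2 / 2 + x ^ 3 / 8) \<le> exp x" .
  moreover have "0 \<le> x + x\<^sup>2 / 2 + x ^ 3 / 8" using assms by simp
  ultimately show ?thesis by linarith
qed

section \<open>Measurability and almost sure grid approximation of passage times\<close>

context weighted_poisson_process
begin

lemma configuration:
  "\<omega> \<in> space M \<Longrightarrow> weighted_configuration (\<lambda>i. p i \<omega>) (\<lambda>i. w i \<omega>)"
  using points_distinct points_locally_finite weights_positive by unfold_locales auto

definition passage :: "real \<times> real \<Rightarrow> real \<times> real \<Rightarrow> 'a \<Rightarrow> real" where
  "passage a b \<omega> = last_passage (\<lambda>i. p i \<omega>) (\<lambda>i. w i \<omega>) a b"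

lemma passage_nonneg: "\<omega> \<in> space M \<Longrightarrow> 0 \<le> passage a b \<omega>"
  unfolding passage_def by (rule weighted_configuration.last_passage_nonneg[OF configuration])

lemma pred_le_points: "Measurable.pred M (\<lambda>\<omega>. p i \<omega> \<le> p j \<omega>)"
proof -
  have [measurable]: "(\<lambda>\<omega>. fst (p i \<omega>)) \<in> borel_measurable M" "(\<lambda>\<omega>. snd (p i \<omega>)) \<in> borel_measurable M" for i
    by (rule measurable_compose[OF points_measurable], intro borel_measurable_continuous_onI
        continuous_intros)+
  show ?thesis unfolding less_eq_prod_def by measurable
qed

lemma pred_up_right_path: "Measurable.pred M (\<lambda>\<omega>. is \<in> up_right_paths (\<lambda>i. p i \<omega>) a b)"
proof -
  note [measurable] = pred_le_points
  have [measurable]: "{a..b} - {a} \<in> sets borel" by simp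
  have "is \<in> up_right_paths (\<lambda>i. p i \<omega>) a b \<longleftrightarrow>
      (\<forall>k<length is. \<forall>j<k. p (is ! j) \<omega> \<le> p (is ! k) \<omega> \<and> \<not> p (is ! k) \<omega> \<le> p (is ! j) \<omega>) \<and>
      (\<forall>i\<in>set is. p i \<omega> \<in> {a..b} - {a})" for \<omega>
    unfolding up_right_paths_def
    by (auto simp: sorted_wrt_iff_nth_less less_le_not_le)
  then show ?thesis by simp
qed

text \<open>The passage time is a supremum over the countably many index lists. A list that is not a
  path contributes 0, which is harmless because the empty path has weight 0.\<close>

lemma passage_measurable [measurable]: "random_variable borel (passage a b)"
proof -
  have "passage a b \<omega> = (SUP is. if is \<in> up_right_paths (\<lambda>i. p i \<omega>) a b then \<Sum>i\<leftarrow>is. w i \<omega> else 0)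
      \<and> bdd_above (range (\<lambda>is. if is \<in> up_right_paths (\<lambda>i. p i \<omega>) a b then \<Sum>i\<leftarrow>is. w i \<omega> else 0))"
    if \<omega>: "\<omega> \<in> space M" for \<omega>
  proof -
    interpret weighted_configuration "\<lambda>i. p i \<omega>" "\<lambda>i. w i \<omega>" by (rule configuration[OF \<omega>])
    let ?f = "\<lambda>is. if is \<in> up_right_paths (\<lambda>i. p i \<omega>) a b then \<Sum>i\<leftarrow>is. w i \<omega> else 0"
    have le: "?f is \<le> passage a b \<omega>" for "is"
      using last_passage_upper last_passage_nonneg by (simp add: passage_def)
    then have bdd: "bdd_above (range ?f)" by (rule bdd_aboveI2)
    obtain xs where "xs \<in> up_right_paths (\<lambda>i. p i \<omega>) a b" "passage a b \<omega> = (\<Sum>i\<leftarrow>xs. w i \<omega>)"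
      unfolding passage_def by (rule last_passage_attained)
    then have "passage a b \<omega> \<le> (SUP is. ?f is)" using cSUP_upper[OF UNIV_I bdd, of xs] by simp
    moreover have "(SUP is. ?f is) \<le> passage a b \<omega>" using le by (rule cSUP_least[OF UNIV_not_empty])
    ultimately show ?thesis using bdd by simp
  qed
  moreover have "(\<lambda>\<omega>. SUP is. if is \<in> up_right_paths (\<lambda>i. p i \<omega>) a b then \<Sum>i\<leftarrow>is. w i \<omega> else 0)
      \<in> borel_measurable M"
  proof (rule borel_measurable_cSUP)
    fix "is" :: "nat list"
    note [measurable] = pred_up_right_path
    have [measurable]: "(\<lambda>\<omega>. \<Sum>i\<leftarrow>is. w i \<omega>) \<in> borel_measurable M" by (induction "is") auto
    show "(\<lambda>\<omega>. if is \<in> up_right_paths (\<lambda>i. p i \<omega>) a b then \<Sum>i\<leftarrow>is. w i \<omega> else 0) \<in> borel_measurable M"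
      by measurable
  qed (use calculation in auto)
  ultimately show ?thesis by (simp cong: measurable_cong)
qed

lemma AE_no_point:
  assumes "B \<in> sets borel" "bounded B" "measure lborel B = 0"
  shows "AE \<omega> in M. \<forall>i. p i \<omega> \<notin> B"
proof -
  have "prob {\<omega> \<in> space M. card {i. p i \<omega> \<in> B} = 0} = 1"
    using poisson_count[OF assms(1,2), of 0] assms(3) by simp
  then have "AE \<omega> in M. \<omega> \<in> {\<omega> \<in> space M. card {i. p i \<omega> \<in> B} = 0}" by (rule AE_prob_1)
  then show ?thesis
  proof eventually_elim
    case (elim \<omega>)
    then show ?case using points_locally_finite[OF _ assms(2), of \<omega>] by auto
  qed
qed

text \<open>Two sides and one corner have area zero. They are exactly where the half-open boxes
  differ from the closed rectangle without its corner.\<close>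

lemma AE_interior:
  assumes "fst a < fst b" "snd a < snd b"
  shows "AE \<omega> in M. (\<forall>i. p i \<omega> \<in> {a..b} \<longrightarrow> fst (p i \<omega>) < fst b \<and> snd (p i \<omega>) < snd b) \<and>
    (\<forall>i. p i \<omega> \<noteq> a)"
proof -
  have area: "measure lborel (S \<times> T) = measure lborel S * measure lborel T"
    if "S \<in> sets borel" "T \<in> sets borel" for S T :: "real set"
    using that lborel.emeasure_pair_measure_Times[of S lborel T]
    by (simp add: measure_def lborel_prod[symmetric] enn2real_mult)
  have ST: "S \<times> T \<in> sets (borel :: (real \<times> real) measure)"
    if "S \<in> sets borel" "T \<in> sets borel" for S T :: "real set"
    using that unfolding borel_prod[symmetric] by (rule pair_measureI)
  have "AE \<omega> in M. \<forall>i. p i \<omega> \<notin> {fst b} \<times> {snd a..snd b}"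
    by (rule AE_no_point) (auto simp: area ST intro!: bounded_Times)
  moreover have "AE \<omega> in M. \<forall>i. p i \<omega> \<notin> {fst a..fst b} \<times> {snd b}"
    by (rule AE_no_point) (auto simp: area ST intro!: bounded_Times)
  moreover have "AE \<omega> in M. \<forall>i. p i \<omega> \<notin> {fst a} \<times> {snd a}"
    by (rule AE_no_point) (auto simp: area ST intro!: bounded_Times)
  ultimately show ?thesis
  proof eventually_elim
    case (elim \<omega>)
    show ?case
    proof (intro conjI allI impI)
      fix i
      show "p i \<omega> \<noteq> a" using elim(3) by (auto simp: mem_Times_iff)
      assume "p i \<omega> \<in> {a..b}"
      then have "fst a \<le> fst (p i \<omega>)" "fst (p i \<omega>) \<le> fst b" "snd a \<le> snd (p i \<omega>)" "snd (p i \<omega>) \<le> snd b"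
        by (auto simp: less_eq_prod_def)
      moreover have "p i \<omega> \<notin> {fst b} \<times> {snd a..snd b}" "p i \<omega> \<notin> {fst a..fst b} \<times> {snd b}"
        by (rule elim(1)[rule_format], rule elim(2)[rule_format])
      ultimately show "fst (p i \<omega>) < fst b" "snd (p i \<omega>) < snd b"
        by (auto simp: mem_Times_iff less_le)
    qed
  qed
qed

definition grid_weights :: "real \<times> real \<Rightarrow> real \<times> real \<Rightarrow> nat \<Rightarrow> 'a \<Rightarrow> nat \<times> nat \<Rightarrow> real" where
  "grid_weights a b n \<omega> = (\<lambda>B\<in>{..<n} \<times> {..<n}. random_box_weight (grid_box a b n B) \<omega>)"

abbreviation area :: "real \<times> real \<Rightarrow> real \<times> real \<Rightarrow> real" where
  "area a b \<equiv> (fst b - fst a) * (snd b - snd a)"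

abbreviation grid_law :: "nat \<Rightarrow> real \<Rightarrow> (nat \<times> nat \<Rightarrow> real) measure" where
  "grid_law n A \<equiv> (\<Pi>\<^sub>M B\<in>{..<n} \<times> {..<n}. compound_poisson weight_law (A / (real n)\<^sup>2))"

lemma compound_poisson_prob:
  "prob_space (compound_poisson weight_law A)" "sets (compound_poisson weight_law A) = sets borel"
  by (simp_all add: prob_space_compound_poisson weight_law_prob sets_weight_law)

lemma grid_weights_measurable [measurable]:
  "grid_weights a b n \<in> measurable M (\<Pi>\<^sub>M B\<in>{..<n} \<times> {..<n}. borel)"
  unfolding grid_weights_def
  by (intro measurable_restrict random_box_weight_measurable grid_box_borel bounded_grid_box)

lemma distr_grid_weights:
  assumes ab: "fst a < fst b" "snd a < snd b" and n: "0 < n"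
  shows "distr M (\<Pi>\<^sub>M B\<in>{..<n} \<times> {..<n}. borel) (grid_weights a b n) = grid_law n (area a b)"
  unfolding grid_weights_def
proof (rule distr_boxes)
  show "disjoint_family_on (grid_box a b n) ({..<n} \<times> {..<n})"
    using disjoint_grid_box[OF ab n] by (auto simp: disjoint_family_on_def)
qed (use assms in \<open>auto simp: grid_box_borel bounded_grid_box measure_grid_box\<close>)

lemma integral_grid_law:
  fixes f :: "(nat \<times> nat \<Rightarrow> real) \<Rightarrow> real"
  assumes ab: "fst a < fst b" "snd a < snd b" and n: "0 < n"
    and f: "f \<in> borel_measurable (\<Pi>\<^sub>M B\<in>{..<n} \<times> {..<n}. borel)"
  shows "(\<integral>x. f x \<partial>grid_law n (area a b)) = expectation (\<lambda>\<omega>. f (grid_weights a b n \<omega>))"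
  unfolding distr_grid_weights[OF ab n, symmetric]
  using f by (subst integral_distr) auto

lemma AE_passage_le_grid:
  assumes ab: "fst a < fst b" "snd a < snd b" and n: "0 < n"
  shows "AE \<omega> in M. passage a b \<omega> \<le> grid_passage n (grid_weights a b n \<omega>)"
  using AE_interior[OF ab] AE_space
proof eventually_elim
  case (elim \<omega>)
  interpret weighted_configuration "\<lambda>i. p i \<omega>" "\<lambda>i. w i \<omega>" by (rule configuration[OF elim(2)])
  have "passage a b \<omega> \<le> grid_passage n (\<lambda>B. box_weight (\<lambda>i. p i \<omega>) (\<lambda>i. w i \<omega>) (grid_box a b n B))"
    unfolding passage_def using elim(1)
    by (intro last_passage_le_grid_passage[OF ab n]) (auto simp: points_in_def)
  also have "\<dots> = grid_passage n (grid_weights a b n \<omega>)"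
    by (rule grid_passage_cong) (simp add: grid_weights_def random_box_weight_def)
  finally show ?case .
qed

lemma AE_grid_eventually:
  assumes ab: "fst a < fst b" "snd a < snd b"
  shows "AE \<omega> in M. \<forall>\<^sub>F n in sequentially. grid_passage n (grid_weights a b n \<omega>) = passage a b \<omega>"
  using AE_interior[OF ab] AE_space
proof eventually_elim
  case (elim \<omega>)
  interpret weighted_configuration "\<lambda>i. p i \<omega>" "\<lambda>i. w i \<omega>" by (rule configuration[OF elim(2)])
  have "\<forall>\<^sub>F n in sequentially. grid_passage n
      (\<lambda>B. box_weight (\<lambda>i. p i \<omega>) (\<lambda>i. w i \<omega>) (grid_box a b n B)) = passage a b \<omega>"
    unfolding passage_def using elim(1)
    by (intro eventually_last_passage_eq_grid_passage[OF ab]) (auto simp: points_in_def)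
  moreover have "grid_passage n (\<lambda>B. box_weight (\<lambda>i. p i \<omega>) (\<lambda>i. w i \<omega>) (grid_box a b n B)) =
      grid_passage n (grid_weights a b n \<omega>)" for n
    by (rule grid_passage_cong) (simp add: grid_weights_def random_box_weight_def)
  ultimately show ?case by simp
qed

lemma grid_passage_weights_measurable [measurable]:
  "(\<lambda>\<omega>. grid_passage n (grid_weights a b n \<omega>)) \<in> borel_measurable M"
  by (rule measurable_compose[OF grid_weights_measurable grid_passage_measurable]) simp

text \<open>Almost surely the grid times equal the passage time from some n on, and bounded
  \<open>h\<close> permits dominated convergence. The function \<open>h\<close> is free so that
  first and second moments are covered together.\<close>

lemma truncated_limit:
  assumes ab: "fst a < fst b" "snd a < snd b"
    and h: "h \<in> borel_measurable borel" "\<And>x. \<bar>h x\<bar> \<le> K"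
  shows "(\<lambda>n. expectation (\<lambda>\<omega>. h (min (grid_passage n (grid_weights a b n \<omega>)) R))) \<longlonglongrightarrow>
    expectation (\<lambda>\<omega>. h (min (passage a b \<omega>) R) :: real)"
proof (rule integral_dominated_convergence[where w="\<lambda>_. K"])
  show "AE \<omega> in M. (\<lambda>n. h (min (grid_passage n (grid_weights a b n \<omega>)) R)) \<longlonglongrightarrow> h (min (passage a b \<omega>) R)"
    using AE_grid_eventually[OF ab]
  proof eventually_elim
    case (elim \<omega>)
    then have "\<forall>\<^sub>F n in sequentially. h (min (grid_passage n (grid_weights a b n \<omega>)) R) = h (min (passage a b \<omega>) R)"
      by eventually_elim simp
    then show ?case by (rule tendsto_eventually)
  qed
qed (use h in auto)

text \<open>For each n the grids of the two rectangles have the same law, since only the area of a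
  box enters; the identity survives the limit in n.\<close>

lemma truncated_area_invariant:
  assumes ab: "fst a < fst b" "snd a < snd b" and ab': "fst a' < fst b'" "snd a' < snd b'"
    and eq: "area a b = area a' b'" and R: "0 \<le> R"
  shows "expectation (\<lambda>\<omega>. min (passage a b \<omega>) R) = expectation (\<lambda>\<omega>. min (passage a' b' \<omega>) R)"
proof -
  \<comment> \<open>The lower cut at 0 makes \<open>h\<close> bounded on the whole line; on the
    nonnegative values that occur it is the plain truncation.\<close>
  define h where "h = (\<lambda>x::real. max 0 (min x R))"
  have h: "h \<in> borel_measurable borel" "\<And>x. \<bar>h x\<bar> \<le> R" using R by (auto simp: h_def)
  have eqh: "expectation (\<lambda>\<omega>. min (passage a b \<omega>) R) = expectation (\<lambda>\<omega>. h (min (passage a b \<omega>) R))" for a b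
    using R passage_nonneg by (intro Bochner_Integration.integral_cong) (auto simp: h_def)
  have hm: "(\<lambda>x. h (min (grid_passage n x) R)) \<in> borel_measurable (\<Pi>\<^sub>M B\<in>{..<n} \<times> {..<n}. borel)" for n
    using h(1) grid_passage_measurable[OF refl, of n] by measurable
  have "expectation (\<lambda>\<omega>. h (min (grid_passage n (grid_weights a b n \<omega>)) R)) =
      expectation (\<lambda>\<omega>. h (min (grid_passage n (grid_weights a' b' n \<omega>)) R))" if "0 < n" for n
    using integral_grid_law[OF ab that hm] integral_grid_law[OF ab' that hm] eq by simp
  then have "\<forall>\<^sub>F n in sequentially.
      expectation (\<lambda>\<omega>. h (min (grid_passage n (grid_weights a b n \<omega>)) R)) =
      expectation (\<lambda>\<omega>. h (min (grid_passage n (grid_weights a' b' n \<omega>)) R))"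
    by (intro eventually_mono[OF eventually_gt_at_top[of 0]])
  from Lim_transform_eventually[OF truncated_limit[OF ab h] this]
  have "expectation (\<lambda>\<omega>. h (min (passage a b \<omega>) R)) = expectation (\<lambda>\<omega>. h (min (passage a' b' \<omega>) R))"
    using truncated_limit[OF ab' h] by (rule LIMSEQ_unique)
  then show ?thesis unfolding eqh .
qed

end

section \<open>Moment and variance bounds under an exponential moment\<close>

locale exp_weighted_poisson_process = weighted_poisson_process M p w F
  for M :: "'a measure" and p w F +
  fixes \<theta> \<phi> :: real
  assumes \<theta>_pos: "0 < \<theta>"
    and \<phi>_ge_1: "1 \<le> \<phi>"
    and weight_moment: "(\<integral>\<^sup>+x. ennreal (exp (\<theta> * x)) \<partial>weight_law) = ennreal \<phi>"
begin

text \<open>Here exp \<kappa> = 16 exp (\<phi> - 1)^2: an N by N grid has at most 16^N chains, each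
  with at most 2N boxes, and a box of area at most 1 has exponential moment at most exp (\<phi> -
  1).\<close>

definition \<kappa> :: real where "\<kappa> = ln 16 + 2 * (\<phi> - 1)"

lemma \<kappa>_pos: "0 < \<kappa>"
  using \<phi>_ge_1 by (auto simp: \<kappa>_def intro!: add_pos_nonneg)

lemma nn_integral_prod_boxes:
  assumes ab: "fst a < fst b" "snd a < snd b" and n: "0 < n" and P: "P \<subseteq> {..<n} \<times> {..<n}"
  shows "(\<integral>\<^sup>+\<omega>. (\<Prod>B\<in>P. ennreal (exp (\<theta> * random_box_weight (grid_box a b n B) \<omega>))) \<partial>M) =
    ennreal (exp (area a b / (real n)\<^sup>2 * (\<phi> - 1))) ^ card P"
proof (cases "P = {}")
  case True
  then show ?thesis by (simp add: emeasure_space_1)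
next
  case False
  define c where "c = compound_poisson weight_law (area a b / (real n)\<^sup>2)"
  have c: "prob_space c" "sets c = sets borel" by (simp_all add: c_def compound_poisson_prob)
  interpret product_sigma_finite "\<lambda>_ :: nat \<times> nat. c"
    using c by (simp add: product_sigma_finite_def prob_space_imp_sigma_finite)
  have fin: "finite P" using P by (rule finite_subset) simp
  have pos: "0 < area a b / (real n)\<^sup>2" using ab n by simp
  have law: "distr M (\<Pi>\<^sub>M B\<in>P. borel) (\<lambda>\<omega>. \<lambda>B\<in>P. random_box_weight (grid_box a b n B) \<omega>) =
      (\<Pi>\<^sub>M B\<in>P. c)"
    unfolding c_def
  proof (rule distr_boxes[OF fin False])
    show "disjoint_family_on (grid_box a b n) P"
      by (rule disjoint_family_on_mono[OF subset_UNIV disjoint_grid_box[OF ab n]])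
  qed (use ab n pos in \<open>auto simp: grid_box_borel bounded_grid_box measure_grid_box\<close>)
  have Wm: "(\<lambda>\<omega>. \<lambda>B\<in>P. random_box_weight (grid_box a b n B) \<omega>) \<in> measurable M (\<Pi>\<^sub>M B\<in>P. borel)"
    by (intro measurable_restrict random_box_weight_measurable grid_box_borel bounded_grid_box)
  have "(\<integral>\<^sup>+\<omega>. (\<Prod>B\<in>P. ennreal (exp (\<theta> * random_box_weight (grid_box a b n B) \<omega>))) \<partial>M) =
      (\<integral>\<^sup>+\<omega>. (\<Prod>B\<in>P. ennreal (exp (\<theta> * (\<lambda>B\<in>P. random_box_weight (grid_box a b n B) \<omega>) B))) \<partial>M)"
    by (intro nn_integral_cong prod.cong) auto
  also have "\<dots> = (\<integral>\<^sup>+x. (\<Prod>B\<in>P. ennreal (exp (\<theta> * x B))) \<partial>distr M (\<Pi>\<^sub>M B\<in>P. borel)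
      (\<lambda>\<omega>. \<lambda>B\<in>P. random_box_weight (grid_box a b n B) \<omega>))"
    using Wm by (subst nn_integral_distr) (auto intro!: borel_measurable_prod_ennreal)
  also have "\<dots> = (\<Prod>B\<in>P. \<integral>\<^sup>+x. ennreal (exp (\<theta> * x)) \<partial>c)"
    unfolding law using fin
    by (intro product_nn_integral_prod) (simp_all add: measurable_cong_sets[OF c(2) refl])
  also have "(\<integral>\<^sup>+x. ennreal (exp (\<theta> * x)) \<partial>c) = ennreal (exp (area a b / (real n)\<^sup>2 * (\<phi> - 1)))"
    unfolding c_def using \<phi>_ge_1 weight_moment
    by (intro nn_integral_exp_compound_poisson weight_law_prob sets_weight_law pos) auto
  finally show ?thesis by simp
qed

text \<open>A union bound on a coarse grid: N is so large that each box has area at most 1, and the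
  maximum over chains is replaced by a sum, whose terms factor by independence of the boxes.\<close>

lemma passage_exp_moment:
  assumes ab: "fst a < fst b" "snd a < snd b" and N: "0 < N" "area a b \<le> (real N)\<^sup>2"
  shows "(\<integral>\<^sup>+\<omega>. ennreal (exp (\<theta> * passage a b \<omega>)) \<partial>M) \<le> ennreal (exp (real N * \<kappa>))"
proof -
  let ?P = "grid_chains N N"
  let ?W = "\<lambda>\<omega> B. random_box_weight (grid_box a b N B) \<omega>"
  have PJ: "P \<subseteq> {..<N} \<times> {..<N}" if "P \<in> ?P" for P using that by (simp add: grid_chains_def)
  have cP: "card P \<le> 2 * N" if "P \<in> ?P" for P using card_grid_chain[OF that] by simp
  have "AE \<omega> in M. ennreal (exp (\<theta> * passage a b \<omega>)) \<le> (\<Sum>P\<in>?P. \<Prod>B\<in>P. ennreal (exp (\<theta> * ?W \<omega> B)))"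
    using AE_passage_le_grid[OF ab N(1)]
  proof eventually_elim
    case (elim \<omega>)
    have "grid_passage N (grid_weights a b N \<omega>) = grid_passage N (?W \<omega>)"
      by (rule grid_passage_cong) (simp add: grid_weights_def)
    moreover obtain P where P: "P \<in> ?P" "grid_passage N (?W \<omega>) = (\<Sum>B\<in>P. ?W \<omega> B)"
      by (rule grid_passage_attained)
    ultimately have "\<theta> * passage a b \<omega> \<le> (\<Sum>B\<in>P. \<theta> * ?W \<omega> B)"
      using elim \<theta>_pos by (simp add: sum_distrib_left[symmetric])
    then have "exp (\<theta> * passage a b \<omega>) \<le> (\<Prod>B\<in>P. exp (\<theta> * ?W \<omega> B))"
      using finite_grid_chain[OF P(1)] by (simp add: exp_sum[symmetric])
    then have "ennreal (exp (\<theta> * passage a b \<omega>)) \<le> (\<Prod>B\<in>P. ennreal (exp (\<theta> * ?W \<omega> B)))"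
      by (simp add: prod_ennreal ennreal_leI)
    also have "\<dots> \<le> (\<Sum>P\<in>?P. \<Prod>B\<in>P. ennreal (exp (\<theta> * ?W \<omega> B)))"
      using P by (intro member_le_sum) auto
    finally show ?case .
  qed
  then have "(\<integral>\<^sup>+\<omega>. ennreal (exp (\<theta> * passage a b \<omega>)) \<partial>M) \<le>
      (\<integral>\<^sup>+\<omega>. (\<Sum>P\<in>?P. \<Prod>B\<in>P. ennreal (exp (\<theta> * ?W \<omega> B))) \<partial>M)" by (rule nn_integral_mono_AE)
  also have "\<dots> = (\<Sum>P\<in>?P. \<integral>\<^sup>+\<omega>. (\<Prod>B\<in>P. ennreal (exp (\<theta> * ?W \<omega> B))) \<partial>M)"
    by (intro nn_integral_sum borel_measurable_prod_ennreal measurable_compose[OF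
        random_box_weight_measurable[OF grid_box_borel bounded_grid_box]]) measurable
  also have "\<dots> = (\<Sum>P\<in>?P. ennreal (exp (area a b / (real N)\<^sup>2 * (\<phi> - 1))) ^ card P)"
    using PJ by (intro sum.cong refl nn_integral_prod_boxes ab N(1))
  also have "\<dots> \<le> (\<Sum>P\<in>?P. ennreal (exp (\<phi> - 1)) ^ (2 * N))"
  proof (rule sum_mono)
    fix P assume P: "P \<in> ?P"
    have "area a b / (real N)\<^sup>2 * (\<phi> - 1) \<le> 1 * (\<phi> - 1)"
      using N \<phi>_ge_1 by (intro mult_right_mono) auto
    then have "exp (area a b / (real N)\<^sup>2 * (\<phi> - 1)) ^ card P \<le> exp (\<phi> - 1) ^ card P"
      by (intro power_mono) auto
    also have "\<dots> \<le> exp (\<phi> - 1) ^ (2 * N)"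
      using cP[OF P] \<phi>_ge_1 by (intro power_increasing) auto
    finally show "ennreal (exp (area a b / (real N)\<^sup>2 * (\<phi> - 1))) ^ card P \<le> ennreal (exp (\<phi> - 1)) ^ (2 * N)"
      by (simp add: ennreal_power ennreal_leI)
  qed
  also have "\<dots> = ennreal (real (card ?P) * exp (\<phi> - 1) ^ (2 * N))"
    by (simp add: ennreal_power ennreal_mult ennreal_of_nat_eq_real_of_nat)
  also have "\<dots> \<le> ennreal (16 ^ N * exp (\<phi> - 1) ^ (2 * N))"
  proof (intro ennreal_leI mult_right_mono)
    have "card ?P \<le> 16 ^ N" using card_grid_chains[of N N] by (simp add: mult_2[symmetric] power_mult)
    then have "real (card ?P) \<le> real (16 ^ N)" by (rule of_nat_mono)
    then show "real (card ?P) \<le> 16 ^ N" by simp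
  qed simp
  also have "16 ^ N * exp (\<phi> - 1) ^ (2 * N) = exp (real N * \<kappa>)"
  proof -
    have "exp (real N * \<kappa>) = exp \<kappa> ^ N" by (rule exp_of_nat_mult)
    also have "exp \<kappa> = 16 * exp (\<phi> - 1) ^ 2" unfolding \<kappa>_def exp_add exp_double by simp
    finally show ?thesis by (simp add: power_mult_distrib power_mult)
  qed
  finally show ?thesis .
qed

lemma
  assumes ab: "fst a < fst b" "snd a < snd b"
  shows integrable_passage: "integrable M (passage a b)"
    and integrable_passage_square: "integrable M (\<lambda>\<omega>. (passage a b \<omega>)\<^sup>2)"
    and integrable_exp_passage: "integrable M (\<lambda>\<omega>. exp (\<theta> * passage a b \<omega>))"
proof -
  obtain N :: nat where N: "0 < N" "area a b \<le> (real N)\<^sup>2"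
  proof -
    obtain N :: nat where "max 1 (area a b) < real N" using reals_Archimedean2 by blast
    then have "1 \<le> real N" "area a b \<le> real N" by auto
    then have "area a b \<le> real N * real N" using mult_left_mono[of 1 "real N" "real N"] by linarith
    then show ?thesis using that[of N] \<open>1 \<le> real N\<close> by (simp add: power2_eq_square)
  qed
  show exp: "integrable M (\<lambda>\<omega>. exp (\<theta> * passage a b \<omega>))"
    using passage_exp_moment[OF ab N]
    by (intro integrableI_bounded) (auto intro: le_less_trans)
  have exp': "integrable M (\<lambda>\<omega>. 2 / \<theta>\<^sup>2 * exp (\<theta> * passage a b \<omega>))" using exp by simp
  show sq: "integrable M (\<lambda>\<omega>. (passage a b \<omega>)\<^sup>2)"
  proof (rule Bochner_Integration.integrable_bound[OF exp'])
    show "AE \<omega> in M. norm ((passage a b \<omega>)\<^sup>2) \<le> norm (2 / \<theta>\<^sup>2 * exp (\<theta> * passage a b \<omega>))"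
      using AE_space
    proof eventually_elim
      case (elim \<omega>)
      have "(\<theta> * passage a b \<omega>)\<^sup>2 / 2 \<le> exp (\<theta> * passage a b \<omega>)"
        using passage_nonneg[OF elim] \<theta>_pos by (intro exp_ge_square) simp
      then show ?case using \<theta>_pos by (simp add: field_simps power_mult_distrib)
    qed
  qed simp
  show "integrable M (passage a b)"
    by (rule square_integrable_imp_integrable[OF passage_measurable sq])
qed

text \<open>Take N = ceiling s, at most 2 s: the bound N \<kappa> + 1 for \<theta> times the mean
  becomes (2 \<kappa> + 1) s.\<close>

definition C\<^sub>1 :: real where "C\<^sub>1 = (2 * \<kappa> + 1) / \<theta>"
text \<open>The factor 64 / \<theta>^4 comes from \<open>exp_minus_one_ge_fourth\<close>, the rest
  from exp y - 1 being at most y exp y with y = A (\<phi> - 1) and A at most 1.\<close>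

definition C\<^sub>2 :: real where "C\<^sub>2 = 64 / \<theta> ^ 4 * ((\<phi> - 1) * exp (\<phi> - 1))"

lemma C2_nonneg: "0 \<le> C\<^sub>2" using \<phi>_ge_1 \<theta>_pos by (simp add: C\<^sub>2_def)

lemma expectation_passage_le:
  assumes ab: "fst a < fst b" "snd a < snd b" and s: "1 \<le> s" "area a b = s\<^sup>2"
  shows "expectation (passage a b) \<le> C\<^sub>1 * s"
proof -
  define N where "N = nat \<lceil>s\<rceil>"
  have N: "0 < N" "s \<le> real N" "real N \<le> 2 * s" using s unfolding N_def by linarith+
  have "area a b \<le> (real N)\<^sup>2" unfolding s(2) using N s by (intro power_mono) auto
  from passage_exp_moment[OF ab N(1) this]
  have "ennreal (expectation (\<lambda>\<omega>. exp (\<theta> * passage a b \<omega>))) \<le> ennreal (exp (real N * \<kappa>))"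
    using integrable_exp_passage[OF ab] by (subst nn_integral_eq_integral[symmetric]) auto
  then have e: "expectation (\<lambda>\<omega>. exp (\<theta> * passage a b \<omega>)) \<le> exp (real N * \<kappa>)" by simp
  have "\<theta> * expectation (passage a b) = expectation (\<lambda>\<omega>. \<theta> * passage a b \<omega>)" by simp
  \<comment> \<open>The tangent line of exp at \<open>real N * \<kappa>\<close> turns the
    exponential moment into a bound on the mean, with an error of only 1.\<close>
  also have "\<dots> \<le> expectation (\<lambda>\<omega>. real N * \<kappa> + exp (- (real N * \<kappa>)) * exp (\<theta> * passage a b \<omega>))"
  proof (rule integral_mono)
    fix \<omega>
    have "1 + (\<theta> * passage a b \<omega> - real N * \<kappa>) \<le> exp (\<theta> * passage a b \<omega> - real N * \<kappa>)"
      by (rule exp_ge_add_one_self)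
    also have "\<dots> = exp (- (real N * \<kappa>)) * exp (\<theta> * passage a b \<omega>)" by (simp add: exp_add[symmetric])
    finally show "\<theta> * passage a b \<omega> \<le> real N * \<kappa> + exp (- (real N * \<kappa>)) * exp (\<theta> * passage a b \<omega>)"
      by linarith
  qed (use integrable_passage[OF ab] integrable_exp_passage[OF ab] in auto)
  also have "\<dots> = real N * \<kappa> + exp (- (real N * \<kappa>)) * expectation (\<lambda>\<omega>. exp (\<theta> * passage a b \<omega>))"
    using integrable_exp_passage[OF ab] by (simp add: prob_space)
  also have "\<dots> \<le> real N * \<kappa> + exp (- (real N * \<kappa>)) * exp (real N * \<kappa>)"
    using e by (intro add_left_mono mult_left_mono) auto
  also have "\<dots> = real N * \<kappa> + 1" by (simp add: exp_add[symmetric])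
  also have "\<dots> \<le> 2 * s * \<kappa> + s" using N s \<kappa>_pos by (intro add_mono mult_right_mono) auto
  also have "\<dots> = \<theta> * (C\<^sub>1 * s)" using \<theta>_pos by (simp add: C\<^sub>1_def field_simps)
  finally show ?thesis using \<theta>_pos by simp
qed

text \<open>The bound is linear in the area of the box, so the fourth moments of all boxes add up to
  at most \<open>C\<^sub>2\<close> times the area of the rectangle, whatever the mesh.\<close>

lemma box_fourth_moment:
  assumes ab: "fst a < fst b" "snd a < snd b" and n: "0 < n" and small: "area a b \<le> (real n)\<^sup>2"
    and B: "B \<in> {..<n} \<times> {..<n}"
  shows "integrable M (\<lambda>\<omega>. random_box_weight (grid_box a b n B) \<omega> ^ 4)"
    and "expectation (\<lambda>\<omega>. random_box_weight (grid_box a b n B) \<omega> ^ 4) \<le> C\<^sub>2 * (area a b / (real n)\<^sup>2)"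
proof -
  let ?W = "random_box_weight (grid_box a b n B)"
  define A where "A = area a b / (real n)\<^sup>2"
  have A: "0 \<le> A" "A \<le> 1" using ab n small by (simp_all add: A_def)
  have [measurable]: "?W \<in> borel_measurable M"
    by (rule random_box_weight_measurable[OF grid_box_borel bounded_grid_box])
  have nn: "(\<integral>\<^sup>+\<omega>. ennreal (exp (\<theta> * ?W \<omega>)) \<partial>M) = ennreal (exp (A * (\<phi> - 1)))"
    using nn_integral_prod_boxes[OF ab n, of "{B}"] B by (simp add: A_def)
  have int: "integrable M (\<lambda>\<omega>. exp (\<theta> * ?W \<omega>))"
    using nn by (intro integrableI_bounded) auto
  have ex: "expectation (\<lambda>\<omega>. exp (\<theta> * ?W \<omega>)) = exp (A * (\<phi> - 1))"
    using nn by (subst integral_eq_nn_integral) auto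
  have le: "?W \<omega> ^ 4 \<le> 64 / \<theta> ^ 4 * (exp (\<theta> * ?W \<omega>) - 1)" if "\<omega> \<in> space M" for \<omega>
  proof -
    have "0 \<le> ?W \<omega>" unfolding random_box_weight_def
      by (rule weighted_configuration.box_weight_nonneg[OF configuration[OF that]])
    then have "(\<theta> * ?W \<omega>) ^ 4 / 64 \<le> exp (\<theta> * ?W \<omega>) - 1"
      using \<theta>_pos by (intro exp_minus_one_ge_fourth) simp
    then show ?thesis using \<theta>_pos by (simp add: field_simps power_mult_distrib)
  qed
  have int': "integrable M (\<lambda>\<omega>. 64 / \<theta> ^ 4 * (exp (\<theta> * ?W \<omega>) - 1))" using int by simp
  show 1: "integrable M (\<lambda>\<omega>. ?W \<omega> ^ 4)"
  proof (rule Bochner_Integration.integrable_bound[OF int'])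
    show "AE \<omega> in M. norm (?W \<omega> ^ 4) \<le> norm (64 / \<theta> ^ 4 * (exp (\<theta> * ?W \<omega>) - 1))"
    proof (rule AE_I2)
      fix \<omega> assume "\<omega> \<in> space M"
      have "norm (?W \<omega> ^ 4) = ?W \<omega> ^ 4" by simp
      also note le[OF \<open>\<omega> \<in> space M\<close>]
      also have "64 / \<theta> ^ 4 * (exp (\<theta> * ?W \<omega>) - 1) \<le> norm (64 / \<theta> ^ 4 * (exp (\<theta> * ?W \<omega>) - 1))"
        by (simp only: real_norm_def abs_ge_self)
      finally show "norm (?W \<omega> ^ 4) \<le> norm (64 / \<theta> ^ 4 * (exp (\<theta> * ?W \<omega>) - 1))" .
    qed
  qed simp
  have "expectation (\<lambda>\<omega>. ?W \<omega> ^ 4) \<le> expectation (\<lambda>\<omega>. 64 / \<theta> ^ 4 * (exp (\<theta> * ?W \<omega>) - 1))"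
    using le by (intro integral_mono 1 int')
  also have "\<dots> = 64 / \<theta> ^ 4 * (exp (A * (\<phi> - 1)) - 1)"
    using int by (simp add: ex prob_space)
  also have "\<dots> \<le> 64 / \<theta> ^ 4 * (A * ((\<phi> - 1) * exp (\<phi> - 1)))"
  proof (rule mult_left_mono)
    define y where "y = A * (\<phi> - 1)"
    have y: "0 \<le> y" "y \<le> \<phi> - 1"
      using A \<phi>_ge_1 mult_right_mono[of A 1 "\<phi> - 1"] by (auto simp: y_def)
    have "1 - y \<le> exp (- y)" using exp_ge_add_one_self[of "- y"] by simp
    then have "(1 - y) * exp y \<le> exp (- y) * exp y" by (intro mult_right_mono) auto
    then have "exp y - 1 \<le> y * exp y" by (simp add: exp_add[symmetric] left_diff_distrib)
    also have "\<dots> \<le> y * exp (\<phi> - 1)" using y by (intro mult_left_mono) auto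
    finally show "exp (A * (\<phi> - 1)) - 1 \<le> A * ((\<phi> - 1) * exp (\<phi> - 1))"
      by (simp add: y_def mult.assoc)
  qed (use \<theta>_pos in simp)
  finally show "expectation (\<lambda>\<omega>. ?W \<omega> ^ 4) \<le> C\<^sub>2 * (area a b / (real n)\<^sup>2)"
    by (simp add: C\<^sub>2_def A_def mult_ac)
qed

text \<open>
  The discarded box plays the role of the resampled coordinate in the Efron--Stein inequality; only
  boxes on an optimal chain contribute, which is what beats the trivial bound of order \<open>s\<^sup>2\<close>.
\<close>

lemma truncated_grid_variance:
  assumes ab: "fst a < fst b" "snd a < snd b" and s: "1 \<le> s" "area a b = s\<^sup>2"
    and n: "s \<le> real n" and R: "0 \<le> R"
  defines "f \<equiv> \<lambda>x. min (grid_passage n x) R"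
  shows "expectation (\<lambda>\<omega>. (f (grid_weights a b n \<omega>))\<^sup>2) - (expectation (\<lambda>\<omega>. f (grid_weights a b n \<omega>)))\<^sup>2
    \<le> sqrt s * expectation (\<lambda>\<omega>. f (grid_weights a b n \<omega>)) + C\<^sub>2 * s"
proof -
  define c where "c = compound_poisson weight_law (area a b / (real n)\<^sup>2)"
  define J where "J = {..<n} \<times> {..<n}"
  define G where "G = grid_weights a b n"
  have n0: "0 < n" using n s by (cases n) auto
  have small: "area a b \<le> (real n)\<^sup>2" unfolding s(2) using n s by (intro power_mono) auto
  have c: "prob_space c" "sets c = sets borel" by (simp_all add: c_def compound_poisson_prob)
  have spc: "space c = UNIV" using sets_eq_imp_space_eq[OF c(2)] by simp
  have fb: "\<bar>f x\<bar> \<le> R" for x using R grid_passage_nonneg[of n x] by (simp add: f_def)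
  have gm: "grid_passage n \<in> borel_measurable (\<Pi>\<^sub>M B\<in>J. borel)"
    unfolding J_def by (rule grid_passage_measurable) simp
  have fm: "f \<in> borel_measurable (\<Pi>\<^sub>M B\<in>J. borel)" unfolding f_def using gm by measurable
  have sPc: "sets (\<Pi>\<^sub>M B\<in>J. c) = sets (\<Pi>\<^sub>M B\<in>J. borel)" by (intro sets_PiM_cong) (simp_all add: c)
  have fm': "f \<in> borel_measurable (\<Pi>\<^sub>M B\<in>J. c)" unfolding measurable_cong_sets[OF sPc refl] by (rule fm)
  have upd: "(\<lambda>x. x(B := 0)) \<in> measurable (\<Pi>\<^sub>M B\<in>J. borel) (\<Pi>\<^sub>M B\<in>J. (borel :: real measure))"
    if "B \<in> J" for B
    by (rule measurable_fun_upd[OF _ measurable_ident_sets]) (use that in auto)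
  have dm: "(\<lambda>x. (f x - f (x(B := 0)))\<^sup>2) \<in> borel_measurable (\<Pi>\<^sub>M B\<in>J. borel)" if "B \<in> J" for B
    using fm measurable_compose[OF upd[OF that] fm] by measurable
  have tr: "(\<integral>x. g x \<partial>(\<Pi>\<^sub>M B\<in>J. c)) = expectation (\<lambda>\<omega>. g (G \<omega>))"
    if "g \<in> borel_measurable (\<Pi>\<^sub>M B\<in>J. borel)" for g :: "_ \<Rightarrow> real"
    using integral_grid_law[OF ab n0, of g] that by (simp add: c_def J_def G_def)
  have Gm: "G \<in> measurable M (\<Pi>\<^sub>M B\<in>J. borel)" unfolding G_def J_def by (rule grid_weights_measurable)
  have GB: "G \<omega> B = random_box_weight (grid_box a b n B) \<omega>" if "B \<in> J" for B \<omega>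
    using that by (simp add: G_def J_def grid_weights_def)
  have int_d: "integrable M (\<lambda>\<omega>. (f (G \<omega>) - f ((G \<omega>)(B := 0)))\<^sup>2)" if "B \<in> J" for B
  proof (rule bounded_integrable[of _ "(2 * R)\<^sup>2"])
    show "(\<lambda>\<omega>. (f (G \<omega>) - f ((G \<omega>)(B := 0)))\<^sup>2) \<in> borel_measurable M"
      using measurable_compose[OF Gm dm[OF that]] by simp
    show "\<bar>(f (G \<omega>) - f ((G \<omega>)(B := 0)))\<^sup>2\<bar> \<le> (2 * R)\<^sup>2" for \<omega>
      using fb[of "G \<omega>"] fb[of "(G \<omega>)(B := 0)"] by (intro square_bound) linarith
  qed
  have int_f: "integrable M (\<lambda>\<omega>. f (G \<omega>))"
    by (rule bounded_integrable[OF measurable_compose[OF Gm fm] fb])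
  have int_4: "integrable M (\<lambda>\<omega>. G \<omega> B ^ 4)"
    and exp_4: "expectation (\<lambda>\<omega>. G \<omega> B ^ 4) \<le> C\<^sub>2 * (area a b / (real n)\<^sup>2)" if "B \<in> J" for B
    using box_fourth_moment[OF ab n0 small, of B] that unfolding GB[OF that] by (simp_all add: J_def)
  have "expectation (\<lambda>\<omega>. (f (G \<omega>))\<^sup>2) - (expectation (\<lambda>\<omega>. f (G \<omega>)))\<^sup>2 =
      (\<integral>x. (f x)\<^sup>2 \<partial>(\<Pi>\<^sub>M B\<in>J. c)) - (\<integral>x. f x \<partial>(\<Pi>\<^sub>M B\<in>J. c))\<^sup>2"
    using tr[OF fm] tr[OF borel_measurable_power[OF fm]] by simp
  also have "\<dots> \<le> (\<Sum>B\<in>J. \<integral>x. (f x - f (x(B := 0)))\<^sup>2 \<partial>(\<Pi>\<^sub>M B\<in>J. c))"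
    by (rule efron_stein[of "\<lambda>_. c" "\<lambda>_. 0" J f R]) (auto simp: c spc J_def fm'[unfolded J_def] fb)
  also have "\<dots> = (\<Sum>B\<in>J. expectation (\<lambda>\<omega>. (f (G \<omega>) - f ((G \<omega>)(B := 0)))\<^sup>2))"
    by (intro sum.cong refl tr dm)
  also have "\<dots> = expectation (\<lambda>\<omega>. \<Sum>B\<in>J. (f (G \<omega>) - f ((G \<omega>)(B := 0)))\<^sup>2)"
    using int_d by (intro Bochner_Integration.integral_sum[symmetric])
  \<comment> \<open>The threshold u = sqrt s makes the first term of order s^(3/2), while the fourth
    moments, of total order s^2, are divided by u^2 = s.\<close>
  also have "\<dots> \<le> expectation (\<lambda>\<omega>. sqrt s * f (G \<omega>) + (\<Sum>B\<in>J. G \<omega> B ^ 4) / s)"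
  proof (rule integral_mono)
    show "integrable M (\<lambda>\<omega>. \<Sum>B\<in>J. (f (G \<omega>) - f ((G \<omega>)(B := 0)))\<^sup>2)"
      using int_d by (intro Bochner_Integration.integrable_sum)
    show "integrable M (\<lambda>\<omega>. sqrt s * f (G \<omega>) + (\<Sum>B\<in>J. G \<omega> B ^ 4) / s)"
      using int_f int_4 by (intro Bochner_Integration.integrable_add integrable_mult_right
        integrable_divide Bochner_Integration.integrable_sum) auto
    fix \<omega> assume \<omega>: "\<omega> \<in> space M"
    have "0 \<le> G \<omega> B" if "B \<in> J" for B
      unfolding GB[OF that] random_box_weight_def
      by (rule weighted_configuration.box_weight_nonneg[OF configuration[OF \<omega>]])
    then show "(\<Sum>B\<in>J. (f (G \<omega>) - f ((G \<omega>)(B := 0)))\<^sup>2) \<le> sqrt s * f (G \<omega>) + (\<Sum>B\<in>J. G \<omega> B ^ 4) / s"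
      using grid_increments_le[of n "G \<omega>" R "sqrt s"] R s unfolding f_def J_def by simp
  qed
  also have "\<dots> = sqrt s * expectation (\<lambda>\<omega>. f (G \<omega>)) + (\<Sum>B\<in>J. expectation (\<lambda>\<omega>. G \<omega> B ^ 4)) / s"
    using int_f int_4 by (simp add: Bochner_Integration.integral_sum)
  also have "(\<Sum>B\<in>J. expectation (\<lambda>\<omega>. G \<omega> B ^ 4)) / s \<le> (\<Sum>B\<in>J. C\<^sub>2 * (area a b / (real n)\<^sup>2)) / s"
    using exp_4 s by (intro divide_right_mono sum_mono) auto
  also have "\<dots> = C\<^sub>2 * s"
    using n0 s unfolding s(2) by (simp add: J_def power2_eq_square)
  finally show ?thesis by (simp add: G_def)
qed

lemma
  assumes ab: "fst a < fst b" "snd a < snd b"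
  shows truncated_expectation: "(\<lambda>k. expectation (\<lambda>\<omega>. min (passage a b \<omega>) (real k))) \<longlonglongrightarrow>
      expectation (passage a b)"
    and truncated_second_moment: "(\<lambda>k. expectation (\<lambda>\<omega>. (min (passage a b \<omega>) (real k))\<^sup>2)) \<longlonglongrightarrow>
      expectation (\<lambda>\<omega>. (passage a b \<omega>)\<^sup>2)"
proof -
  have ev: "\<forall>\<^sub>F k in sequentially. min x (real k) = x" for x :: real
  proof -
    have "\<forall>\<^sub>F k in sequentially. x \<le> real k" by real_asymp
    then show ?thesis by eventually_elim simp
  qed
  show "(\<lambda>k. expectation (\<lambda>\<omega>. min (passage a b \<omega>) (real k))) \<longlonglongrightarrow> expectation (passage a b)"
  proof (rule integral_dominated_convergence[OF _ _ integrable_passage[OF ab]])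
    show "AE \<omega> in M. (\<lambda>k. min (passage a b \<omega>) (real k)) \<longlonglongrightarrow> passage a b \<omega>"
      using ev by (intro AE_I2 tendsto_eventually)
    show "AE \<omega> in M. norm (min (passage a b \<omega>) (real k)) \<le> passage a b \<omega>" for k
      using passage_nonneg by (intro AE_I2) (auto simp: min_def)
  qed measurable
  show "(\<lambda>k. expectation (\<lambda>\<omega>. (min (passage a b \<omega>) (real k))\<^sup>2)) \<longlonglongrightarrow>
      expectation (\<lambda>\<omega>. (passage a b \<omega>)\<^sup>2)"
  proof (rule integral_dominated_convergence[OF _ _ integrable_passage_square[OF ab]])
    show "AE \<omega> in M. (\<lambda>k. (min (passage a b \<omega>) (real k))\<^sup>2) \<longlonglongrightarrow> (passage a b \<omega>)\<^sup>2"
      using ev by (intro AE_I2 tendsto_power tendsto_eventually)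
    show "AE \<omega> in M. norm ((min (passage a b \<omega>) (real k))\<^sup>2) \<le> (passage a b \<omega>)\<^sup>2" for k
      using passage_nonneg by (intro AE_I2) (auto simp: min_def intro!: power_mono)
  qed measurable
qed

text \<open>Two limits in a fixed order: first the mesh at fixed truncation R, then R to infinity.
  The mean on the right of the grid bound is absorbed by \<open>expectation_passage_le\<close>,
  which gives the factor s sqrt s.\<close>

lemma variance_passage_le:
  assumes ab: "fst a < fst b" "snd a < snd b" and s: "1 \<le> s" "area a b = s\<^sup>2"
  shows "variance (passage a b) \<le> (C\<^sub>1 + C\<^sub>2) * (s * sqrt s)"
proof -
  have trunc: "expectation (\<lambda>\<omega>. (min (passage a b \<omega>) R)\<^sup>2) - (expectation (\<lambda>\<omega>. min (passage a b \<omega>) R))\<^sup>2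
      \<le> sqrt s * (C\<^sub>1 * s) + C\<^sub>2 * s" if R: "0 \<le> R" for R
  proof -
    define h where "h = (\<lambda>x::real. max 0 (min x R))"
    have h: "h \<in> borel_measurable borel" "\<And>x. \<bar>h x\<bar> \<le> R"
      using R unfolding h_def by (measurable, auto)
    have h2: "(\<lambda>x. (h x)\<^sup>2) \<in> borel_measurable borel" "\<And>x. \<bar>(h x)\<^sup>2\<bar> \<le> R\<^sup>2"
      using h(1) by measurable (rule square_bound[OF h(2)])
    have hm: "h (min x R) = min x R" if "0 \<le> x" for x using that R by (simp add: h_def)
    define g where "g n \<omega> = min (grid_passage n (grid_weights a b n \<omega>)) R" for n \<omega>
    have l1: "(\<lambda>n. expectation (g n)) \<longlonglongrightarrow> expectation (\<lambda>\<omega>. min (passage a b \<omega>) R)"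
      using truncated_limit[OF ab h, of R] passage_nonneg grid_passage_nonneg
      by (simp add: hm g_def[abs_def] cong: Bochner_Integration.integral_cong)
    have l2: "(\<lambda>n. expectation (\<lambda>\<omega>. (g n \<omega>)\<^sup>2)) \<longlonglongrightarrow> expectation (\<lambda>\<omega>. (min (passage a b \<omega>) R)\<^sup>2)"
      using truncated_limit[OF ab h2, of R] passage_nonneg grid_passage_nonneg
      by (simp add: hm g_def[abs_def] cong: Bochner_Integration.integral_cong)
    have "expectation (\<lambda>\<omega>. (min (passage a b \<omega>) R)\<^sup>2) - (expectation (\<lambda>\<omega>. min (passage a b \<omega>) R))\<^sup>2
        \<le> sqrt s * expectation (\<lambda>\<omega>. min (passage a b \<omega>) R) + C\<^sub>2 * s"
    proof (rule tendsto_le[OF sequentially_bot])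
      show "(\<lambda>n. expectation (\<lambda>\<omega>. (g n \<omega>)\<^sup>2) - (expectation (g n))\<^sup>2) \<longlonglongrightarrow>
        expectation (\<lambda>\<omega>. (min (passage a b \<omega>) R)\<^sup>2) - (expectation (\<lambda>\<omega>. min (passage a b \<omega>) R))\<^sup>2"
        by (intro tendsto_intros l1 l2)
      show "(\<lambda>n. sqrt s * expectation (g n) + C\<^sub>2 * s) \<longlonglongrightarrow>
        sqrt s * expectation (\<lambda>\<omega>. min (passage a b \<omega>) R) + C\<^sub>2 * s"
        by (intro tendsto_intros l1)
      have "\<forall>\<^sub>F n in sequentially. s \<le> real n" by real_asymp
      then show "\<forall>\<^sub>F n in sequentially. expectation (\<lambda>\<omega>. (g n \<omega>)\<^sup>2) - (expectation (g n))\<^sup>2 \<le>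
          sqrt s * expectation (g n) + C\<^sub>2 * s"
      proof eventually_elim
        case (elim n)
        show ?case using truncated_grid_variance[OF ab s elim R] by (simp add: g_def[abs_def])
      qed
    qed
    also have "expectation (\<lambda>\<omega>. min (passage a b \<omega>) R) \<le> expectation (passage a b)"
    proof (rule integral_mono)
      show "integrable M (\<lambda>\<omega>. min (passage a b \<omega>) R)"
        using integrable_passage[OF ab] by (intro integrable_min) auto
    qed (use integrable_passage[OF ab] in auto)
    also have "\<dots> \<le> C\<^sub>1 * s" by (rule expectation_passage_le[OF ab s])
    finally show ?thesis using s by simp
  qed
  have "expectation (\<lambda>\<omega>. (passage a b \<omega>)\<^sup>2) - (expectation (passage a b))\<^sup>2 \<le> sqrt s * (C\<^sub>1 * s) + C\<^sub>2 * s"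
  proof (rule tendsto_upperbound)
    show "(\<lambda>k. expectation (\<lambda>\<omega>. (min (passage a b \<omega>) (real k))\<^sup>2) -
        (expectation (\<lambda>\<omega>. min (passage a b \<omega>) (real k)))\<^sup>2) \<longlonglongrightarrow>
        expectation (\<lambda>\<omega>. (passage a b \<omega>)\<^sup>2) - (expectation (passage a b))\<^sup>2"
      by (intro tendsto_intros truncated_expectation truncated_second_moment ab)
  qed (use trunc in auto)
  also have "\<dots> \<le> (C\<^sub>1 + C\<^sub>2) * (s * sqrt s)"
  proof -
    have "s \<le> s * sqrt s" using s mult_left_mono[of 1 "sqrt s" s] by simp
    then have "C\<^sub>2 * s \<le> C\<^sub>2 * (s * sqrt s)" using C2_nonneg by (rule mult_left_mono)
    moreover have "(C\<^sub>1 + C\<^sub>2) * (s * sqrt s) = sqrt s * (C\<^sub>1 * s) + C\<^sub>2 * (s * sqrt s)"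
      by (simp add: algebra_simps)
    ultimately show ?thesis by linarith
  qed
  finally show ?thesis
    using variance_eq[OF integrable_passage[OF ab] integrable_passage_square[OF ab]] by simp
qed

end

section \<open>The law of large numbers for last-passage times\<close>

context exp_weighted_poisson_process
begin

abbreviation \<gamma> :: real where "\<gamma> \<equiv> lpp_gamma M p w"

section \<open>Convergence of the mean passage times\<close>

definition mean_passage :: "real \<Rightarrow> real" where
  "mean_passage s = expectation (passage (0, 0) (s, s))"

lemma passage_mono:
  assumes "\<omega> \<in> space M" "a' \<le> a" "b \<le> b'"
  shows "passage a b \<omega> \<le> passage a' b' \<omega>"
  unfolding passage_def
  by (rule weighted_configuration.last_passage_mono[OF configuration]) fact+

lemma expectation_passage_eq:
  assumes ab: "fst a < fst b" "snd a < snd b" and s: "0 < s" "area a b = s\<^sup>2"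
  shows "expectation (passage a b) = mean_passage s"
proof -
  have s': "fst (0::real, 0::real) < fst (s, s)" "snd (0::real, 0::real) < snd (s, s)" using s by auto
  have "area a b = area (0, 0) (s, s)" using s by (simp add: power2_eq_square)
  then have "expectation (\<lambda>\<omega>. min (passage a b \<omega>) (real k)) =
      expectation (\<lambda>\<omega>. min (passage (0, 0) (s, s) \<omega>) (real k))" for k
    by (intro truncated_area_invariant[OF ab s']) auto
  then show ?thesis
    using truncated_expectation[OF ab] truncated_expectation[OF s'] unfolding mean_passage_def
    by (auto intro: LIMSEQ_unique)
qed

lemma integrable_square_passage: "0 < s \<Longrightarrow> integrable M (passage (0, 0) (s, s))"
  by (rule integrable_passage) auto

lemma mean_passage_nonneg: "0 \<le> mean_passage s"
  unfolding mean_passage_def using passage_nonneg by (intro integral_nonneg_AE AE_I2)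

lemma mean_passage_mono:
  assumes "0 < s" "s \<le> s'" shows "mean_passage s \<le> mean_passage s'"
  unfolding mean_passage_def
  using assms by (intro integral_mono integrable_square_passage passage_mono) auto

text \<open>Squares placed corner to corner on the diagonal; the shifted square has the same mean
  because its area is the same.\<close>

lemma mean_passage_superadditive:
  assumes "0 < s" shows "real m * mean_passage s \<le> mean_passage (real m * s)"
proof (induction m)
  case 0
  then show ?case using mean_passage_nonneg by simp
next
  case (Suc m)
  show ?case
  proof (cases "m = 0")
    case True
    then show ?thesis by simp
  next
    case False
    define u where "u = real m * s"
    have u: "0 < u" using False assms by (simp add: u_def)
    have int: "integrable M (passage (u, u) (u + s, u + s))"
      using assms by (intro integrable_passage) auto
    have shift: "expectation (passage (u, u) (u + s, u + s)) = mean_passage s"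
      using assms by (intro expectation_passage_eq) (auto simp: power2_eq_square)
    have "mean_passage u + mean_passage s =
        expectation (\<lambda>\<omega>. passage (0, 0) (u, u) \<omega> + passage (u, u) (u + s, u + s) \<omega>)"
      using int integrable_square_passage[OF u] by (simp add: shift mean_passage_def[of u])
    also have "\<dots> \<le> mean_passage (u + s)"
      unfolding mean_passage_def
    proof (rule integral_mono)
      fix \<omega> assume \<omega>: "\<omega> \<in> space M"
      show "passage (0, 0) (u, u) \<omega> + passage (u, u) (u + s, u + s) \<omega> \<le> passage (0, 0) (u + s, u + s) \<omega>"
        unfolding passage_def using u assms
        by (intro weighted_configuration.last_passage_superadditive[OF configuration[OF \<omega>]]) auto
    qed (use int u assms integrable_square_passage in auto)
    finally show ?thesis using Suc by (simp add: u_def algebra_simps)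
  qed
qed

lemma gamma_eq: "\<gamma> = (SUP n\<in>{1::nat..}. mean_passage (real n) / real n)"
  unfolding lpp_gamma_def mean_passage_def passage_def ..

lemma mean_passage_le_gamma:
  assumes "1 \<le> n" shows "mean_passage (real n) \<le> \<gamma> * real n"
proof -
  have "mean_passage (real n) / real n \<le> C\<^sub>1" if "1 \<le> n" for n :: nat
    using expectation_passage_le[of "(0, 0)" "(real n, real n)" "real n"] that
    by (simp add: mean_passage_def power2_eq_square divide_le_eq)
  then have "bdd_above ((\<lambda>n. mean_passage (real n) / real n) ` {1::nat..})"
    by (intro bdd_aboveI2[of _ _ "C\<^sub>1"]) auto
  then have "mean_passage (real n) / real n \<le> \<gamma>"
    unfolding gamma_eq using assms by (intro cSUP_upper) auto
  then show ?thesis using assms by (simp add: divide_le_eq)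
qed

lemma gamma_nonneg: "0 \<le> \<gamma>"
  using mean_passage_le_gamma[of 1] mean_passage_nonneg[of 1] by simp

text \<open>Fekete's argument for real s. From below, s contains floor (s / n) squares of side n for
  an n that nearly attains the supremum; from above, s is rounded up to an integer, where the
  supremum itself is the bound.\<close>

lemma mean_passage_limit: "((\<lambda>s. mean_passage s / s) \<longlongrightarrow> \<gamma>) at_top"
proof (rule order_tendstoI)
  fix l assume "l < \<gamma>"
  then obtain n :: nat where n: "1 \<le> n" "l < mean_passage (real n) / real n"
    unfolding gamma_eq by (subst (asm) less_cSUP_iff)
      (auto intro!: bdd_aboveI2[of _ _ \<gamma>] simp: divide_le_eq mean_passage_le_gamma)
  have "((\<lambda>s. (1 / real n - 1 / s) * mean_passage (real n)) \<longlongrightarrow>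
      (1 / real n - 0) * mean_passage (real n)) at_top"
    by (intro tendsto_intros) real_asymp
  from order_tendstoD(1)[OF this, of l] n
  have "\<forall>\<^sub>F s in at_top. l < (1 / real n - 1 / s) * mean_passage (real n)" by simp
  then show "\<forall>\<^sub>F s in at_top. l < mean_passage s / s"
    using eventually_ge_at_top[of "real n"]
  proof eventually_elim
    case (elim s)
    define m where "m = nat \<lfloor>s / real n\<rfloor>"
    have s: "0 < s" using elim n by linarith
    have "0 \<le> s / real n" using s by simp
    then have m: "s / real n - 1 \<le> real m" "real m \<le> s / real n" unfolding m_def by linarith+
    have "1 \<le> s / real n" using elim n by (simp add: le_divide_eq)
    then have "0 < m" unfolding m_def by linarith
    have "(1 / real n - 1 / s) * mean_passage (real n) * s = (s / real n - 1) * mean_passage (real n)"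
      using s by (simp add: field_simps)
    also have "\<dots> \<le> real m * mean_passage (real n)"
      using m mean_passage_nonneg by (intro mult_right_mono)
    also have "\<dots> \<le> mean_passage (real m * real n)"
      using n by (intro mean_passage_superadditive) simp
    also have "\<dots> \<le> mean_passage s"
      using m n \<open>0 < m\<close> by (intro mean_passage_mono) (auto simp: le_divide_eq)
    finally have "(1 / real n - 1 / s) * mean_passage (real n) \<le> mean_passage s / s"
      using s by (simp add: le_divide_eq)
    then show ?case using elim by simp
  qed
next
  fix u assume u: "\<gamma> < u"
  have "((\<lambda>s. \<gamma> * ((s + 1) / s)) \<longlongrightarrow> \<gamma> * 1) at_top" by (intro tendsto_intros) real_asymp
  from order_tendstoD(2)[OF this, of u] u
  have "\<forall>\<^sub>F s in at_top. \<gamma> * ((s + 1) / s) < u" by simp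
  then show "\<forall>\<^sub>F s in at_top. mean_passage s / s < u"
    using eventually_ge_at_top[of 1]
  proof eventually_elim
    case (elim s)
    define n where "n = nat \<lceil>s\<rceil>"
    have n: "s \<le> real n" "real n \<le> s + 1" "1 \<le> n" using elim(2) unfolding n_def by linarith+
    have "mean_passage s \<le> mean_passage (real n)" using n elim by (intro mean_passage_mono) auto
    also have "\<dots> \<le> \<gamma> * real n" by (rule mean_passage_le_gamma) fact
    also have "\<dots> \<le> \<gamma> * (s + 1)" using n gamma_nonneg by (intro mult_left_mono)
    finally have "mean_passage s / s \<le> \<gamma> * ((s + 1) / s)"
      using elim(2) by (simp add: divide_right_mono)
    then show ?case using elim(1) by simp
  qed
qed

text \<open>The rectangle has the area of a square of side c T with c = sqrt (b - a); this is the
  source of the factor sqrt (b - a). The means then converge, and the deviations from them are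
  handled by Chebyshev and Borel--Cantelli.\<close>

lemma passage_limit:
  assumes ab: "a < b"
  defines "T \<equiv> \<lambda>j. real (Suc j) ^ 4"
  shows "AE \<omega> in M. (\<lambda>j. passage (a * T j, 0) (b * T j, T j) \<omega> / T j) \<longlonglongrightarrow> \<gamma> * sqrt (b - a)"
proof -
  define c where "c = sqrt (b - a)"
  have c: "0 < c" "c * c = b - a" using ab by (auto simp: c_def)
  define X where "X j = passage (a * T j, 0) (b * T j, T j)" for j
  have T: "0 < T j" for j by (simp add: T_def)
  have rect: "fst (a * T j, 0::real) < fst (b * T j, T j)" "snd (a * T j, 0::real) < snd (b * T j, T j)"
    for j using ab T[of j] by auto
  have area: "area (a * T j, 0) (b * T j, T j) = (c * T j)\<^sup>2" for j
    using c(2) by (simp add: power2_eq_square left_diff_distrib[symmetric] mult.assoc)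
  have EX: "expectation (X j) = mean_passage (c * T j)" for j
    unfolding X_def using c T[of j] by (intro expectation_passage_eq rect area) simp
  have top: "filterlim (\<lambda>j. c * T j) at_top sequentially" using c unfolding T_def by real_asymp
  have "(\<lambda>j. c * (mean_passage (c * T j) / (c * T j))) \<longlonglongrightarrow> c * \<gamma>"
    by (intro tendsto_intros filterlim_compose[OF mean_passage_limit top])
  then have mean: "(\<lambda>j. expectation (X j) / T j) \<longlonglongrightarrow> \<gamma> * c"
    using c by (simp add: EX mult.commute)
  have dev: "AE \<omega> in M. \<forall>\<^sub>F j in sequentially. \<bar>X j \<omega> - expectation (X j)\<bar> < \<delta> * T j"
    if \<delta>: "0 < \<delta>" for \<delta>
  proof -
    define A where "A j = {\<omega> \<in> space M. \<bar>X j \<omega> - expectation (X j)\<bar> \<ge> \<delta> * T j}" for j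
    have [measurable]: "X j \<in> borel_measurable M" for j unfolding X_def by measurable
    define K where "K = (C\<^sub>1 + C\<^sub>2) * c * sqrt c / \<delta>\<^sup>2"
    have bound: "prob (A j) \<le> K * inverse (real (Suc j) ^ 2)" if "1 \<le> c * T j" for j
    proof -
      have "prob (A j) \<le> variance (X j) / (\<delta> * T j)\<^sup>2"
        unfolding A_def X_def using \<delta> T[of j]
        by (intro Chebyshev_inequality integrable_passage_square rect) auto
      also have "\<dots> \<le> (C\<^sub>1 + C\<^sub>2) * (c * T j * sqrt (c * T j)) / (\<delta> * T j)\<^sup>2"
        unfolding X_def by (intro divide_right_mono variance_passage_le rect that area) simp
      also have "\<dots> = K * inverse (real (Suc j) ^ 2)"
      proof -
        \<comment> \<open>As \<open>T j\<close> is the square of \<open>q\<close>, the root in the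
          variance bound becomes \<open>q\<close> and the quotient is a multiple of 1/q.\<close>
        define q where "q = real (Suc j) ^ 2"
        have q: "0 < q" "T j = q * q" by (simp_all add: q_def T_def power_add[symmetric])
        then have "sqrt (c * T j) = sqrt c * q" by (simp add: real_sqrt_mult)
        then show ?thesis unfolding q_def[symmetric] K_def using q \<delta>
          by (simp add: field_simps power2_eq_square)
      qed
      finally show ?thesis .
    qed
    have "\<forall>\<^sub>F j in sequentially. 1 \<le> c * T j" using top by (simp add: filterlim_at_top)
    then have ev: "\<forall>\<^sub>F j in sequentially. norm (prob (A j)) \<le> K * inverse (real (Suc j) ^ 2)"
      by eventually_elim (simp add: bound del: of_nat_Suc)
    have "summable (\<lambda>j. inverse (real (Suc j) ^ 2))"
      using inverse_power_summable[of 2, where 'a = real] by (subst summable_Suc_iff) simp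
    then have "summable (\<lambda>j. prob (A j))"
      by (intro summable_comparison_test_ev[OF ev] summable_mult)
    then have "AE \<omega> in M. \<forall>\<^sub>F j in sequentially. \<omega> \<in> space M - A j"
      by (intro borel_cantelli_AE1) (auto simp: A_def emeasure_eq_measure)
    then show ?thesis
    proof eventually_elim
      case (elim \<omega>)
      then show ?case by eventually_elim (auto simp: A_def not_le)
    qed
  qed
  \<comment> \<open>Countably many tolerances suffice, so that one null set serves all of
    them.\<close>
  have "AE \<omega> in M. \<forall>k. \<forall>\<^sub>F j in sequentially. \<bar>X j \<omega> - expectation (X j)\<bar> < inverse (real (Suc k)) * T j"
    unfolding AE_all_countable by (intro allI dev) simp
  then show ?thesis
  proof eventually_elim
    case (elim \<omega>)
    have "(\<lambda>j. (X j \<omega> - expectation (X j)) / T j) \<longlonglongrightarrow> 0"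
    proof (rule tendstoI)
      fix e :: real assume "0 < e"
      from reals_Archimedean[OF this] obtain k where k: "inverse (real (Suc k)) < e" ..
      have "\<forall>\<^sub>F j in sequentially. \<bar>X j \<omega> - expectation (X j)\<bar> < inverse (real (Suc k)) * T j"
        using elim by blast
      then show "\<forall>\<^sub>F j in sequentially. dist ((X j \<omega> - expectation (X j)) / T j) 0 < e"
      proof eventually_elim
        case (elim j)
        have "\<bar>X j \<omega> - expectation (X j)\<bar> / T j < inverse (real (Suc k))"
          using elim T[of j] by (simp add: divide_less_eq del: of_nat_Suc)
        then show ?case using k T[of j] by (simp add: dist_real_def abs_divide)
      qed
    qed
    from tendsto_add[OF this mean] show ?case
      by (simp add: X_def c_def add_divide_distrib[symmetric])
  qed
qed

end

section \<open>The second-class particle\<close>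

text \<open>The moment hypothesis is stated for the measure generated by F, the estimates for the
  law of a weight; both have distribution function F.\<close>

lemma (in weighted_poisson_process) interval_measure_weight: "interval_measure F = weight_law"
proof -
  have W: "real_distribution weight_law"
    unfolding weight_law_def by (rule real_distribution_distr) simp
  have F: "F = cdf weight_law" unfolding weight_law_def by (rule weights_distribution[symmetric])
  interpret W: real_distribution weight_law by fact
  have nd: "\<And>x y. x \<le> y \<Longrightarrow> F x \<le> F y" unfolding F by (rule W.cdf_nondecreasing)
  have rc: "\<And>a. continuous (at_right a) F" unfolding F by (rule W.cdf_is_right_cont)
  have lb: "(F \<longlongrightarrow> 0) at_bot" unfolding F by (rule W.cdf_lim_at_bot)
  have lt: "(F \<longlongrightarrow> 1) at_top" unfolding F by (rule W.cdf_lim_at_top_prob)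
  have I: "real_distribution (interval_measure F)"
    by (rule real_distribution_interval_measure[OF nd rc lb lt])
  have c: "cdf (interval_measure F) = F"
    by (rule cdf_interval_measure[OF nd rc lb])
  show ?thesis by (rule cdf_unique[OF I W trans[OF c F]])
qed

theorem theorem7p4:
  fixes M :: "'a measure"
    and p :: "nat \<Rightarrow> 'a \<Rightarrow> real \<times> real"
    and w :: "nat \<Rightarrow> 'a \<Rightarrow> real"
    and F :: "real \<Rightarrow> real"
    and \<nu> :: "real measure"
    and \<alpha> \<epsilon> :: real
  assumes "weighted_poisson_process M p w F"
    and "\<exists>a>0. set_integrable (interval_measure F) {0..} (\<lambda>x. exp (a * x))"
    and "\<epsilon> > 0"
    and "pi < \<alpha>" and "\<alpha> < 3 * pi / 2"
    and "\<nu> \<in> fluid_measures"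
    and "((\<lambda>x. mass_function \<nu> x / x) \<longlongrightarrow> lpp_gamma M p w / 2 * sqrt (tan \<alpha>)) at_top"
    and "((\<lambda>x. mass_function \<nu> x / x) \<longlongrightarrow> lpp_gamma M p w / 2 * sqrt (tan \<alpha>)) at_bot"
  shows "AE \<omega> in M.
    ((\<lambda>t. second_class_particle (\<lambda>i. p i \<omega>) (\<lambda>i. w i \<omega>) \<epsilon> \<nu> t / ereal t)
      \<longlongrightarrow> ereal (1 / tan \<alpha>)) at_top"
proof -
  interpret weighted_poisson_process M p w F by fact
  obtain \<theta> where \<theta>: "0 < \<theta>" "set_integrable (interval_measure F) {0..} (\<lambda>x. exp (\<theta> * x))"
    using assms(2) by blast
  interpret law: prob_space weight_law by (rule weight_law_prob)
  \<comment> \<open>The moment hypothesis integrates over the nonnegative half-line; positive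
    weights make the restriction invisible, and they also give \<phi> at least 1.\<close>
  have AE_pos: "AE x in weight_law. 0 < x"
    unfolding weight_law_def using weights_positive by (subst AE_distr_iff) auto
  have int: "integrable weight_law (\<lambda>x. exp (\<theta> * x))"
  proof -
    have "integrable weight_law (\<lambda>x. indicator {0..} x *\<^sub>R exp (\<theta> * x))"
      using \<theta>(2) by (simp add: set_integrable_def interval_measure_weight)
    moreover have "AE x in weight_law. indicator {0..} x *\<^sub>R exp (\<theta> * x) = exp (\<theta> * x)"
      using AE_pos by eventually_elim auto
    moreover have "(\<lambda>x. exp (\<theta> * x)) \<in> borel_measurable weight_law"
      by (simp add: measurable_cong_sets[OF sets_weight_law refl])
    ultimately show ?thesis
      by (subst (asm) integrable_cong_AE) (auto simp: measurable_cong_sets[OF sets_weight_law refl])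
  qed
  define \<phi> where "\<phi> = (\<integral>x. exp (\<theta> * x) \<partial>weight_law)"
  have nn: "(\<integral>\<^sup>+x. ennreal (exp (\<theta> * x)) \<partial>weight_law) = ennreal \<phi>"
    unfolding \<phi>_def by (rule nn_integral_eq_integral[OF int]) simp
  have "law.expectation (\<lambda>_. 1) \<le> \<phi>"
    unfolding \<phi>_def using AE_pos \<theta>(1) by (intro integral_mono_AE int) auto
  then have "1 \<le> \<phi>" by (simp add: law.prob_space)
  interpret exp_weighted_poisson_process M p w F \<theta> \<phi>
    using \<theta>(1) \<open>1 \<le> \<phi>\<close> nn by unfold_locales
  define c\<^sub>0 where "c\<^sub>0 = 1 / tan \<alpha>"
  define \<rho> where "\<rho> = lpp_gamma M p w / 2 * sqrt (tan \<alpha>)"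
  have tan: "0 < tan \<alpha>"
  proof -
    \<comment> \<open>The tangent has period pi, and \<alpha> - pi lies in the first
      quadrant.\<close>
    have "0 < tan (\<alpha> - pi)" using assms(4,5) by (intro tan_gt_zero) auto
    then show ?thesis by (simp add: tan_def cos_diff sin_diff)
  qed
  then have c0: "0 < c\<^sub>0" by (simp add: c\<^sub>0_def)
  have \<gamma>: "2 * \<rho> * sqrt c\<^sub>0 = lpp_gamma M p w"
    using tan by (simp add: \<rho>_def c\<^sub>0_def real_sqrt_divide)
  \<comment> \<open>Positivity of the slope is read off from the liminf condition in
    \<open>fluid_measures\<close>, since the limit at minus infinity equals that liminf.\<close>
  have \<rho>: "0 < \<rho>"
  proof -
    have "((\<lambda>y. ereal (mass_function \<nu> y / y)) \<longlongrightarrow> ereal \<rho>) at_bot"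
      using assms(8) by (simp add: \<rho>_def)
    then have "Liminf at_bot (\<lambda>y. ereal (mass_function \<nu> y / y)) = ereal \<rho>"
      by (rule lim_imp_Liminf[rotated]) simp
    then show ?thesis using assms(6) by (simp add: fluid_measures_def)
  qed
  \<comment> \<open>One null set for all pairs of rational endpoints; after this the argument runs
    pathwise.\<close>
  have "AE \<omega> in M. \<forall>a\<in>\<rat>. \<forall>b\<in>\<rat>. a < b \<longrightarrow> (\<lambda>j. passage (a * real (Suc j) ^ 4, 0)
      (b * real (Suc j) ^ 4, real (Suc j) ^ 4) \<omega> / real (Suc j) ^ 4) \<longlonglongrightarrow> lpp_gamma M p w * sqrt (b - a)"
  proof (intro AE_ball_countable[THEN iffD2] countable_rat ballI)
    fix a b :: real
    show "AE \<omega> in M. a < b \<longrightarrow> (\<lambda>j. passage (a * real (Suc j) ^ 4, 0)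
      (b * real (Suc j) ^ 4, real (Suc j) ^ 4) \<omega> / real (Suc j) ^ 4) \<longlonglongrightarrow> lpp_gamma M p w * sqrt (b - a)"
      using passage_limit[of a b] by (cases "a < b") simp_all
  qed
  then show ?thesis using AE_space
  proof eventually_elim
    case (elim \<omega>)
    interpret C: weighted_configuration "\<lambda>i. p i \<omega>" "\<lambda>i. w i \<omega>" by (rule configuration[OF elim(2)])
    have "C.uniform_passage (lpp_gamma M p w) sequentially (\<lambda>j. real (Suc j) ^ 4)"
    proof (rule C.uniform_passage_rational)
      fix a b :: real assume "a \<in> \<rat>" "b \<in> \<rat>" "a < b"
      then show "(\<lambda>j. C.passage_time (real (Suc j) ^ 4) (a * real (Suc j) ^ 4) (b * real (Suc j) ^ 4) /
          real (Suc j) ^ 4) \<longlonglongrightarrow> lpp_gamma M p w * sqrt (b - a)"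
        using elim(1) unfolding C.passage_time_def passage_def by blast
    qed (simp_all add: gamma_nonneg)
    then have "C.uniform_passage (2 * \<rho> * sqrt c\<^sub>0) at_top (\<lambda>t. t)"
      unfolding \<gamma> by (rule C.uniform_passage_interpolate) (rule gamma_nonneg)
    then show ?case unfolding c\<^sub>0_def[symmetric]
      by (rule C.second_class_speed[OF _ \<rho> c0 assms(6,3)]) (use assms(7,8) in \<open>simp_all add: \<rho>_def\<close>)
  qed
qed

end
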